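(* Let $d=1$, $\nu=1/2$, $\mathcal S=[0,1]$, $Y=X$ (no regression terms), and let $\mathcal S_n=\{s_1,\ldots,s_n\}$ with $s_i=i/n$, $i=1,\ldots,n$. Then, with $$\varsigma_n=3n^{-1/2+(\overline\kappa+\underline\kappa/2)},$$ one has $\varsigma_n\to0$ and, for all sufficiently large $n$, $$\sup_{\alpha\in[\underline\alpha_n,\overline\alpha_n]}\max\Big\{\sup_{s^*\in\mathcal S\setminus\mathcal S_n}\Big|\tfrac{E_{(\theta_0/\alpha^{2\nu},\alpha)}\{e_n(s^*;\alpha)^2\}}{E_{(\sigma_0^2,\alpha_0)}\{e_n(s^*;\alpha)^2\}}-1\Big|,\ \sup_{s^*\in\mathcal S\setminus\mathcal S_n}\Big|\tfrac{E_{(\theta_0/\alpha^{2\nu},\alpha)}\{e_n(s^*;\alpha)^2\}}{E_{(\sigma_0^2,\alpha_0)}\{e_n(s^*;\alpha_0)^2\}}-1\Big|\Big\}\le\varsigma_n .$$ As a result, assume in addition that: (1) $\pi(\theta|\alpha)$ is a proper density in $\theta\in(0,\infty)$, continuously differentiable in $\theta$, continuous in $\alpha$, finite for all $\theta,\alpha\in(0,\infty)$, not depending on $n$, with $\pi(\theta_0|\alpha)>0$ for all $\alpha>0$; (2) there exist positive constants $C_{\pi,1},C_{\pi,2},C_{\pi,3}$ (which may depend on $\alpha_0,\theta_0$) with $C_{\pi,1}+C_{\pi,2}<1/2$ and $C_{\pi,3}<1$ such that for all sufficiently large $n$, $$\sup_{\alpha\in[\underline\alpha_n,\overline\alpha_n]}\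 \sup_{\theta\in(\theta_0/2,2\theta_0)}\Big|\frac{\partial\log\pi(\theta|\alpha)}{\partial\theta}\Big|\le n^{C_{\pi,1}},\quad \sup_{\alpha\in[\underline\alpha_n,\overline\alpha_n]}\ \sup_{\theta\in(\theta_0/2,2\theta_0)}\frac{\pi(\theta|\alpha)}{\pi(\theta_0|\alpha)}\le n^{C_{\pi,2}},\quad \inf_{\alpha\in[\underline\alpha_n,\overline\alpha_n]}\log\pi(\theta_0|\alpha)\ge -n^{C_{\pi,3}};$$ (3) $\pi(\alpha)$ is a proper continuous density on $(0,\infty)$ not depending on $n$, $\pi(\alpha_0)>0$, $\int_0^\infty\pi(\theta_0|\alpha)\pi(\alpha)d\alpha<\infty$, and there exist positive constants $\underline{c_\pi}<(\nu+d/2)\underline\kappa$ and $\overline{c_\pi}<(\nu+d/2)\overline\kappa$ (here $\nu+d/2=1$) such that for all sufficiently large $n$, $$\max\Big\{\int_0^{\underline\alpha_n}\alpha^{-n(\nu+d/2)}\pi(\alpha)d\alpha,\ \int_0^{\underline\alpha_n}\alpha^{-n(\nu+d/2)}\pi(\theta_0|\alpha)\pi(\alpha)d\alpha\Big\}\le\exp(\underline{c_\pi}\,n\log n),$$ $$\max\Big\{\int_{\overline\alpha_n}^\infty\alpha^{n(\nu+d/2)}\pi(\alpha)d\alpha,\ \int_{\overline\alpha_n}^\infty\alpha^{n(\nu+d/2)}\pi(\theta_0|\alpha)\pi(\alpha)d\alpha\Big\}\le\exp(\overline{c_\pi}\,n\log n);$$ (4) $\sup_{s^*\in\mathcal S}\min_{1\le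 i\le n}|s^*-s_i|\to0$ as $n\to\infty$ (which holds for this grid). Then, as $n\to\infty$, almost surely $P_{(\sigma_0^2,\alpha_0)}$, $$\Pi\Big[\sup_{s^*\in\mathcal S\setminus\mathcal S_n}\Big|\tfrac{E_{(\sigma^2,\alpha)}\{e_n(s^*;\alpha)^2\}}{E_{(\sigma_0^2,\alpha_0)}\{e_n(s^*;\alpha)^2\}}-1\Big|>6n^{-1/2+(\overline\kappa+\underline\kappa/2)}\ \Big|\ Y_n\Big]\to0,$$ $$\Pi\Big[\sup_{s^*\in\mathcal S\setminus\mathcal S_n}\Big|\tfrac{E_{(\sigma^2,\alpha)}\{e_n(s^*;\alpha)^2\}}{E_{(\sigma_0^2,\alpha_0)}\{e_n(s^*;\alpha_0)^2\}}-1\Big|>6n^{-1/2+(\overline\kappa+\underline\kappa/2)}\ \Big|\ Y_n\Big]\to0.$$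
   Context: $K_{\alpha,\nu}(x)=\exp(-\alpha|x|)$ (Matérn with $\nu=1/2$). $X$ is a mean-zero Gaussian process on $[0,1]$; $E_{(\sigma^2,\alpha)}$ and $P_{(\sigma^2,\alpha)}$ refer to the covariance $\sigma^2\exp(-\alpha|s-t|)$. The fixed true parameters are $\sigma_0^2,\alpha_0>0$; $\theta_0=\sigma_0^2\alpha_0^{2\nu}=\sigma_0^2\alpha_0$. $Y_n=(Y(s_1),\ldots,Y(s_n))^\top$, $R_\alpha$ is the matrix with entries $\exp(-\alpha|s_i-s_j|)$. The log-likelihood is $\mathcal L_n(\sigma^2,\alpha)=-\frac{1}{2\sigma^2}Y_n^\top R_\alpha^{-1}Y_n-\frac n2\log\sigma^2-\frac12\log|R_\alpha|$. With $\theta=\sigma^2\alpha^{2\nu}$, the prior of $(\theta,\alpha)$ has density $\pi(\theta|\alpha)\pi(\alpha)$, and under $\Pi(\cdot|Y_n)$, $(\theta,\alpha)$ has density proportional to $\exp\{\mathcal L_n(\theta/\alpha^{2\nu},\alpha)\}\pi(\theta|\alpha)\pi(\alpha)$, with $\sigma^2=\theta/\alpha^{2\nu}$. Prediction: $r_\alpha(s^* )=(K_{\alpha,\nu}(s_1-s^* ),\ldots,K_{\alpha,\nu}(s_n-s^* ))^\top$, $\widehat Y(s^*;\alpha)=r_\alpha(s^* )^\top R_\alpha^{-1}Y_n$, $e_n(s^*;\alpha)=\widehat Y(s^*;\alpha)-Y(s^* )$. Thus $E_{(\sigma^2,\alpha)}\{e_n(s^*;\alpha)^2\}=\sigma^2\{1-r_\alpha(s^*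 )^\top R_\alpha^{-1}r_\alpha(s^* )\}$ and $E_{(\sigma_0^2,\alpha_0)}\{e_n(s^*;\alpha)^2\}=\sigma_0^2\{1-2r_\alpha(s^* )^\top R_\alpha^{-1}r_{\alpha_0}(s^* )+r_\alpha(s^* )^\top R_\alpha^{-1}R_{\alpha_0}R_\alpha^{-1}r_\alpha(s^* )\}$. Constants (with $d=1$, $\nu=1/2$): $\underline\alpha_n=n^{-\underline\kappa}$, $\overline\alpha_n=n^{\overline\kappa}$, with $$\underline\kappa=\tfrac12\min\Big\{\tfrac{0.9}{(2d+0.94)(8\nu+3d-0.9)},\tfrac{1}{4(3\nu+d)},0.01\Big\},\qquad \overline\kappa=\tfrac12\min\Big\{\tfrac{0.9}{(2d+0.94)(8\nu+5d+0.9)},\tfrac{1}{2(2\nu+d)},0.01\Big\}.$$ *)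

theory Defs
  imports
    "HOL-Probability.Probability"
    "Jordan_Normal_Form.Determinant"
    "Jordan_Normal_Form.Gauss_Jordan_Elimination"
begin

text \<open>Normal random variables; the second disjunct is the degenerate law of variance zero.\<close>

definition gaussian_rv :: "'a measure \<Rightarrow> ('a \<Rightarrow> real) \<Rightarrow> bool" where
  "gaussian_rv M Z \<longleftrightarrow>
     (\<exists>\<mu>. (\<exists>\<sigma>>0. distributed M lborel Z (\<lambda>x. ennreal (normal_density \<mu> \<sigma> x)))
        \<or> (Z \<in> borel_measurable M \<and> (AE \<omega> in M. Z \<omega> = \<mu>)))"

definition centered_gaussian_process ::
    "'a measure \<Rightarrow> real set \<Rightarrow> (real \<Rightarrow> 'a \<Rightarrow> real) \<Rightarrow> (real \<Rightarrow> real \<Rightarrow> real) \<Rightarrow> bool" where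
  "centered_gaussian_process M T X k \<longleftrightarrow>
     prob_space M \<and>
     (\<forall>F c. finite F \<and> F \<subseteq> T \<longrightarrow> gaussian_rv M (\<lambda>\<omega>. \<Sum>s\<in>F. c s * X s \<omega>)) \<and>
     (\<forall>s\<in>T. prob_space.expectation M (X s) = 0) \<and>
     (\<forall>s\<in>T. \<forall>t\<in>T. prob_space.expectation M (\<lambda>\<omega>. X s \<omega> * X t \<omega>) = k s t)"

text \<open>Matern correlation function with smoothness \<open>\<nu> = 1/2\<close>; hence \<open>\<alpha>\<close> stands for
  \<open>\<alpha>\<close> to the power \<open>2 * \<nu>\<close> throughout, and the microergodic parameter is
  \<open>\<theta> = \<sigma>\<^sup>2 * \<alpha>\<close>.\<close>

definition matern :: "real \<Rightarrow> real \<Rightarrow> real" where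
  "matern \<alpha> x = exp (- \<alpha> * \<bar>x\<bar>)"

text \<open>A mean-zero process on the unit interval together with its laws \<open>P \<sigma>2 \<alpha>\<close>
  for all values of the variance \<open>\<sigma>2\<close> and of \<open>\<alpha>\<close>, on one measurable space.\<close>

definition matern_gp_family ::
    "(real \<Rightarrow> real \<Rightarrow> 'a measure) \<Rightarrow> (real \<Rightarrow> 'a \<Rightarrow> real) \<Rightarrow> bool" where
  "matern_gp_family P X \<longleftrightarrow>
     (\<exists>\<Omega>. \<forall>\<sigma>2>0. \<forall>\<alpha>>0. sets (P \<sigma>2 \<alpha>) = sets \<Omega> \<and>
        centered_gaussian_process (P \<sigma>2 \<alpha>) {0..1} X (\<lambda>s t. \<sigma>2 * matern \<alpha> (s - t)))"

definition site :: "nat \<Rightarrow> nat \<Rightarrow> real" where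
  "site n i = real i / real n"

definition sites :: "nat \<Rightarrow> real set" where
  "sites n = site n ` {1..n}"

text \<open>Vectors and matrices are indexed from \<open>0\<close>, so entry \<open>i\<close> belongs to the site with
  number \<open>Suc i\<close>.\<close>

definition obs :: "nat \<Rightarrow> (real \<Rightarrow> 'a \<Rightarrow> real) \<Rightarrow> 'a \<Rightarrow> real vec" where
  "obs n X \<omega> = Matrix.vec n (\<lambda>i. X (site n (Suc i)) \<omega>)"

definition corr_mat :: "nat \<Rightarrow> real \<Rightarrow> real mat" where
  "corr_mat n \<alpha> = Matrix.mat n n (\<lambda>(i, j). matern \<alpha> (site n (Suc i) - site n (Suc j)))"

text \<open>For \<open>\<alpha> > 0\<close> the sites are distinct, the matrix is positive definite, and
  \<^const>\<open>mat_inverse\<close> returns \<^const>\<open>Some\<close>.\<close>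

definition corr_inv :: "nat \<Rightarrow> real \<Rightarrow> real mat" where
  "corr_inv n \<alpha> = the (mat_inverse (corr_mat n \<alpha>))"

definition corr_vec :: "nat \<Rightarrow> real \<Rightarrow> real \<Rightarrow> real vec" where
  "corr_vec n \<alpha> s = Matrix.vec n (\<lambda>i. matern \<alpha> (site n (Suc i) - s))"

definition predictor :: "nat \<Rightarrow> real vec \<Rightarrow> real \<Rightarrow> real \<Rightarrow> real" where
  "predictor n y s \<alpha> = scalar_prod (corr_vec n \<alpha> s) (corr_inv n \<alpha> *\<^sub>v y)"

definition pred_err :: "nat \<Rightarrow> (real \<Rightarrow> 'a \<Rightarrow> real) \<Rightarrow> real \<Rightarrow> real \<Rightarrow> 'a \<Rightarrow> real" where
  "pred_err n X s \<alpha> \<omega> = predictor n (obs n X \<omega>) s \<alpha> - X s \<omega>"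

definition mspe :: "'a measure \<Rightarrow> nat \<Rightarrow> (real \<Rightarrow> 'a \<Rightarrow> real) \<Rightarrow> real \<Rightarrow> real \<Rightarrow> real" where
  "mspe M n X s \<alpha> = prob_space.expectation M (\<lambda>\<omega>. (pred_err n X s \<alpha> \<omega>)\<^sup>2)"

definition log_lik :: "nat \<Rightarrow> real vec \<Rightarrow> real \<Rightarrow> real \<Rightarrow> real" where
  "log_lik n y \<sigma>2 \<alpha> =
     - (1 / (2 * \<sigma>2)) * scalar_prod y (corr_inv n \<alpha> *\<^sub>v y)
     - real n / 2 * ln \<sigma>2 - 1 / 2 * ln (Determinant.det (corr_mat n \<alpha>))"

text \<open>Posterior law of \<open>(\<theta>, \<alpha>)\<close>. The prior densities are only meaningful for positive
  arguments: \<open>\<pi> \<theta> \<alpha>\<close> is the conditional density of \<open>\<theta>\<close> given \<open>\<alpha>\<close>,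
  and \<open>\<rho>\<close> is the density of \<open>\<alpha>\<close>.\<close>

definition unnormalized_posterior ::
    "(real \<Rightarrow> real \<Rightarrow> real) \<Rightarrow> (real \<Rightarrow> real) \<Rightarrow> nat \<Rightarrow> real vec \<Rightarrow> (real \<times> real) measure" where
  "unnormalized_posterior \<pi> \<rho> n y = density lborel
     (\<lambda>(\<theta>, \<alpha>). if 0 < \<theta> \<and> 0 < \<alpha>
        then ennreal (exp (log_lik n y (\<theta> / \<alpha>) \<alpha>) * \<pi> \<theta> \<alpha> * \<rho> \<alpha>) else 0)"

definition posterior ::
    "(real \<Rightarrow> real \<Rightarrow> real) \<Rightarrow> (real \<Rightarrow> real) \<Rightarrow> nat \<Rightarrow> real vec \<Rightarrow> (real \<times> real) measure" where
  "posterior \<pi> \<rho> n y =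
     scale_measure (1 / emeasure (unnormalized_posterior \<pi> \<rho> n y) UNIV)
       (unnormalized_posterior \<pi> \<rho> n y)"

definition kappa_lower :: "real \<Rightarrow> real \<Rightarrow> real" where
  "kappa_lower d \<nu> = 1 / 2 *
     Min {0.9 / ((2 * d + 0.94) * (8 * \<nu> + 3 * d - 0.9)), 1 / (4 * (3 * \<nu> + d)), 0.01}"

definition kappa_upper :: "real \<Rightarrow> real \<Rightarrow> real" where
  "kappa_upper d \<nu> = 1 / 2 *
     Min {0.9 / ((2 * d + 0.94) * (8 * \<nu> + 5 * d + 0.9)), 1 / (2 * (2 * \<nu> + d)), 0.01}"

abbreviation \<kappa>\<^sub>l :: real where "\<kappa>\<^sub>l \<equiv> kappa_lower 1 (1 / 2)"
abbreviation \<kappa>\<^sub>u :: real where "\<kappa>\<^sub>u \<equiv> kappa_upper 1 (1 / 2)"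

definition alpha_lower :: "nat \<Rightarrow> real" where
  "alpha_lower n = real n powr (- \<kappa>\<^sub>l)"

definition alpha_upper :: "nat \<Rightarrow> real" where
  "alpha_upper n = real n powr \<kappa>\<^sub>u"

definition varsigma :: "nat \<Rightarrow> real" where
  "varsigma n = 3 * real n powr (- 1 / 2 + (\<kappa>\<^sub>u + \<kappa>\<^sub>l / 2))"

text \<open>Suprema and infima are taken in the extended reals, where they are never junk values.\<close>

definition ratio_dev :: "nat \<Rightarrow> (real \<Rightarrow> real) \<Rightarrow> (real \<Rightarrow> real) \<Rightarrow> ereal" where
  "ratio_dev n f g = (SUP s\<in>{0..1} - sites n. ereal \<bar>f s / g s - 1\<bar>)"

definition cond_prior_regular :: "real \<Rightarrow> (real \<Rightarrow> real \<Rightarrow> real) \<Rightarrow> bool" where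
  "cond_prior_regular \<theta>\<^sub>0 \<pi> \<longleftrightarrow>
     (\<forall>\<alpha>>0. (\<forall>\<theta>>0. 0 \<le> \<pi> \<theta> \<alpha>) \<and>
        (\<integral>\<^sup>+\<theta>\<in>{0<..}. ennreal (\<pi> \<theta> \<alpha>) \<partial>lborel) = 1 \<and>
        (\<exists>D. continuous_on {0<..} D \<and>
             (\<forall>\<theta>>0. ((\<lambda>t. \<pi> t \<alpha>) has_real_derivative D \<theta>) (at \<theta>))) \<and>
        0 < \<pi> \<theta>\<^sub>0 \<alpha>) \<and>
     (\<forall>\<theta>>0. continuous_on {0<..} (\<lambda>\<alpha>. \<pi> \<theta> \<alpha>))"

definition cond_prior_growth :: "real \<Rightarrow> (real \<Rightarrow> real \<Rightarrow> real) \<Rightarrow> bool" where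
  "cond_prior_growth \<theta>\<^sub>0 \<pi> \<longleftrightarrow>
     (\<exists>C1>0. \<exists>C2>0. \<exists>C3>0. C1 + C2 < 1 / 2 \<and> C3 < 1 \<and>
       (\<forall>\<^sub>F n in sequentially.
          (SUP \<alpha>\<in>{alpha_lower n..alpha_upper n}. SUP \<theta>\<in>{\<theta>\<^sub>0 / 2<..<2 * \<theta>\<^sub>0}.
             ereal \<bar>deriv (\<lambda>t. ln (\<pi> t \<alpha>)) \<theta>\<bar>) \<le> ereal (real n powr C1) \<and>
          (SUP \<alpha>\<in>{alpha_lower n..alpha_upper n}. SUP \<theta>\<in>{\<theta>\<^sub>0 / 2<..<2 * \<theta>\<^sub>0}.
             ereal (\<pi> \<theta> \<alpha> / \<pi> \<theta>\<^sub>0 \<alpha>)) \<le> ereal (real n powr C2) \<and>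
          (INF \<alpha>\<in>{alpha_lower n..alpha_upper n}. ereal (ln (\<pi> \<theta>\<^sub>0 \<alpha>)))
             \<ge> ereal (- (real n powr C3))))"

text \<open>The exponents \<open>n * (\<nu> + d / 2)\<close> and the bounds \<open>(\<nu> + d / 2) * \<kappa>\<close>
  appear with \<open>\<nu> + d / 2 = 1\<close>.\<close>

definition range_prior_cond ::
    "real \<Rightarrow> real \<Rightarrow> (real \<Rightarrow> real \<Rightarrow> real) \<Rightarrow> (real \<Rightarrow> real) \<Rightarrow> bool" where
  "range_prior_cond \<theta>\<^sub>0 \<alpha>\<^sub>0 \<pi> \<rho> \<longleftrightarrow>
     (\<forall>\<alpha>>0. 0 \<le> \<rho> \<alpha>) \<and> continuous_on {0<..} \<rho> \<and>
     (\<integral>\<^sup>+\<alpha>\<in>{0<..}. ennreal (\<rho> \<alpha>) \<partial>lborel) = 1 \<and>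
     0 < \<rho> \<alpha>\<^sub>0 \<and>
     (\<integral>\<^sup>+\<alpha>\<in>{0<..}. ennreal (\<pi> \<theta>\<^sub>0 \<alpha> * \<rho> \<alpha>) \<partial>lborel) < \<infinity> \<and>
     (\<exists>cl>0. \<exists>cu>0. cl < \<kappa>\<^sub>l \<and> cu < \<kappa>\<^sub>u \<and>
       (\<forall>\<^sub>F n in sequentially.
          max (\<integral>\<^sup>+\<alpha>\<in>{0<..<alpha_lower n}. ennreal (\<alpha> powr (- real n) * \<rho> \<alpha>) \<partial>lborel)
              (\<integral>\<^sup>+\<alpha>\<in>{0<..<alpha_lower n}.
                  ennreal (\<alpha> powr (- real n) * \<pi> \<theta>\<^sub>0 \<alpha> * \<rho> \<alpha>) \<partial>lborel)
            \<le> ennreal (exp (cl * real n * ln (real n))) \<and>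
          max (\<integral>\<^sup>+\<alpha>\<in>{alpha_upper n<..}. ennreal (\<alpha> powr real n * \<rho> \<alpha>) \<partial>lborel)
              (\<integral>\<^sup>+\<alpha>\<in>{alpha_upper n<..}.
                  ennreal (\<alpha> powr real n * \<pi> \<theta>\<^sub>0 \<alpha> * \<rho> \<alpha>) \<partial>lborel)
            \<le> ennreal (exp (cu * real n * ln (real n)))))"

definition sites_fill :: bool where
  "sites_fill \<longleftrightarrow>
     (\<lambda>n. SUP s\<in>{0..1}. ereal (Min ((\<lambda>i. \<bar>s - site n i\<bar>) ` {1..n}))) \<longlonglongrightarrow> 0"

end

theory Submission
  imports Defs "HOL-Real_Asymp.Real_Asymp"
begin

text \<open>For the exponential covariance the process is Markov, so on a grid the kriging predictor at a
  new point uses only the neighbouring sites, and all mean squared errors are explicit in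
  the two distances. After replacing \<open>\<sigma>\<^sup>2\<close> by \<open>\<theta>\<^sub>0 / \<alpha>\<close> they agree to
  first order for all \<open>\<alpha>\<close> in the slowly growing range.

  With \<open>r = exp (- \<alpha> / n)\<close> the likelihood depends on the data only through the quadratic form
  \<open>S(r) = (1 - r\<^sup>2) y\<^sub>1\<^sup>2 + \<Sum>(y\<^sub>i\<^sub>+\<^sub>1 - r y\<^sub>i)\<^sup>2\<close>. Algebraically
  \<open>S(r) = r V + (1 - r)(y\<^sub>1\<^sup>2 + y\<^sub>n\<^sup>2) + (1 - r)\<^sup>2 \<Sum>\<^sub>1\<^sub><\<^sub>i\<^sub><\<^sub>n y\<^sub>i\<^sup>2\<close> with the quadratic
  variation \<open>V\<close>, so that \<open>S(r)\<close> is close to \<open>V\<close>, hence to \<open>2 \<theta>\<^sub>0\<close>, for \<open>\<alpha>\<close> in that range,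
  and is at least \<open>V / 16\<close> for every \<open>\<alpha>\<close>. The first fact makes the conditional posterior of
  \<open>\<theta>\<close> concentrate at \<open>\<theta>\<^sub>0\<close>; the second bounds the profile likelihood up to a factor \<open>exp (O(n))\<close>, which
  is beaten by the prior mass \<open>exp (- c n log n)\<close> outside the range. Chi-square tails for the innovations and
  the Borel-Cantelli lemma supply the probabilistic input.\<close>

section \<open>The correlation matrix on the grid\<close>

text \<open>Kriging weights do not depend on the variance, so at fixed \<alpha> the mean squared
  error is linear in \<theta>, and the posterior claim becomes one about \<theta> /
  \<open>\<theta>\<^sub>0\<close> alone, at distance 2 q with q = n^(-197/400). The proof lives on
  the gap between two rates. The error granted to the quadratic form is p = n^(-99/200): then n p^2
  = n^(1/100) still gives summable tails, and the conditional mass near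
  \<open>\<theta>\<^sub>0\<close> loses no more than exp(-16 n p^2) and a power of n. The mass
  beyond 2 q inside the window (\<open>\<theta>\<^sub>0\<close> / 2, 2
  \<open>\<theta>\<^sub>0\<close>) carries exp(-n q^2 / 24) with n q^2 = n^(3/200), which beats
  exp(16 n^(1/100)) and every power of n, hence also the growth n^C2 of the prior ratio. The factor
  exp(n^C3) only meets the mass outside that window, which is exponentially small in n. For \<alpha>
  outside its range the form S(r) need not be near V, and no probabilistic statement uniform in
  \<alpha> is attempted there; a deterministic inequality has to serve. It costs a factor 48^(n/2)
  in the likelihood, the quotient of 3 \<open>\<theta>\<^sub>0\<close> and
  \<open>\<theta>\<^sub>0\<close> / 16 to the power n/2.\<close>

lemma corr_mat_carrier [simp]: "corr_mat n \<alpha> \<in> carrier_mat n n"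
  by (simp add: corr_mat_def)

lemma corr_mat_dim [simp]: "dim_row (corr_mat n \<alpha>) = n" "dim_col (corr_mat n \<alpha>) = n"
  by (simp_all add: corr_mat_def)

lemma corr_mat_symmetric: "transpose_mat (corr_mat n \<alpha>) = corr_mat n \<alpha>"
  by (rule eq_matI) (auto simp: corr_mat_def matern_def abs_minus_commute)

definition step_corr :: "nat \<Rightarrow> real \<Rightarrow> real" where
  "step_corr n \<alpha> = exp (- \<alpha> / real n)"

lemma step_corr_bounds:
  assumes "0 < n" "0 < \<alpha>"
  shows "0 < step_corr n \<alpha>" "step_corr n \<alpha> < 1" "(step_corr n \<alpha>)\<^sup>2 < 1"
  using assms by (auto simp: step_corr_def field_simps power_less_one_iff)

lemma matern_site:
  assumes "i \<le> j"
  shows "matern \<alpha> (site n (Suc i) - site n (Suc j)) = step_corr n \<alpha> ^ (j - i)"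
    and "matern \<alpha> (site n (Suc j) - site n (Suc i)) = step_corr n \<alpha> ^ (j - i)"
proof -
  have "\<bar>site n (Suc i) - site n (Suc j)\<bar> = real (j - i) / real n"
    using assms by (simp add: site_def of_nat_diff diff_divide_distrib[symmetric])
  moreover have "exp (- \<alpha> * (real (j - i) / real n)) = step_corr n \<alpha> ^ (j - i)"
    by (simp add: step_corr_def exp_of_nat_mult[symmetric])
  ultimately show "matern \<alpha> (site n (Suc i) - site n (Suc j)) = step_corr n \<alpha> ^ (j - i)"
    and "matern \<alpha> (site n (Suc j) - site n (Suc i)) = step_corr n \<alpha> ^ (j - i)"
    by (auto simp: matern_def abs_minus_commute)
qed

lemma corr_mat_entry:
  assumes "i < n" "j < n" "i \<le> j"
  shows "corr_mat n \<alpha> $$ (i, j) = step_corr n \<alpha> ^ (j - i)"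
    and "corr_mat n \<alpha> $$ (j, i) = step_corr n \<alpha> ^ (j - i)"
  using assms by (simp_all add: corr_mat_def matern_site)

text \<open>Left multiplication by this matrix turns an autoregressive sequence into its innovations.\<close>

definition innov_mat :: "nat \<Rightarrow> real \<Rightarrow> real mat" where
  "innov_mat n r = Matrix.mat n n (\<lambda>(i, k). if k = i then 1 else if Suc k = i then - r else 0)"

text \<open>Innovation variances at unit process variance. Entry 0 has no predecessor: its
  innovation is the observation itself.\<close>

definition innov_var :: "real \<Rightarrow> nat \<Rightarrow> real" where
  "innov_var r i = (if i = 0 then 1 else 1 - r\<^sup>2)"

lemma sum_bidiagonal:
  fixes f :: "nat \<Rightarrow> real"
  assumes "i < n"
  shows "(\<Sum>k\<in>{0..<n}. (if k = i then 1 else if Suc k = i then - r else 0) * f k)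
       = f i - (if i = 0 then 0 else r * f (i - 1))"
proof -
  \<comment> \<open>For \<open>i = 0\<close> truncated subtraction gives \<open>i - 1 = 0\<close>,
    hence the guard \<open>i \<noteq> 0\<close> in the second summand.\<close>
  have "(if k = i then 1 else if Suc k = i then - r else 0) * f k
      = (if k = i then f i else 0) + (if i \<noteq> 0 \<and> k = i - 1 then - r * f (i - 1) else 0)" for k
    by auto
  hence "(\<Sum>k\<in>{0..<n}. (if k = i then 1 else if Suc k = i then - r else 0) * f k)
      = (\<Sum>k\<in>{0..<n}. if k = i then f i else 0)
        + (\<Sum>k\<in>{0..<n}. if i \<noteq> 0 \<and> k = i - 1 then - r * f (i - 1) else 0)"
    by (simp add: sum.distrib)
  also have "\<dots> = f i - (if i = 0 then 0 else r * f (i - 1))"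
    using assms by (cases "i = 0") (auto simp: sum.delta)
  finally show ?thesis .
qed

lemma innov_mat_carrier [simp]: "innov_mat n r \<in> carrier_mat n n"
  by (simp add: innov_mat_def)

lemma innov_mat_dim [simp]: "dim_row (innov_mat n r) = n" "dim_col (innov_mat n r) = n"
  by (simp_all add: innov_mat_def)

lemma innov_mat_mult_vec:
  assumes "v \<in> carrier_vec n" "i < n"
  shows "vec_index (innov_mat n r *\<^sub>v v) i
       = vec_index v i - (if i = 0 then 0 else r * vec_index v (i - 1))"
  using assms sum_bidiagonal[OF assms(2), of r "vec_index v"]
  by (auto simp: innov_mat_def scalar_prod_def)

lemma det_innov_mat: "Determinant.det (innov_mat n r) = 1"
proof -
  have "Determinant.det (innov_mat n r) = prod_list (diag_mat (innov_mat n r))"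
    by (rule det_lower_triangular[where n = n]) (auto simp: innov_mat_def)
  thus ?thesis
    by (simp add: prod_list_diag_prod innov_mat_def)
qed

text \<open>An innovation is uncorrelated with every earlier observation: below the diagonal the two
  subtracted terms are both r^(i - j). What remains is upper triangular with the innovation
  variances on its diagonal.\<close>

lemma innov_corr_entry:
  assumes "i < n" "j < n"
  shows "(innov_mat n (step_corr n \<alpha>) * corr_mat n \<alpha>) $$ (i, j)
    = (if i \<le> j then innov_var (step_corr n \<alpha>) i * step_corr n \<alpha> ^ (j - i) else 0)"
proof -
  let ?r = "step_corr n \<alpha>"
  have "(innov_mat n ?r * corr_mat n \<alpha>) $$ (i, j)
      = (\<Sum>k\<in>{0..<n}. (if k = i then 1 else if Suc k = i then - ?r else 0) * corr_mat n \<alpha> $$ (k, j))"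
    using assms by (auto simp: innov_mat_def scalar_prod_def corr_mat_def intro!: sum.cong)
  also have "\<dots> = corr_mat n \<alpha> $$ (i, j)
      - (if i = 0 then 0 else ?r * corr_mat n \<alpha> $$ (i - 1, j))"
    by (rule sum_bidiagonal[OF assms(1)])
  also have "\<dots> = (if i \<le> j then innov_var ?r i * ?r ^ (j - i) else 0)"
  proof (cases "i = 0")
    case True
    thus ?thesis using assms by (simp add: corr_mat_entry innov_var_def)
  next
    case False
    show ?thesis
    proof (cases "i \<le> j")
      case True
      show ?thesis using True False assms
        by (simp add: corr_mat_entry innov_var_def Suc_diff_le power2_eq_square algebra_simps)
    next
      case ij: False
      have *: "i - j = Suc (i - 1 - j)" using False ij by simp
      show ?thesis using ij False assms
        by (simp add: corr_mat_entry(2) *)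
    qed
  qed
  finally show ?thesis .
qed

text \<open>The bidiagonal factor has determinant 1, so only the diagonal of the triangular product
  counts, and its first entry is 1.\<close>

lemma det_corr_mat:
  assumes "0 < n"
  shows "Determinant.det (corr_mat n \<alpha>) = (1 - (step_corr n \<alpha>)\<^sup>2) ^ (n - 1)"
proof -
  let ?r = "step_corr n \<alpha>"
  let ?U = "innov_mat n ?r * corr_mat n \<alpha>"
  have U: "?U \<in> carrier_mat n n" by (rule mult_carrier_mat[OF innov_mat_carrier corr_mat_carrier])
  have "Determinant.det (corr_mat n \<alpha>) = Determinant.det ?U"
    by (simp add: det_mult[of _ n] det_innov_mat)
  also have "\<dots> = prod_list (diag_mat ?U)"
  proof (rule det_upper_triangular[OF _ U], rule upper_triangularI)
    fix i j assume "j < i" "i < dim_row ?U"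
    moreover have "dim_row ?U = n" using U by simp
    ultimately show "?U $$ (i, j) = 0" using innov_corr_entry[of i n j \<alpha>] by simp
  qed
  also have "\<dots> = (\<Prod>i\<in>{0..<n}. innov_var ?r i)"
    unfolding prod_list_diag_prod using U innov_corr_entry[of _ n _ \<alpha>]
    by (auto intro!: prod.cong simp del: index_mult_mat)
  also have "\<dots> = (\<Prod>i\<in>{Suc 0..<n}. innov_var ?r i)"
    using assms by (subst prod.atLeast_Suc_lessThan) (auto simp: innov_var_def)
  also have "\<dots> = (\<Prod>i\<in>{Suc 0..<n}. 1 - ?r\<^sup>2)"
    by (rule prod.cong) (auto simp: innov_var_def)
  finally show ?thesis by simp
qed

text \<open>A nonzero determinant rules out \<open>None\<close>, so \<open>the\<close> in
  \<open>corr_inv\<close> is applied to a proper value and the inverse laws become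
  available.\<close>

lemma corr_inv_props:
  assumes "0 < n" "0 < \<alpha>"
  shows "corr_inv n \<alpha> \<in> carrier_mat n n"
    and "corr_mat n \<alpha> * corr_inv n \<alpha> = 1\<^sub>m n"
    and "corr_inv n \<alpha> * corr_mat n \<alpha> = 1\<^sub>m n"
proof -
  have "Determinant.det (corr_mat n \<alpha>) \<noteq> 0"
    using step_corr_bounds[OF assms] assms by (simp add: det_corr_mat)
  hence unit: "corr_mat n \<alpha> \<in> Units (ring_mat TYPE(real) n ())"
    by (rule det_non_zero_imp_unit[OF corr_mat_carrier])
  have "mat_inverse (corr_mat n \<alpha>) \<noteq> None"
  proof
    assume "mat_inverse (corr_mat n \<alpha>) = None"
    from mat_inverse(1)[OF corr_mat_carrier this, of "()"] unit show False by contradiction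
  qed
  hence "mat_inverse (corr_mat n \<alpha>) = Some (corr_inv n \<alpha>)"
    by (auto simp: corr_inv_def)
  thus "corr_inv n \<alpha> \<in> carrier_mat n n"
    "corr_mat n \<alpha> * corr_inv n \<alpha> = 1\<^sub>m n" "corr_inv n \<alpha> * corr_mat n \<alpha> = 1\<^sub>m n"
    using mat_inverse(2)[OF corr_mat_carrier] by auto
qed

lemma corr_inv_mult_vec:
  assumes "0 < n" "0 < \<alpha>" "z \<in> carrier_vec n" "corr_mat n \<alpha> *\<^sub>v z = y"
  shows "corr_inv n \<alpha> *\<^sub>v y = z"
  using corr_inv_props[OF assms(1,2)] assms(3,4)
  by (metis assoc_mult_mat_vec corr_mat_carrier one_mult_mat_vec)

text \<open>Weights can be guessed and checked against the normal equations instead of being read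
  off an inverse: symmetry moves the matrix from \<open>w\<close> onto \<open>q\<close>, where it
  cancels the inverse.\<close>

lemma predictor_eq:
  assumes "0 < n" "0 < \<alpha>" and w: "w \<in> carrier_vec n" and y: "y \<in> carrier_vec n"
    and R: "corr_mat n \<alpha> *\<^sub>v w = corr_vec n \<alpha> s"
  shows "predictor n y s \<alpha> = scalar_prod w y"
proof -
  note Q = corr_inv_props[OF assms(1,2)]
  define q where "q = corr_inv n \<alpha> *\<^sub>v y"
  have q: "q \<in> carrier_vec n" using Q(1) y by (simp add: q_def)
  have "predictor n y s \<alpha> = scalar_prod (transpose_mat (corr_mat n \<alpha>) *\<^sub>v w) q"
    by (simp add: predictor_def R corr_mat_symmetric q_def)
  also have "\<dots> = scalar_prod w (corr_mat n \<alpha> *\<^sub>v q)"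
    by (rule transpose_vec_mult_scalar[OF corr_mat_carrier q w])
  also have "corr_mat n \<alpha> *\<^sub>v q = y"
    unfolding q_def using Q y
    by (metis assoc_mult_mat_vec corr_mat_carrier one_mult_mat_vec)
  finally show ?thesis .
qed

text \<open>The matrix \<open>L R L\<^sup>T\<close> is diagonal for the innovation matrix \<open>L\<close>; hence
  \<open>R\<^sup>-\<^sup>1 = L\<^sup>T D\<^sup>-\<^sup>1 L\<close>.\<close>

lemma corr_inv_quadratic_form:
  assumes n: "0 < n" and \<alpha>: "0 < \<alpha>" and y: "y \<in> carrier_vec n"
  defines "r \<equiv> step_corr n \<alpha>"
  shows "scalar_prod y (corr_inv n \<alpha> *\<^sub>v y)
    = (\<Sum>i<n. (vec_index y i - (if i = 0 then 0 else r * vec_index y (i - 1)))\<^sup>2 / innov_var r i)"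
proof -
  define L where "L = innov_mat n r"
  define R where "R = corr_mat n \<alpha>"
  define D where "D = Matrix.mat n n (\<lambda>(i, j). if i = j then innov_var r i else 0)"
  define x where "x = L *\<^sub>v y"
  define w where "w = Matrix.vec n (\<lambda>i. vec_index x i / innov_var r i)"
  have c: "L \<in> carrier_mat n n" "R \<in> carrier_mat n n" "D \<in> carrier_mat n n"
    "transpose_mat L \<in> carrier_mat n n"
    by (simp_all add: L_def R_def D_def)
  have x: "x \<in> carrier_vec n" using c y by (simp add: x_def)
  have w: "w \<in> carrier_vec n" by (simp add: w_def)
  have pos: "innov_var r i \<noteq> 0" for i
    using step_corr_bounds(3)[OF n \<alpha>] by (auto simp: innov_var_def r_def)
  have LR: "L * R \<in> carrier_mat n n" using c by simp
  have LRL: "L * R * transpose_mat L = D"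
  proof (rule eq_matI)
    fix i j assume "i < dim_row D" "j < dim_col D"
    hence ij: "i < n" "j < n" by (simp_all add: D_def)
    have "(L * R * transpose_mat L) $$ (i, j)
        = (\<Sum>k\<in>{0..<n}. (if k = j then 1 else if Suc k = j then - r else 0) * (L * R) $$ (i, k))"
      using ij c LR by (auto simp: scalar_prod_def L_def innov_mat_def mult.commute
          simp del: assoc_mult_mat intro!: sum.cong)
    also have "\<dots> = (L * R) $$ (i, j) - (if j = 0 then 0 else r * (L * R) $$ (i, j - 1))"
      by (rule sum_bidiagonal[OF ij(2)])
    also have "\<dots> = D $$ (i, j)"
    proof (cases "i < j")
      case True
      have "j - i = Suc (j - 1 - i)" using True by simp
      thus ?thesis using True ij innov_corr_entry[of i n _ \<alpha>]
        by (simp add: L_def R_def r_def D_def del: index_mult_mat)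
    next
      case False
      thus ?thesis using ij innov_corr_entry[of i n _ \<alpha>]
        by (auto simp: L_def R_def r_def D_def simp del: index_mult_mat)
    qed
    finally show "(L * R * transpose_mat L) $$ (i, j) = D $$ (i, j)" .
  qed (use c in \<open>simp_all add: D_def\<close>)
  \<comment> \<open>The candidate for the inverse applied to \<open>y\<close>; \<open>w\<close> is
    the innovation vector divided by its variances. It is confirmed by showing that
    \<open>R *\<^sub>v z\<close> and \<open>y\<close> have the same innovations.\<close>
  define z where "z = transpose_mat L *\<^sub>v w"
  have z: "z \<in> carrier_vec n" using c w by (simp add: z_def)
  have "L *\<^sub>v (R *\<^sub>v z) = (L * R * transpose_mat L) *\<^sub>v w"
    unfolding z_def using c w LR
    by (metis assoc_mult_mat_vec mult_mat_vec_carrier)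
  also have "\<dots> = D *\<^sub>v w" by (simp add: LRL)
  also have "\<dots> = x"
  proof (rule eq_vecI)
    fix i assume "i < dim_vec x"
    hence i: "i < n" using x by simp
    have "vec_index (D *\<^sub>v w) i = (\<Sum>k\<in>{0..<n}. (if i = k then innov_var r i else 0) * vec_index w k)"
      using i w by (auto simp: D_def scalar_prod_def w_def)
    also have "\<dots> = (\<Sum>k\<in>{0..<n}. if k = i then innov_var r i * vec_index w i else 0)"
      by (rule sum.cong) auto
    also have "\<dots> = vec_index x i" using i pos[of i] by (simp add: w_def)
    finally show "vec_index (D *\<^sub>v w) i = vec_index x i" .
  qed (use x c in simp)
  finally have eq: "L *\<^sub>v (R *\<^sub>v z) = L *\<^sub>v y" by (simp add: x_def)
  \<comment> \<open>Determinant 1 provides a left inverse of \<open>L\<close>, which cancels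
    \<open>L\<close> on both sides.\<close>
  obtain B where B: "B \<in> carrier_mat n n" "B * L = 1\<^sub>m n"
  proof -
    have "L \<in> Units (ring_mat TYPE(real) n ())"
      by (rule det_non_zero_imp_unit[OF c(1)]) (simp add: L_def det_innov_mat)
    thus ?thesis using that by (auto simp: Units_def ring_mat_def)
  qed
  have Rz: "R *\<^sub>v z \<in> carrier_vec n" by (rule mult_mat_vec_carrier[OF c(2) z])
  have "R *\<^sub>v z = B *\<^sub>v (L *\<^sub>v (R *\<^sub>v z))"
    using assoc_mult_mat_vec[OF B(1) c(1) Rz] B(2) Rz by simp
  also have "\<dots> = y"
    using assoc_mult_mat_vec[OF B(1) c(1) y] B(2) y by (simp add: eq)
  finally have "R *\<^sub>v z = y" .
  hence "corr_inv n \<alpha> *\<^sub>v y = z"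
    using corr_inv_mult_vec[OF n \<alpha> z] by (simp add: R_def)
  hence "scalar_prod y (corr_inv n \<alpha> *\<^sub>v y) = scalar_prod (transpose_mat L *\<^sub>v w) y"
    using z y by (simp add: z_def comm_scalar_prod[of _ n])
  also have "\<dots> = scalar_prod w x"
    unfolding x_def by (rule transpose_vec_mult_scalar[OF c(1) y w])
  also have "\<dots> = (\<Sum>i<n. (vec_index x i)\<^sup>2 / innov_var r i)"
    using x by (simp add: scalar_prod_def w_def power2_eq_square lessThan_atLeast0)
  also have "\<dots> = (\<Sum>i<n. (vec_index y i - (if i = 0 then 0 else r * vec_index y (i - 1)))\<^sup>2
      / innov_var r i)"
    by (rule sum.cong) (simp_all add: x_def L_def innov_mat_mult_vec[OF y] del: index_mult_mat_vec)
  finally show ?thesis .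
qed

section \<open>Kriging weights\<close>

text \<open>Simple kriging weight of a neighbour at distance \<open>a\<close> when the neighbour on the other
  side is at distance \<open>b\<close>; it equals \<open>sinh (\<alpha> b) / sinh (\<alpha> (a + b))\<close>.\<close>

definition krig :: "real \<Rightarrow> real \<Rightarrow> real \<Rightarrow> real" where
  "krig \<alpha> a b = exp (- \<alpha> * a) * (1 - (exp (- \<alpha> * b))\<^sup>2)
     / (1 - (exp (- \<alpha> * a) * exp (- \<alpha> * b))\<^sup>2)"

lemma krig_denominator:
  fixes \<alpha> a b :: real
  assumes "0 < \<alpha>" "0 < a" "0 < b"
  shows "0 < 1 - (exp (- \<alpha> * a) * exp (- \<alpha> * b))\<^sup>2"
proof -
  have "exp (- \<alpha> * a) * exp (- \<alpha> * b) = exp (- (\<alpha> * a + \<alpha> * b))" 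
    using exp_add[of "- (\<alpha> * a)" "- (\<alpha> * b)"] by simp
  also have "\<dots> < 1" 
    using mult_pos_pos[OF assms(1,2)] mult_pos_pos[OF assms(1,3)] by simp
  finally show ?thesis by (simp add: power_less_one_iff)
qed

text \<open>Normal equation of the two-neighbour predictor for the neighbour at distance
  \<open>a\<close>; the product of the exponentials is the correlation between the two
  neighbours.\<close>

lemma krig_equation:
  assumes "0 < \<alpha>" "0 < a" "0 < b"
  shows "krig \<alpha> a b + exp (- \<alpha> * a) * exp (- \<alpha> * b) * krig \<alpha> b a = exp (- \<alpha> * a)"
proof -
  have "krig \<alpha> a b + exp (- \<alpha> * a) * exp (- \<alpha> * b) * krig \<alpha> b a
      = (exp (- \<alpha> * a) * (1 - (exp (- \<alpha> * b))\<^sup>2)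
          + exp (- \<alpha> * a) * exp (- \<alpha> * b) * (exp (- \<alpha> * b) * (1 - (exp (- \<alpha> * a))\<^sup>2)))
        / (1 - (exp (- \<alpha> * a) * exp (- \<alpha> * b))\<^sup>2)"
    by (simp add: krig_def mult.commute add_divide_distrib)
  also have "\<dots> = exp (- \<alpha> * a)"
    using krig_denominator[OF assms]
    by (simp add: divide_eq_eq) (simp add: power2_eq_square algebra_simps)
  finally show ?thesis .
qed

text \<open>To the left of the first site the distance to any site passes through the first one and
  is additive, so a single weight solves every normal equation.\<close>

lemma predictor_boundary:
  assumes "0 < n" "0 < \<alpha>" "s < 1 / real n"
  shows "predictor n (obs n X \<omega>) s \<alpha> = exp (- \<alpha> * (1 / real n - s)) * X (1 / real n) \<omega>"
proof -
  define p where "p = exp (- \<alpha> * (1 / real n - s))"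
  define w where "w = Matrix.vec n (\<lambda>k. if k = 0 then p else 0)"
  have w: "w \<in> carrier_vec n" by (simp add: w_def)
  have sp: "scalar_prod w v = p * vec_index v 0" "scalar_prod v w = p * vec_index v 0"
    if "v \<in> carrier_vec n" for v
  proof -
    have "scalar_prod w v = (\<Sum>k\<in>{0..<n}. if k = 0 then p * vec_index v 0 else 0)"
      unfolding scalar_prod_def using that by (intro sum.cong) (auto simp: w_def)
    also have "\<dots> = p * vec_index v 0" using assms(1) by simp
    finally show "scalar_prod w v = p * vec_index v 0" .
    thus "scalar_prod v w = p * vec_index v 0"
      using comm_scalar_prod[OF that w] by simp
  qed
  have "corr_mat n \<alpha> *\<^sub>v w = corr_vec n \<alpha> s"
  proof (rule eq_vecI)
    fix j assume "j < dim_vec (corr_vec n \<alpha> s)"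
    hence j: "j < n" by (simp add: corr_vec_def)
    have "vec_index (corr_mat n \<alpha> *\<^sub>v w) j = p * corr_mat n \<alpha> $$ (j, 0)"
      using j assms(1) by (simp add: sp(2) row_carrier_vec[of _ n])
    also have "\<dots> = exp (- \<alpha> * (1 / real n - s)) * exp (- \<alpha> * (real j / real n))"
      using j assms(1)
      by (simp add: p_def corr_mat_def matern_def site_def diff_divide_distrib[symmetric])
    also have "\<dots> = exp (- \<alpha> * \<bar>site n (Suc j) - s\<bar>)"
    proof -
      have "site n (Suc j) = 1 / real n + real j / real n"
        by (simp add: site_def add_divide_distrib)
      moreover have "0 \<le> real j / real n" by simp
      ultimately have e: "\<bar>site n (Suc j) - s\<bar> = (1 / real n - s) + real j / real n"
        using assms(3) by linarith
      show ?thesis unfolding e by (simp only: exp_add distrib_left)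
    qed
    finally show "vec_index (corr_mat n \<alpha> *\<^sub>v w) j = vec_index (corr_vec n \<alpha> s) j"
      using j by (simp add: corr_vec_def matern_def)
  qed (simp add: corr_vec_def)
  hence "predictor n (obs n X \<omega>) s \<alpha> = scalar_prod w (obs n X \<omega>)"
    using assms by (intro predictor_eq) (simp_all add: w_def obs_def)
  also have "\<dots> = p * X (1 / real n) \<omega>"
    using assms(1) by (simp add: sp obs_def site_def)
  finally show ?thesis by (simp add: p_def)
qed

text \<open>Every site lies at or beyond one of the two neighbours, so its normal equation is the
  equation of that neighbour multiplied by the correlation to it. Two weights therefore satisfy all
  n equations.\<close>

lemma predictor_interior:
  assumes n: "Suc i < n" and \<alpha>: "0 < \<alpha>"
    and s: "site n (Suc i) < s" "s < site n (Suc (Suc i))"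
  shows "predictor n (obs n X \<omega>) s \<alpha>
      = krig \<alpha> (s - site n (Suc i)) (site n (Suc (Suc i)) - s) * X (site n (Suc i)) \<omega>
      + krig \<alpha> (site n (Suc (Suc i)) - s) (s - site n (Suc i)) * X (site n (Suc (Suc i))) \<omega>"
proof -
  define a where "a = s - site n (Suc i)"
  define b where "b = site n (Suc (Suc i)) - s"
  define p where "p = krig \<alpha> a b"
  define q where "q = krig \<alpha> b a"
  have ab: "0 < a" "0 < b" "a + b = 1 / real n"
    using s by (simp_all add: a_def b_def site_def add_divide_distrib)
  define w where "w = Matrix.vec n (\<lambda>k. if k = i then p else if k = Suc i then q else 0)"
  have w: "w \<in> carrier_vec n" by (simp add: w_def)
  have sp: "scalar_prod w v = p * vec_index v i + q * vec_index v (Suc i)"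
    "scalar_prod v w = p * vec_index v i + q * vec_index v (Suc i)"
    if "v \<in> carrier_vec n" for v
  proof -
    have "scalar_prod w v = (\<Sum>k\<in>{0..<n}. (if k = i then p * vec_index v i else 0)
        + (if k = Suc i then q * vec_index v (Suc i) else 0))"
      unfolding scalar_prod_def using that by (intro sum.cong) (auto simp: w_def)
    also have "\<dots> = p * vec_index v i + q * vec_index v (Suc i)"
      using n by (simp add: sum.distrib)
    finally show "scalar_prod w v = p * vec_index v i + q * vec_index v (Suc i)" .
    thus "scalar_prod v w = p * vec_index v i + q * vec_index v (Suc i)"
      using comm_scalar_prod[OF that w] by simp
  qed
  have eqs: "p + exp (- (\<alpha> / real n)) * q = exp (- (\<alpha> * a))"
    "exp (- (\<alpha> / real n)) * p + q = exp (- (\<alpha> * b))"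
  proof -
    have h: "\<alpha> * (a + b) = \<alpha> / real n" by (simp add: ab(3))
    have "- (\<alpha> / real n) = - (\<alpha> * a) + - (\<alpha> * b)"
      using h unfolding distrib_left by linarith
    hence "exp (- (\<alpha> / real n)) = exp (- (\<alpha> * a)) * exp (- (\<alpha> * b))"
      by (simp only: exp_add)
    thus "p + exp (- (\<alpha> / real n)) * q = exp (- (\<alpha> * a))"
      "exp (- (\<alpha> / real n)) * p + q = exp (- (\<alpha> * b))"
      using krig_equation[OF \<alpha> ab(1,2)] krig_equation[OF \<alpha> ab(2,1)]
      by (simp_all add: p_def q_def algebra_simps)
  qed
  have "corr_mat n \<alpha> *\<^sub>v w = corr_vec n \<alpha> s"
  proof (rule eq_vecI)
    fix j assume "j < dim_vec (corr_vec n \<alpha> s)"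
    hence j: "j < n" by (simp add: corr_vec_def)
    have "vec_index (corr_mat n \<alpha> *\<^sub>v w) j
        = p * corr_mat n \<alpha> $$ (j, i) + q * corr_mat n \<alpha> $$ (j, Suc i)"
      using j n by (simp add: sp(2) row_carrier_vec[of _ n])
    also have "\<dots> = exp (- \<alpha> * \<bar>site n (Suc j) - s\<bar>)"
    proof (cases "j \<le> i")
      case True
      define x where "x = site n (Suc i) - site n (Suc j)"
      have x: "0 \<le> x" using True by (simp add: x_def site_def divide_right_mono)
      have "\<bar>site n (Suc j) - site n (Suc i)\<bar> = x"
        "\<bar>site n (Suc j) - site n (Suc (Suc i))\<bar> = x + 1 / real n"
        "\<bar>site n (Suc j) - s\<bar> = x + a"
        using x ab by (simp_all add: x_def a_def site_def add_divide_distrib)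
      moreover have "p * exp (- \<alpha> * x) + q * exp (- \<alpha> * (x + 1 / real n))
          = exp (- \<alpha> * x) * (p + exp (- (\<alpha> / real n)) * q)"
        by (simp add: algebra_simps exp_add exp_diff exp_minus divide_inverse)
      moreover have "exp (- \<alpha> * x) * exp (- \<alpha> * a) = exp (- \<alpha> * (x + a))"
        by (simp add: exp_add[symmetric] algebra_simps)
      ultimately show ?thesis
        using j n by (simp add: corr_mat_def matern_def eqs)
    next
      case False
      define x where "x = site n (Suc j) - site n (Suc (Suc i))"
      have x: "0 \<le> x"
        using False by (simp add: x_def site_def divide_right_mono)
      have "\<bar>site n (Suc j) - site n (Suc i)\<bar> = x + 1 / real n"
        "\<bar>site n (Suc j) - site n (Suc (Suc i))\<bar> = x"
        "\<bar>site n (Suc j) - s\<bar> = x + b"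
        using x ab by (simp_all add: x_def b_def site_def add_divide_distrib)
      moreover have "p * exp (- \<alpha> * (x + 1 / real n)) + q * exp (- \<alpha> * x)
          = exp (- \<alpha> * x) * (exp (- (\<alpha> / real n)) * p + q)"
        by (simp add: algebra_simps exp_add exp_diff exp_minus divide_inverse)
      moreover have "exp (- \<alpha> * x) * exp (- \<alpha> * b) = exp (- \<alpha> * (x + b))"
        by (simp add: exp_add[symmetric] algebra_simps)
      ultimately show ?thesis
        using j n by (simp add: corr_mat_def matern_def eqs)
    qed
    finally show "vec_index (corr_mat n \<alpha> *\<^sub>v w) j = vec_index (corr_vec n \<alpha> s) j"
      using j by (simp add: corr_vec_def matern_def)
  qed (simp add: corr_vec_def)
  hence "predictor n (obs n X \<omega>) s \<alpha> = scalar_prod w (obs n X \<omega>)"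
    using n \<alpha> by (intro predictor_eq) (simp_all add: w_def obs_def)
  also have "\<dots> = p * X (site n (Suc i)) \<omega> + q * X (site n (Suc (Suc i))) \<omega>"
    using n by (simp add: sp obs_def)
  finally show ?thesis by (simp add: p_def q_def a_def b_def)
qed

section \<open>Gaussian processes\<close>

text \<open>Completing the square tilts the density to the normal density with mean a
  \<sigma>^2.\<close>

lemma mgf_normal_density:
  assumes "0 < \<sigma>"
  shows "(\<integral>\<^sup>+x. ennreal (normal_density 0 \<sigma> x) * ennreal (exp (a * x)) \<partial>lborel)
    = ennreal (exp ((a * \<sigma>)\<^sup>2 / 2))"
proof -
  have "normal_density 0 \<sigma> x * exp (a * x) = exp ((a * \<sigma>)\<^sup>2 / 2) * normal_density (a * \<sigma>\<^sup>2) \<sigma> x" for x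
  proof -
    have "- x\<^sup>2 / (2 * \<sigma>\<^sup>2) + a * x = (a * \<sigma>)\<^sup>2 / 2 + - (x - a * \<sigma>\<^sup>2)\<^sup>2 / (2 * \<sigma>\<^sup>2)"
      using assms by (simp add: field_simps power2_eq_square)
    hence "exp (- x\<^sup>2 / (2 * \<sigma>\<^sup>2)) * exp (a * x)
        = exp ((a * \<sigma>)\<^sup>2 / 2) * exp (- (x - a * \<sigma>\<^sup>2)\<^sup>2 / (2 * \<sigma>\<^sup>2))"
      by (simp only: exp_add[symmetric])
    thus ?thesis by (simp add: normal_density_def)
  qed
  hence "(\<integral>\<^sup>+x. ennreal (normal_density 0 \<sigma> x) * ennreal (exp (a * x)) \<partial>lborel)
      = (\<integral>\<^sup>+x. ennreal (exp ((a * \<sigma>)\<^sup>2 / 2)) * ennreal (normal_density (a * \<sigma>\<^sup>2) \<sigma> x) \<partial>lborel)"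
    by (simp add: ennreal_mult''[symmetric])
  also have "\<dots> = ennreal (exp ((a * \<sigma>)\<^sup>2 / 2)) * (\<integral>\<^sup>+x. ennreal (normal_density (a * \<sigma>\<^sup>2) \<sigma> x) \<partial>lborel)"
    by (rule nn_integral_cmult) simp
  also have "(\<integral>\<^sup>+x. ennreal (normal_density (a * \<sigma>\<^sup>2) \<sigma> x) \<partial>lborel) = 1"
    using assms by (subst nn_integral_eq_integral) auto
  finally show ?thesis by simp
qed

lemma gaussian_rv_measurable: "gaussian_rv M Z \<Longrightarrow> Z \<in> borel_measurable M"
  by (auto simp: gaussian_rv_def distributed_def)

text \<open>The degenerate law obeys the same three formulas with v = 0, so all later transform
  computations are free of the case distinction in \<open>gaussian_rv\<close>.\<close>

lemma gaussian_rv_centered: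
  assumes M: "prob_space M" and Z: "gaussian_rv M Z" and mean: "prob_space.expectation M Z = 0"
  defines "v \<equiv> prob_space.expectation M (\<lambda>\<omega>. (Z \<omega>)\<^sup>2)"
  shows "integrable M (\<lambda>\<omega>. (Z \<omega>)\<^sup>2)"
    and "(\<integral>\<^sup>+\<omega>. ennreal (exp (Z \<omega>)) \<partial>M) = ennreal (exp (v / 2))"
    and "(CLINT \<omega>|M. iexp (Z \<omega>)) = complex_of_real (exp (- v / 2))"
proof -
  interpret prob_space M by (rule M)
  have meas [measurable]: "Z \<in> borel_measurable M" by (rule gaussian_rv_measurable[OF Z])
  from Z obtain \<mu> where "(\<exists>\<sigma>>0. distributed M lborel Z (\<lambda>x. ennreal (normal_density \<mu> \<sigma> x)))
        \<or> (AE \<omega> in M. Z \<omega> = \<mu>)"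
    by (auto simp: gaussian_rv_def)
  hence "integrable M (\<lambda>\<omega>. (Z \<omega>)\<^sup>2) \<and>
    (\<integral>\<^sup>+\<omega>. ennreal (exp (Z \<omega>)) \<partial>M) = ennreal (exp (v / 2)) \<and>
    (CLINT \<omega>|M. iexp (Z \<omega>)) = complex_of_real (exp (- v / 2))"
  proof
    assume "\<exists>\<sigma>>0. distributed M lborel Z (\<lambda>x. ennreal (normal_density \<mu> \<sigma> x))"
    then obtain \<sigma> where \<sigma>: "0 < \<sigma>" and D: "distributed M lborel Z (\<lambda>x. ennreal (normal_density \<mu> \<sigma> x))"
      by blast
    have \<mu>: "\<mu> = 0" using normal_distributed_expectation[OF \<sigma> D] mean by simp
    have v: "v = \<sigma>\<^sup>2" using normal_distributed_variance[OF \<sigma> D] mean by (simp add: v_def)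
    have 1: "integrable M (\<lambda>\<omega>. (Z \<omega>)\<^sup>2)"
      using distributed_integrable[OF D, of "\<lambda>x. x\<^sup>2"] integrable_normal_moment[OF \<sigma>, of 0 2]
      by (simp add: \<mu>)
    have 2: "(\<integral>\<^sup>+\<omega>. ennreal (exp (Z \<omega>)) \<partial>M) = ennreal (exp (v / 2))"
      using distributed_nn_integral[OF D, of "\<lambda>x. ennreal (exp x)"] mgf_normal_density[OF \<sigma>, of 1]
      by (simp add: \<mu> v)
    have std: "distributed M lborel (\<lambda>\<omega>. Z \<omega> / \<sigma>) (\<lambda>x. ennreal (std_normal_density x))"
      using D normal_standard_normal_convert[OF \<sigma>, of Z 0] by (simp add: \<mu>)
    have "complex_of_real (exp (- v / 2)) = char std_normal_distribution \<sigma>"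
      by (simp add: char_std_normal_distribution v)
    also have "std_normal_distribution = distr M lborel (\<lambda>\<omega>. Z \<omega> / \<sigma>)"
      using distributed_distr_eq_density[OF std] by simp
    also have "char \<dots> \<sigma> = (CLINT \<omega>|M. iexp (\<sigma> * (Z \<omega> / \<sigma>)))"
      unfolding char_def by (rule integral_distr) simp_all
    also have "\<dots> = (CLINT \<omega>|M. iexp (Z \<omega>))" using \<sigma> by simp
    finally show ?thesis using 1 2 by simp
  next
    assume AE: "AE \<omega> in M. Z \<omega> = \<mu>"
    have "expectation Z = expectation (\<lambda>_. \<mu>)" by (rule integral_cong_AE) (use AE in auto)
    hence \<mu>: "\<mu> = 0" using mean by (simp add: prob_space)
    have AE0: "AE \<omega> in M. Z \<omega> = 0" using AE \<mu> by simp
    have 1: "integrable M (\<lambda>\<omega>. (Z \<omega>)\<^sup>2)"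
      by (rule integrable_cong_AE_imp[of _ "\<lambda>_. 0"]) (use AE0 in auto)
    have "v = expectation (\<lambda>_. 0)"
      unfolding v_def by (rule integral_cong_AE) (use AE0 in auto)
    hence v: "v = 0" by simp
    have "(\<integral>\<^sup>+\<omega>. ennreal (exp (Z \<omega>)) \<partial>M) = (\<integral>\<^sup>+\<omega>. 1 \<partial>M)"
      by (rule nn_integral_cong_AE) (use AE0 in auto)
    moreover have "(CLINT \<omega>|M. iexp (Z \<omega>)) = (CLINT \<omega>|M. 1)"
      by (rule integral_cong_AE) (use AE0 in auto)
    ultimately show ?thesis using 1 by (simp add: v emeasure_space_1 prob_space)
  qed
  thus "integrable M (\<lambda>\<omega>. (Z \<omega>)\<^sup>2)"
    "(\<integral>\<^sup>+\<omega>. ennreal (exp (Z \<omega>)) \<partial>M) = ennreal (exp (v / 2))"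
    "(CLINT \<omega>|M. iexp (Z \<omega>)) = complex_of_real (exp (- v / 2))" by blast+
qed

lemma integrable_mult_of_square:
  fixes f g :: "'a \<Rightarrow> real"
  assumes [measurable]: "f \<in> borel_measurable M" "g \<in> borel_measurable M"
    and "integrable M (\<lambda>x. (f x)\<^sup>2)" "integrable M (\<lambda>x. (g x)\<^sup>2)"
  shows "integrable M (\<lambda>x. f x * g x)"
proof (rule Bochner_Integration.integrable_bound)
  show "integrable M (\<lambda>x. (f x)\<^sup>2 + (g x)\<^sup>2)" using assms by simp
  have "\<bar>f x * g x\<bar> \<le> \<bar>(f x)\<^sup>2 + (g x)\<^sup>2\<bar>" for x
  proof -
    have "2 * (\<bar>f x\<bar> * \<bar>g x\<bar>) \<le> (f x)\<^sup>2 + (g x)\<^sup>2"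
      using sum_squares_bound[of "\<bar>f x\<bar>" "\<bar>g x\<bar>"] by simp
    moreover have "0 \<le> \<bar>f x\<bar> * \<bar>g x\<bar>" by simp
    ultimately show ?thesis unfolding abs_mult by linarith
  qed
  thus "AE x in M. norm (f x * g x) \<le> norm ((f x)\<^sup>2 + (g x)\<^sup>2)" by simp
qed simp

context
  fixes M :: "'a measure" and T :: "real set" and X k
  assumes gp: "centered_gaussian_process M T X k"
begin

lemma gp_prob_space: "prob_space M"
  using gp by (simp add: centered_gaussian_process_def)

lemma gp_measurable: "s \<in> T \<Longrightarrow> X s \<in> borel_measurable M"
proof -
  assume s: "s \<in> T"
  hence "gaussian_rv M (\<lambda>\<omega>. \<Sum>u\<in>{s}. 1 * X u \<omega>)"
    using gp unfolding centered_gaussian_process_def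
    by (meson empty_subsetI finite.emptyI finite_insert insert_subset)
  thus ?thesis using gaussian_rv_measurable by fastforce
qed

text \<open>The process is specified through sums over sets of points, whereas consecutive
  innovations share a site. Combinations indexed by a non-injective \<open>t\<close> are reduced to
  the former by collecting the coefficients of equal points.\<close>

lemma gp_gaussian_combination:
  assumes "finite I" "t ` I \<subseteq> T"
  shows "gaussian_rv M (\<lambda>\<omega>. \<Sum>i\<in>I. c i * X (t i) \<omega>)"
proof -
  have "(\<Sum>i\<in>I. c i * X (t i) \<omega>) = (\<Sum>s\<in>t ` I. (\<Sum>i\<in>{i\<in>I. t i = s}. c i) * X s \<omega>)" for \<omega>
    by (subst sum.image_gen[OF assms(1), of _ t]) (auto simp: sum_distrib_right intro!: sum.cong)
  moreover have "gaussian_rv M (\<lambda>\<omega>. \<Sum>s\<in>t ` I. (\<Sum>i\<in>{i\<in>I. t i = s}. c i) * X s \<omega>)"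
    using gp assms unfolding centered_gaussian_process_def
    by (elim conjE) (drule spec[of _ "t ` I"], drule spec, erule mp, simp)
  ultimately show ?thesis by simp
qed

lemma gp_square_integrable:
  assumes "s \<in> T"
  shows "integrable M (\<lambda>\<omega>. (X s \<omega>)\<^sup>2)"
proof (rule gaussian_rv_centered(1)[OF gp_prob_space])
  show "gaussian_rv M (X s)" using gp_gaussian_combination[of "{s}" "\<lambda>s. s" "\<lambda>_. 1"] assms by simp
  show "prob_space.expectation M (X s) = 0"
    using gp assms by (simp add: centered_gaussian_process_def)
qed

lemma gp_integrable:
  assumes "s \<in> T"
  shows "integrable M (X s)"
proof -
  interpret prob_space M by (rule gp_prob_space)
  show ?thesis
    by (rule square_integrable_imp_integrable[OF gp_measurable gp_square_integrable]) (rule assms)+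
qed

lemma gp_integrable_mult:
  assumes "s \<in> T" "u \<in> T"
  shows "integrable M (\<lambda>\<omega>. X s \<omega> * X u \<omega>)"
  by (intro integrable_mult_of_square gp_measurable gp_square_integrable assms)

lemma gp_covariance:
  assumes "s \<in> T" "u \<in> T"
  shows "prob_space.expectation M (\<lambda>\<omega>. X s \<omega> * X u \<omega>) = k s u"
  using gp assms by (simp add: centered_gaussian_process_def)

lemma gp_combination_moments:
  fixes c :: "'i \<Rightarrow> real" and t :: "'i \<Rightarrow> real"
  assumes "finite I" "t ` I \<subseteq> T"
  defines "Z \<equiv> \<lambda>\<omega>. \<Sum>i\<in>I. c i * X (t i) \<omega>"
  defines "v \<equiv> \<Sum>i\<in>I. \<Sum>j\<in>I. c i * c j * k (t i) (t j)"
  shows "gaussian_rv M Z" "prob_space.expectation M Z = 0"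
    "prob_space.expectation M (\<lambda>\<omega>. (Z \<omega>)\<^sup>2) = v"
    "(\<integral>\<^sup>+\<omega>. ennreal (exp (Z \<omega>)) \<partial>M) = ennreal (exp (v / 2))"
    "(CLINT \<omega>|M. iexp (Z \<omega>)) = complex_of_real (exp (- v / 2))"
proof -
  interpret prob_space M by (rule gp_prob_space)
  have tI: "t i \<in> T" if "i \<in> I" for i using that assms(2) by auto
  show G: "gaussian_rv M Z" unfolding Z_def by (rule gp_gaussian_combination) fact+
  have "expectation (X s) = 0" if "s \<in> T" for s
    using gp that by (simp add: centered_gaussian_process_def)
  thus E: "expectation Z = 0"
    unfolding Z_def using tI by (subst Bochner_Integration.integral_sum) (auto simp: gp_integrable)
  have "(Z \<omega>)\<^sup>2 = (\<Sum>i\<in>I. \<Sum>j\<in>I. c i * c j * (X (t i) \<omega> * X (t j) \<omega>))" for \<omega>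
    by (simp add: Z_def power2_eq_square sum_product algebra_simps)
  hence "expectation (\<lambda>\<omega>. (Z \<omega>)\<^sup>2) = (\<Sum>i\<in>I. \<Sum>j\<in>I. c i * c j * expectation (\<lambda>\<omega>. X (t i) \<omega> * X (t j) \<omega>))"
    using tI by (simp add: Bochner_Integration.integral_sum gp_integrable_mult)
  also have "\<dots> = v"
    unfolding v_def using tI by (intro sum.cong) (auto simp: gp_covariance)
  finally show V: "expectation (\<lambda>\<omega>. (Z \<omega>)\<^sup>2) = v" .
  show "(\<integral>\<^sup>+\<omega>. ennreal (exp (Z \<omega>)) \<partial>M) = ennreal (exp (v / 2))"
    "(CLINT \<omega>|M. iexp (Z \<omega>)) = complex_of_real (exp (- v / 2))"
    using gaussian_rv_centered(2,3)[OF gp_prob_space G E] by (simp_all add: V)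
qed

lemma gp_three_point_second_moment:
  assumes "a \<in> T" "b \<in> T" "s \<in> T"
  shows "prob_space.expectation M (\<lambda>\<omega>. (p * X a \<omega> + q * X b \<omega> - X s \<omega>)\<^sup>2)
    = p\<^sup>2 * k a a + q\<^sup>2 * k b b + k s s + 2 * p * q * k a b - 2 * p * k a s - 2 * q * k b s"
proof -
  have "(p * X a \<omega> + q * X b \<omega> - X s \<omega>)\<^sup>2
      = p\<^sup>2 * (X a \<omega> * X a \<omega>) + q\<^sup>2 * (X b \<omega> * X b \<omega>) + X s \<omega> * X s \<omega>
      + 2 * p * q * (X a \<omega> * X b \<omega>) - 2 * p * (X a \<omega> * X s \<omega>) - 2 * q * (X b \<omega> * X s \<omega>)" for \<omega>
    by (simp add: power2_eq_square algebra_simps)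
  thus ?thesis
    using assms by (simp add: gp_integrable_mult gp_covariance)
qed

end

section \<open>Mean squared prediction errors\<close>

text \<open>For d = 1 and \<nu> = 1/2 the entry 0.01 is the smallest in both minima. From here on
  the exponents are explicit rationals.\<close>

lemma kappa_values: "\<kappa>\<^sub>l = 1 / 200" "\<kappa>\<^sub>u = 1 / 200"
  by (simp_all add: kappa_lower_def kappa_upper_def field_simps min_def)

section \<open>Elementary inequalities and bounds for kriging weights\<close>

lemma one_minus_exp_bounds:
  fixes z :: real
  assumes "0 \<le> z"
  shows "z - z\<^sup>2 / 2 \<le> 1 - exp (- z)" "1 - exp (- z) \<le> z"
proof -
  show "1 - exp (- z) \<le> z" using exp_ge_add_one_self[of "- z"] by simp
  \<comment> \<open>The product equals 1 + z^4 / 4.\<close>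
  have "1 \<le> (1 - z + z\<^sup>2 / 2) * (1 + z + z\<^sup>2 / 2)"
    using assms by (simp add: algebra_simps power2_eq_square)
  also have "\<dots> \<le> (1 - z + z\<^sup>2 / 2) * exp z"
  proof (rule mult_left_mono)
    show "1 + z + z\<^sup>2 / 2 \<le> exp z" by (rule exp_lower_Taylor_quadratic[OF assms])
    have e: "1 - z + z\<^sup>2 / 2 = ((1 - z)\<^sup>2 + 1) / 2" by (simp add: power2_eq_square field_simps)
    show "0 \<le> 1 - z + z\<^sup>2 / 2"
      unfolding e by (intro divide_nonneg_pos add_nonneg_nonneg) auto
  qed
  finally have "exp (- z) \<le> 1 - z + z\<^sup>2 / 2" by (simp add: exp_minus field_simps)
  thus "z - z\<^sup>2 / 2 \<le> 1 - exp (- z)" by simp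
qed

text \<open>Convexity of sinh on the half-line together with sinh 0 = 0, obtained by comparing
  derivatives.\<close>

lemma sinh_mult_le:
  fixes t x :: real
  assumes "0 \<le> t" "t \<le> 1" "0 \<le> x"
  shows "sinh (t * x) \<le> t * sinh x"
proof -
  have "t * sinh 0 - sinh (t * 0) \<le> t * sinh x - sinh (t * x)"
  proof (rule DERIV_nonneg_imp_nondecreasing[OF assms(3)])
    fix y assume y: "0 \<le> y" "y \<le> x"
    have "t * y \<le> y" using assms y by (simp add: mult_left_le_one_le)
    hence "cosh (t * y) \<le> cosh y"
      using assms y by (simp add: cosh_real_nonneg_le_iff)
    hence "0 \<le> t * cosh y - cosh (t * y) * t"
      using assms mult_left_mono[of "cosh (t * y)" "cosh y" t] by (simp add: mult.commute)
    moreover have "((\<lambda>y. t * sinh y - sinh (t * y)) has_real_derivative t * cosh y - cosh (t * y) * t) (at y)"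
      by (auto intro!: derivative_eq_intros)
    ultimately show "\<exists>D. ((\<lambda>y. t * sinh y - sinh (t * y)) has_real_derivative D) (at y) \<and> 0 \<le> D"
      by blast
  qed
  thus ?thesis by simp
qed

text \<open>Written as sinh(\<alpha> b) / sinh(\<alpha> (a + b)), the weight is compared with that
  of linear interpolation, its limit for \<alpha> tending to 0.\<close>

lemma krig_le:
  assumes "0 < \<alpha>" "0 < a" "0 < b"
  shows "krig \<alpha> a b \<le> b / (a + b)"
proof -
  have h: "exp (- \<alpha> * a) * exp (- \<alpha> * b) = exp (- \<alpha> * (a + b))"
    by (simp only: exp_add distrib_left)
  have e: "1 - (exp (- y))\<^sup>2 = 2 * exp (- y) * sinh y" for y :: real
    by (simp add: sinh_def power2_eq_square algebra_simps exp_minus)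
  have pos: "0 < sinh (\<alpha> * (a + b))" using assms by simp
  have "krig \<alpha> a b = exp (- \<alpha> * a) * (2 * exp (- (\<alpha> * b)) * sinh (\<alpha> * b))
      / (2 * exp (- (\<alpha> * (a + b))) * sinh (\<alpha> * (a + b)))"
    unfolding krig_def h using e[of "\<alpha> * b"] e[of "\<alpha> * (a + b)"] by simp
  also have "\<dots> = (exp (- \<alpha> * a) * exp (- \<alpha> * b)) * sinh (\<alpha> * b)
      / (exp (- \<alpha> * (a + b)) * sinh (\<alpha> * (a + b)))"
    by (simp add: mult_ac)
  also have "\<dots> = sinh (\<alpha> * b) / sinh (\<alpha> * (a + b))"
    unfolding h by simp
  also have "\<dots> \<le> b / (a + b)"
  proof -
    have "b / (a + b) * (\<alpha> * (a + b)) = \<alpha> * b" using assms by simp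
    hence "sinh (\<alpha> * b) \<le> b / (a + b) * sinh (\<alpha> * (a + b))"
      using sinh_mult_le[of "b / (a + b)" "\<alpha> * (a + b)"] assms by (simp add: mult.commute)
    thus ?thesis using pos by (simp add: pos_divide_le_eq)
  qed
  finally show ?thesis .
qed

text \<open>With A and B the correlations to the neighbours, the deficit is exactly (1 - A) (1 - B)
  / (1 + A B). Being of second order, it turns the one-sided bound \<open>krig_le\<close> into a
  sharp two-sided one.\<close>

lemma krig_sum:
  assumes "0 < \<alpha>" "0 < a" "0 < b"
  shows "1 - (krig \<alpha> a b + krig \<alpha> b a) \<le> \<alpha>\<^sup>2 * (a * b)"
proof -
  define A where "A = exp (- \<alpha> * a)"
  define B where "B = exp (- \<alpha> * b)"
  have AB: "0 < A" "A < 1" "0 < B" "B < 1" using assms by (auto simp: A_def B_def)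
  hence AB1: "A * B < 1" using mult_strict_mono[of A 1 B 1] by simp
  have d: "1 - (A * B)\<^sup>2 \<noteq> 0" "1 - (B * A)\<^sup>2 = 1 - (A * B)\<^sup>2"
    using krig_denominator[OF assms] by (simp_all add: A_def B_def mult.commute)
  have f: "1 - (A * B)\<^sup>2 = (1 - A * B) * (1 + A * B)"
    by (simp add: power2_eq_square algebra_simps)
  have "krig \<alpha> a b + krig \<alpha> b a = (A * (1 - B\<^sup>2) + B * (1 - A\<^sup>2)) / (1 - (A * B)\<^sup>2)"
    by (simp add: krig_def A_def B_def add_divide_distrib mult.commute)
  hence "(1 - (krig \<alpha> a b + krig \<alpha> b a)) * (1 - (A * B)\<^sup>2)
      = 1 - (A * B)\<^sup>2 - (A * (1 - B\<^sup>2) + B * (1 - A\<^sup>2))"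
    using d(1) by (simp add: left_diff_distrib)
  also have "\<dots> = (1 - A) * (1 - B) * (1 - A * B)"
    by (simp add: power2_eq_square algebra_simps)
  finally have "(1 - (krig \<alpha> a b + krig \<alpha> b a)) * (1 + A * B) = (1 - A) * (1 - B)"
    using AB1 unfolding f by simp
  moreover have "0 \<le> (1 - A) * (1 - B)" using AB by simp
  ultimately have "0 \<le> 1 - (krig \<alpha> a b + krig \<alpha> b a)"
    using AB by (smt (verit) mult_neg_pos mult_pos_pos)
  hence "(1 - (krig \<alpha> a b + krig \<alpha> b a)) * 1 \<le> (1 - (krig \<alpha> a b + krig \<alpha> b a)) * (1 + A * B)"
    using AB by (intro mult_left_mono) auto
  also have "\<dots> = (1 - A) * (1 - B)" by fact
  also have "\<dots> \<le> (\<alpha> * a) * (\<alpha> * b)"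
    using one_minus_exp_bounds(2)[of "\<alpha> * a"] one_minus_exp_bounds(2)[of "\<alpha> * b"] assms AB
    by (intro mult_mono) (auto simp: A_def B_def)
  finally show ?thesis by (simp add: power2_eq_square mult_ac)
qed

text \<open>Variance at unit process variance of the process conditioned on both neighbours, that
  is, of an Ornstein-Uhlenbeck bridge.\<close>

definition gap_var :: "real \<Rightarrow> real \<Rightarrow> real \<Rightarrow> real" where
  "gap_var \<alpha> a b = (1 - (exp (- \<alpha> * a))\<^sup>2) * (1 - (exp (- \<alpha> * b))\<^sup>2)
     / (1 - (exp (- \<alpha> * a) * exp (- \<alpha> * b))\<^sup>2)"

text \<open>Orthogonality of the kriging error to the neighbouring observations: any other weights
  add the variance of the difference of the predictors.\<close>

lemma kriging_pythagoras:
  assumes "0 < \<alpha>" "0 < a" "0 < b"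
  shows "p\<^sup>2 + q\<^sup>2 + 1 + 2 * p * q * exp (- \<alpha> * (a + b)) - 2 * p * exp (- \<alpha> * a) - 2 * q * exp (- \<alpha> * b)
    = gap_var \<alpha> a b + ((p - krig \<alpha> a b)\<^sup>2 + (q - krig \<alpha> b a)\<^sup>2
        + 2 * (p - krig \<alpha> a b) * (q - krig \<alpha> b a) * exp (- \<alpha> * (a + b)))"
proof -
  define A where "A = exp (- \<alpha> * a)"
  define B where "B = exp (- \<alpha> * b)"
  define u where "u = krig \<alpha> a b"
  define v where "v = krig \<alpha> b a"
  have h: "exp (- \<alpha> * (a + b)) = A * B"
    unfolding A_def B_def by (simp only: exp_add distrib_left)
  have eqA: "A = u + A * B * v" and eqB: "B = v + A * B * u"
    using krig_equation[OF assms] krig_equation[OF assms(1,3,2)]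
    by (simp_all add: A_def B_def u_def v_def mult.commute)
  have d: "1 - (A * B)\<^sup>2 \<noteq> 0" using krig_denominator[OF assms] by (simp add: A_def B_def)
  have "u = A * (1 - B\<^sup>2) / (1 - (A * B)\<^sup>2)" "v = B * (1 - A\<^sup>2) / (1 - (A * B)\<^sup>2)"
    by (simp_all add: u_def v_def krig_def A_def B_def mult.commute)
  hence "1 - u * A - v * B = (1 - (A * B)\<^sup>2 - A * (1 - B\<^sup>2) * A - B * (1 - A\<^sup>2) * B) / (1 - (A * B)\<^sup>2)"
    using d by (simp add: diff_divide_distrib)
  also have "\<dots> = gap_var \<alpha> a b"
    unfolding gap_var_def A_def[symmetric] B_def[symmetric]
    by (simp add: power2_eq_square algebra_simps)
  finally have g: "gap_var \<alpha> a b = 1 - u * A - v * B" by simp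
  have "p\<^sup>2 + q\<^sup>2 + 1 + 2 * p * q * (A * B) - 2 * p * A - 2 * q * B
      = 1 - u * A - v * B + ((p - u)\<^sup>2 + (q - v)\<^sup>2 + 2 * (p - u) * (q - v) * (A * B))
        + (2 * p - u) * (u + A * B * v - A) + (2 * q - v) * (v + A * B * u - B)"
    by (simp add: power2_eq_square algebra_simps)
  thus ?thesis using eqA eqB
    unfolding g h u_def[symmetric] v_def[symmetric] A_def[symmetric] B_def[symmetric] by simp
qed

text \<open>The weights come from \<alpha>, the covariances from \<alpha>'; the second summand is
  the price of the wrong parameter and vanishes if both agree.\<close>

lemma mspe_interior:
  assumes gp: "centered_gaussian_process M {0..1} X (\<lambda>s t. \<sigma>2 * matern \<alpha>' (s - t))"
    and \<alpha>: "0 < \<alpha>" "0 < \<alpha>'" and i: "Suc i < n"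
    and s: "site n (Suc i) < s" "s < site n (Suc (Suc i))"
  defines "a \<equiv> s - site n (Suc i)" and "b \<equiv> site n (Suc (Suc i)) - s"
  shows "mspe M n X s \<alpha> = \<sigma>2 * (gap_var \<alpha>' a b
      + ((krig \<alpha> a b - krig \<alpha>' a b)\<^sup>2 + (krig \<alpha> b a - krig \<alpha>' b a)\<^sup>2
        + 2 * (krig \<alpha> a b - krig \<alpha>' a b) * (krig \<alpha> b a - krig \<alpha>' b a) * exp (- \<alpha>' * (a + b))))"
proof -
  have ab: "0 < a" "0 < b" using s by (simp_all add: a_def b_def)
  have sites: "site n (Suc i) \<in> {0..1}" "site n (Suc (Suc i)) \<in> {0..1}"
    using i by (auto simp: site_def)
  hence "s \<in> {0..1}" using s by auto
  with sites have "mspe M n X s \<alpha> = (krig \<alpha> a b)\<^sup>2 * \<sigma>2 + (krig \<alpha> b a)\<^sup>2 * \<sigma>2 + \<sigma>2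
      + 2 * krig \<alpha> a b * krig \<alpha> b a * (\<sigma>2 * exp (- \<alpha>' * (a + b)))
      - 2 * krig \<alpha> a b * (\<sigma>2 * exp (- \<alpha>' * a)) - 2 * krig \<alpha> b a * (\<sigma>2 * exp (- \<alpha>' * b))"
    unfolding mspe_def pred_err_def predictor_interior[OF i \<alpha>(1) s] a_def[symmetric] b_def[symmetric]
    using s by (subst gp_three_point_second_moment[OF gp]) (auto simp: matern_def a_def b_def)
  also have "\<dots> = \<sigma>2 * ((krig \<alpha> a b)\<^sup>2 + (krig \<alpha> b a)\<^sup>2 + 1
      + 2 * krig \<alpha> a b * krig \<alpha> b a * exp (- \<alpha>' * (a + b))
      - 2 * krig \<alpha> a b * exp (- \<alpha>' * a) - 2 * krig \<alpha> b a * exp (- \<alpha>' * b))"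
    by (simp add: algebra_simps)
  finally show ?thesis unfolding kriging_pythagoras[OF \<alpha>(2) ab] .
qed

lemma mspe_boundary:
  assumes gp: "centered_gaussian_process M {0..1} X (\<lambda>s t. \<sigma>2 * matern \<alpha>' (s - t))"
    and \<alpha>: "0 < \<alpha>" and n: "0 < n" and s: "0 \<le> s" "s < 1 / real n"
  defines "b \<equiv> 1 / real n - s"
  shows "mspe M n X s \<alpha> = \<sigma>2 * ((1 - (exp (- \<alpha>' * b))\<^sup>2) + (exp (- \<alpha> * b) - exp (- \<alpha>' * b))\<^sup>2)"
proof -
  have sites: "1 / real n \<in> {0..1}" using n by auto
  hence "s \<in> {0..1}" using s by auto
  \<comment> \<open>Using the first site twice, with second weight 0, makes the three-point formula
    cover a single neighbour.\<close>
  with sites have "prob_space.expectation M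
      (\<lambda>\<omega>. (exp (- \<alpha> * b) * X (1 / real n) \<omega> + 0 * X (1 / real n) \<omega> - X s \<omega>)\<^sup>2)
     = (exp (- \<alpha> * b))\<^sup>2 * \<sigma>2 + \<sigma>2 - 2 * exp (- \<alpha> * b) * (\<sigma>2 * exp (- \<alpha>' * b))"
    using s by (subst gp_three_point_second_moment[OF gp]) (auto simp: matern_def b_def)
  thus ?thesis
    unfolding mspe_def pred_err_def predictor_boundary[OF n \<alpha> s(2)] b_def[symmetric]
    by (simp add: power2_eq_square algebra_simps)
qed


text \<open>Both quantities are compared with a common value \<open>B\<close>; the larger allowance
  2 t for \<open>g\<close> leaves room for the excess error of a misspecified predictor. The
  inequality 2 t / (1 - t) \<le> 3 t for t \<le> 1/3 produces the 3, which matches the factor 3 in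
  \<open>varsigma\<close>.\<close>

lemma ratio_deviation_bound:
  fixes f g B t :: real
  assumes "0 < B" "0 \<le> t" "t \<le> 1 / 3"
    and "B * (1 - t) \<le> f" "f \<le> B * (1 + t)" "B * (1 - t) \<le> g" "g \<le> B * (1 + 2 * t)"
  shows "\<bar>f / g - 1\<bar> \<le> 3 * t"
proof -
  have "0 < B * (1 - t)" using assms by simp
  hence g: "0 < g" using assms by linarith
  have "f - g \<le> B * (2 * t)" using assms by (simp add: algebra_simps)
  also have "\<dots> \<le> 3 * t * (B * (1 - t))"
    using assms mult_left_mono[of "2" "3 * (1 - t)" "B * t"] by (simp add: mult_ac)
  also have "\<dots> \<le> 3 * t * g" using assms by (intro mult_left_mono) auto
  finally have 1: "f - g \<le> 3 * t * g" .
  have "g * (1 - 3 * t) \<le> B * (1 + 2 * t) * (1 - 3 * t)"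
    using assms by (intro mult_right_mono) auto
  also have "\<dots> = B * (1 - t) - B * (6 * t * t)" by (simp add: algebra_simps)
  also have "\<dots> \<le> B * (1 - t)" using assms by simp
  finally have 2: "g - f \<le> 3 * t * g" using assms by (simp add: algebra_simps)
  have "f / g - 1 = (f - g) / g" using g by (simp add: diff_divide_distrib)
  hence "\<bar>f / g - 1\<bar> = \<bar>f - g\<bar> / g" using g by (simp add: abs_divide)
  also have "\<dots> \<le> 3 * t" using 1 2 g by (simp add: pos_divide_le_eq abs_le_iff)
  finally show ?thesis .
qed

lemma one_minus_exp_square_bounds:
  fixes z :: real
  assumes "0 \<le> z"
  shows "2 * z * (1 - z) \<le> 1 - (exp (- z))\<^sup>2" "1 - (exp (- z))\<^sup>2 \<le> 2 * z"
proof -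
  have "(exp (- z))\<^sup>2 = exp (- (2 * z))" by (simp add: exp_double[symmetric])
  thus "2 * z * (1 - z) \<le> 1 - (exp (- z))\<^sup>2" "1 - (exp (- z))\<^sup>2 \<le> 2 * z"
    using one_minus_exp_bounds[of "2 * z"] assms by (simp_all add: power2_eq_square algebra_simps)
qed

text \<open>As 1 - exp(-2 x) is 2 x up to a relative error of order x, the bridge variance is 2
  \<alpha> a b / (a + b) to first order. Division by \<alpha> removes the parameter, which is why
  all covariances with the same \<theta> nearly agree.\<close>

lemma gap_var_bounds:
  assumes \<alpha>: "0 < \<alpha>" and ab: "0 < a" "0 < b" and t: "\<alpha> * (a + b) \<le> t / 4" "t \<le> 1"
  shows "2 * a * b / (a + b) * (1 - t) \<le> gap_var \<alpha> a b / \<alpha>"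
    "gap_var \<alpha> a b / \<alpha> \<le> 2 * a * b / (a + b) * (1 + t)"
proof -
  define x where "x = \<alpha> * (a + b)"
  define U where "U = 1 - (exp (- (\<alpha> * a)))\<^sup>2"
  define V where "V = 1 - (exp (- (\<alpha> * b)))\<^sup>2"
  define W where "W = 1 - (exp (- \<alpha> * a) * exp (- \<alpha> * b))\<^sup>2"
  have x: "0 < x" "x \<le> t / 4" "x \<le> 1 / 4" using assms by (simp_all add: x_def)
  have xs: "\<alpha> * a \<le> x" "\<alpha> * b \<le> x" using assms by (simp_all add: x_def)
  have W_eq: "W = 1 - (exp (- x))\<^sup>2"
  proof -
    have "exp (- \<alpha> * a) * exp (- \<alpha> * b) = exp (- \<alpha> * (a + b))" by (simp only: exp_add distrib_left)
    thus ?thesis by (simp add: W_def x_def)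
  qed
  have U: "2 * (\<alpha> * a) * (1 - x) \<le> U" "U \<le> 2 * (\<alpha> * a)"
    and V: "2 * (\<alpha> * b) * (1 - x) \<le> V" "V \<le> 2 * (\<alpha> * b)"
    and W: "2 * x * (1 - x) \<le> W" "W \<le> 2 * x"
  proof -
    have "2 * (\<alpha> * a) * (1 - x) \<le> 2 * (\<alpha> * a) * (1 - \<alpha> * a)"
      "2 * (\<alpha> * b) * (1 - x) \<le> 2 * (\<alpha> * b) * (1 - \<alpha> * b)"
      using assms xs by (intro mult_left_mono; simp)+
    moreover have "0 \<le> \<alpha> * a" "0 \<le> \<alpha> * b" "0 \<le> x" using assms x by simp_all
    note this[THEN one_minus_exp_square_bounds(1)] this[THEN one_minus_exp_square_bounds(2)]
    ultimately show "2 * (\<alpha> * a) * (1 - x) \<le> U" "U \<le> 2 * (\<alpha> * a)"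
      "2 * (\<alpha> * b) * (1 - x) \<le> V" "V \<le> 2 * (\<alpha> * b)"
      "2 * x * (1 - x) \<le> W" "W \<le> 2 * x"
      unfolding U_def V_def W_eq by linarith+
  qed
  define B where "B = 2 * a * b / (a + b)"
  have B: "0 < B" using ab by (simp add: B_def)
  have eq: "2 * (\<alpha> * a) * (2 * (\<alpha> * b)) = \<alpha> * B * (2 * x)"
    using ab by (simp add: B_def x_def)
  have "0 < 2 * x * (1 - x)" using x by simp
  hence W0: "0 < W" using W(1) by linarith
  have "(1 - x)\<^sup>2 = 1 - 2 * x + x * x" by (simp add: power2_eq_square algebra_simps)
  hence sq: "1 - t \<le> (1 - x)\<^sup>2" using x zero_le_square[of x] by linarith
  have "\<alpha> * B * (1 - t) * W \<le> \<alpha> * B * (1 - t) * (2 * x)"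
    using W \<alpha> B t by (intro mult_left_mono) auto
  also have "\<dots> \<le> \<alpha> * B * (1 - x)\<^sup>2 * (2 * x)"
    using x \<alpha> B by (intro mult_right_mono mult_left_mono sq) auto
  also have "\<dots> = \<alpha> * B * (2 * x) * ((1 - x) * (1 - x))"
    by (simp only: power2_eq_square mult_ac)
  also have "\<dots> = 2 * (\<alpha> * a) * (1 - x) * (2 * (\<alpha> * b) * (1 - x))"
    unfolding eq[symmetric] by (simp only: mult_ac)
  also have "\<dots> \<le> U * V" using U V x ab \<alpha> by (intro mult_mono) (auto intro: order_trans[rotated])
  finally have low: "\<alpha> * B * (1 - t) \<le> U * V / W" using W0 by (simp add: pos_le_divide_eq)
  have "0 \<le> 2 * (\<alpha> * a) * (1 - x)" "0 \<le> 2 * (\<alpha> * b) * (1 - x)" using x ab \<alpha> by simp_all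
  hence UV0: "0 \<le> U" "0 \<le> V" using U V by linarith+
  have "U * V \<le> 2 * (\<alpha> * a) * (2 * (\<alpha> * b))" using U V UV0 ab \<alpha> by (intro mult_mono) auto
  also have "\<dots> = \<alpha> * B * (2 * x) * 1" using eq by simp
  also have "\<dots> \<le> \<alpha> * B * (2 * x) * ((1 + t) * (1 - x))"
  proof (rule mult_left_mono)
    have "t * x \<le> t * (1 / 4)" using x t by (intro mult_left_mono) auto
    moreover have "(1 + t) * (1 - x) = 1 + t - x - t * x" by (simp add: algebra_simps)
    ultimately show "1 \<le> (1 + t) * (1 - x)" using x by linarith
  qed (use \<alpha> B x in simp)
  also have "\<dots> = \<alpha> * B * (1 + t) * (2 * x * (1 - x))" by (simp only: mult_ac)
  also have "\<dots> \<le> \<alpha> * B * (1 + t) * W"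
    using W \<alpha> B x by (intro mult_left_mono) auto
  finally have up: "U * V / W \<le> \<alpha> * B * (1 + t)" using W0 by (simp add: pos_divide_le_eq)
  define Q where "Q = U * V / W"
  have g: "gap_var \<alpha> a b = Q" unfolding Q_def by (simp add: gap_var_def U_def V_def W_def)
  show "2 * a * b / (a + b) * (1 - t) \<le> gap_var \<alpha> a b / \<alpha>"
    "gap_var \<alpha> a b / \<alpha> \<le> 2 * a * b / (a + b) * (1 + t)"
    unfolding g B_def[symmetric] using low[folded Q_def] up[folded Q_def] \<alpha>
    by (simp_all add: pos_le_divide_eq pos_divide_le_eq mult_ac)
qed

text \<open>Every weight with parameter at most \<open>m\<close> lies within m^2 a b below the
  interpolation weight b / (a + b): \<open>krig_le\<close> bounds it above, and
  \<open>krig_sum\<close> with \<open>krig_le\<close> for the opposite weight bounds it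
  below.\<close>

lemma krig_diff_bound:
  assumes "0 < \<alpha>" "\<alpha> \<le> m" "0 < \<beta>" "\<beta> \<le> m" "0 < a" "0 < b"
  shows "\<bar>krig \<alpha> a b - krig \<beta> a b\<bar> \<le> m\<^sup>2 * (a * b)"
proof -
  have "b / (a + b) - m\<^sup>2 * (a * b) \<le> krig \<gamma> a b \<and> krig \<gamma> a b \<le> b / (a + b)"
    if "0 < \<gamma>" "\<gamma> \<le> m" for \<gamma>
  proof -
    have "\<gamma>\<^sup>2 * (a * b) \<le> m\<^sup>2 * (a * b)"
      using that assms by (intro mult_right_mono power_mono) auto
    moreover have "b / (a + b) + a / (b + a) = 1"
      using assms by (simp add: add_divide_distrib[symmetric] add.commute)
    ultimately show ?thesis
      using krig_le[of \<gamma> a b] krig_le[of \<gamma> b a] krig_sum[of \<gamma> a b] that assms by linarith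
  qed
  from this[OF assms(1,2)] this[OF assms(3,4)] show ?thesis by linarith
qed

text \<open>The last site is the endpoint 1, so a point with a neighbour on one side only occurs
  only at the left end. The number of the left neighbour is the floor of s n.\<close>

lemma site_location:
  assumes n: "0 < n" and s: "s \<in> {0..1} - sites n"
  shows "s < 1 / real n \<or> (\<exists>i. Suc i < n \<and> site n (Suc i) < s \<and> s < site n (Suc (Suc i)))"
proof (rule disjCI)
  assume neg: "\<not> (\<exists>i. Suc i < n \<and> site n (Suc i) < s \<and> s < site n (Suc (Suc i)))"
  define k where "k = nat \<lfloor>s * real n\<rfloor>"
  have k: "real k \<le> s * real n" "s * real n < real k + 1"
    using s n by (simp_all add: k_def)
  have ks: "site n k \<le> s" "s < site n (Suc k)"
    using k n by (simp_all add: site_def field_simps)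
  show "s < 1 / real n"
  proof (rule ccontr)
    assume "\<not> s < 1 / real n"
    moreover have "s < 1 / real n" if "k = 0" using ks(2) that by (simp add: site_def)
    ultimately have "k \<noteq> 0" by blast
    then obtain i where i: "k = Suc i" using not0_implies_Suc by blast
    have "s * real n \<le> 1 * real n" using s by (intro mult_right_mono) auto
    hence "k \<le> n" using k by simp
    hence "site n k \<in> sites n" using i by (auto simp: sites_def)
    hence "site n k < s" using s ks by (metis DiffD2 order_le_less)
    moreover have "k \<noteq> n"
      using \<open>site n k < s\<close> s n by (auto simp: site_def)
    ultimately show False using neg \<open>k \<le> n\<close> ks i by auto
  qed
qed

section \<open>Ratios of mean squared prediction errors\<close>

lemma gp_of_family:
  assumes "matern_gp_family P X" "0 < \<sigma>2" "0 < \<alpha>"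
  shows "centered_gaussian_process (P \<sigma>2 \<alpha>) {0..1} X (\<lambda>s t. \<sigma>2 * matern \<alpha> (s - t))"
  using assms unfolding matern_gp_family_def by blast

text \<open>The excess \<open>E\<close> is quadratic in the differences of weights, hence of order
  m^4 (a b)^2, against a leading term of order a b / (a + b). The relative excess is of order m^4 /
  n^3, which \<open>c2\<close> budgets. Both denominators are treated at once by letting
  \<open>\<beta>\<close> be either parameter.\<close>

lemma mspe_ratio_interior:
  fixes \<sigma>\<^sub>0 \<alpha>\<^sub>0 :: real
  assumes fam: "matern_gp_family P X" and pos: "0 < \<sigma>\<^sub>0" "0 < \<alpha>\<^sub>0" "0 < \<alpha>" "0 < n"
    and m: "\<alpha> \<le> m" "\<alpha>\<^sub>0 \<le> m" and t: "0 \<le> t" "t \<le> 1 / 3"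
    and c1: "m / real n \<le> t / 4" and c2: "2 * m ^ 4 * (1 / real n) ^ 3 \<le> \<alpha>\<^sub>0 * t"
    and i: "Suc i < n" and s: "site n (Suc i) < s" "s < site n (Suc (Suc i))"
    and \<beta>: "\<beta> \<in> {\<alpha>, \<alpha>\<^sub>0}"
  shows "\<bar>mspe (P (\<sigma>\<^sub>0\<^sup>2 * \<alpha>\<^sub>0 / \<alpha>) \<alpha>) n X s \<alpha> / mspe (P (\<sigma>\<^sub>0\<^sup>2) \<alpha>\<^sub>0) n X s \<beta> - 1\<bar> \<le> 3 * t"
proof -
  define a where "a = s - site n (Suc i)"
  define b where "b = site n (Suc (Suc i)) - s"
  have ab: "0 < a" "0 < b" "a + b = 1 / real n"
    using s by (simp_all add: a_def b_def site_def add_divide_distrib)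
  have \<beta>0: "0 < \<beta>" "\<beta> \<le> m" using \<beta> pos m by auto
  have \<theta>: "0 < \<sigma>\<^sub>0\<^sup>2 * \<alpha>\<^sub>0" "0 < \<sigma>\<^sub>0\<^sup>2 * \<alpha>\<^sub>0 / \<alpha>" "0 < \<sigma>\<^sub>0\<^sup>2" using pos by simp_all
  define \<theta> where "\<theta> = \<sigma>\<^sub>0\<^sup>2 * \<alpha>\<^sub>0"
  define B where "B = \<theta> * (2 * a * b / (a + b))"
  define u where "u = krig \<beta> a b - krig \<alpha>\<^sub>0 a b"
  define v where "v = krig \<beta> b a - krig \<alpha>\<^sub>0 b a"
  define \<rho> where "\<rho> = exp (- \<alpha>\<^sub>0 * (a + b))"
  define E where "E = u\<^sup>2 + v\<^sup>2 + 2 * u * v * \<rho>"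
  have B: "0 < B"
    unfolding B_def by (intro mult_pos_pos divide_pos_pos add_pos_pos) (use ab \<theta> in \<open>auto simp: \<theta>_def\<close>)
  have f: "mspe (P (\<sigma>\<^sub>0\<^sup>2 * \<alpha>\<^sub>0 / \<alpha>) \<alpha>) n X s \<alpha> = \<theta> * (gap_var \<alpha> a b / \<alpha>)"
    using mspe_interior[OF gp_of_family[OF fam \<theta>(2) pos(3)] pos(3) pos(3) i s]
    by (simp add: a_def b_def \<theta>_def)
  have g: "mspe (P (\<sigma>\<^sub>0\<^sup>2) \<alpha>\<^sub>0) n X s \<beta> = \<theta> * (gap_var \<alpha>\<^sub>0 a b / \<alpha>\<^sub>0) + \<sigma>\<^sub>0\<^sup>2 * E"
    using mspe_interior[OF gp_of_family[OF fam \<theta>(3) pos(2)] \<beta>0(1) pos(2) i s] pos(2)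
    by (simp add: a_def b_def \<theta>_def E_def u_def v_def \<rho>_def distrib_left)
  have small: "\<gamma> * (a + b) \<le> t / 4" if "0 < \<gamma>" "\<gamma> \<le> m" for \<gamma>
  proof -
    have "\<gamma> * (a + b) = \<gamma> / real n" by (simp add: ab(3))
    thus ?thesis using that c1 divide_right_mono[of \<gamma> m "real n"] by linarith
  qed
  have G: "B * (1 - t) \<le> \<theta> * (gap_var \<gamma> a b / \<gamma>)" "\<theta> * (gap_var \<gamma> a b / \<gamma>) \<le> B * (1 + t)"
    if "0 < \<gamma>" "\<gamma> \<le> m" for \<gamma>
  proof -
    have \<theta>0: "0 \<le> \<theta>" and t1: "t \<le> 1" using \<theta>(1) t by (simp_all add: \<theta>_def)
    show "B * (1 - t) \<le> \<theta> * (gap_var \<gamma> a b / \<gamma>)" "\<theta> * (gap_var \<gamma> a b / \<gamma>) \<le> B * (1 + t)"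
      using mult_left_mono[OF gap_var_bounds(1)[OF that(1) ab(1,2) small[OF that] t1] \<theta>0]
        mult_left_mono[OF gap_var_bounds(2)[OF that(1) ab(1,2) small[OF that] t1] \<theta>0]
      by (simp_all only: B_def mult.assoc)
  qed
  have uv: "\<bar>u\<bar> \<le> m\<^sup>2 * (a * b)" "\<bar>v\<bar> \<le> m\<^sup>2 * (a * b)"
    using krig_diff_bound[OF \<beta>0 pos(2) m(2) ab(1,2)] krig_diff_bound[OF \<beta>0 pos(2) m(2) ab(2,1)]
    by (simp_all add: u_def v_def mult.commute)
  have \<rho>: "0 \<le> \<rho>" "\<rho> \<le> 1" using ab pos by (simp_all add: \<rho>_def)
  have "0 \<le> E \<and> E \<le> (\<bar>u\<bar> + \<bar>v\<bar>)\<^sup>2"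
  proof -
    have "\<bar>u * v * \<rho>\<bar> \<le> \<bar>u\<bar> * \<bar>v\<bar>"
      using \<rho> by (simp add: abs_mult mult_right_le_one_le)
    moreover have "0 \<le> (\<bar>u\<bar> - \<bar>v\<bar>)\<^sup>2" by simp
    moreover have "(\<bar>u\<bar> - \<bar>v\<bar>)\<^sup>2 = u\<^sup>2 + v\<^sup>2 - 2 * (\<bar>u\<bar> * \<bar>v\<bar>)"
      "(\<bar>u\<bar> + \<bar>v\<bar>)\<^sup>2 = u\<^sup>2 + v\<^sup>2 + 2 * (\<bar>u\<bar> * \<bar>v\<bar>)"
      by (simp_all add: power2_eq_square algebra_simps)
    ultimately show ?thesis unfolding E_def by linarith
  qed
  moreover have "(\<bar>u\<bar> + \<bar>v\<bar>)\<^sup>2 \<le> (2 * (m\<^sup>2 * (a * b)))\<^sup>2"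
    using uv by (intro power_mono) auto
  ultimately have E: "0 \<le> E" "E \<le> (2 * (m\<^sup>2 * (a * b)))\<^sup>2" by auto
  have "\<sigma>\<^sub>0\<^sup>2 * E \<le> \<sigma>\<^sub>0\<^sup>2 * (2 * (m\<^sup>2 * (a * b)))\<^sup>2" by (intro mult_left_mono E) simp
  also have "\<dots> = \<sigma>\<^sub>0\<^sup>2 * (2 * a * b / (a + b)) * (2 * m ^ 4 * (a + b) * (a * b))"
    using ab pos by (simp add: power2_eq_square eval_nat_numeral)
  also have "\<dots> \<le> \<sigma>\<^sub>0\<^sup>2 * (2 * a * b / (a + b)) * (2 * m ^ 4 * (a + b) * ((a + b) * (a + b)))"
    using ab pos m by (intro mult_left_mono mult_mono) auto
  also have "\<dots> = \<sigma>\<^sub>0\<^sup>2 * (2 * a * b / (a + b)) * (2 * m ^ 4 * (1 / real n) ^ 3)"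
    unfolding ab(3) by (simp add: eval_nat_numeral)
  also have "\<dots> \<le> \<sigma>\<^sub>0\<^sup>2 * (2 * a * b / (a + b)) * (\<alpha>\<^sub>0 * t)"
    using ab by (intro mult_left_mono c2) auto
  also have "\<dots> = B * t" by (simp add: B_def \<theta>_def)
  finally have E2: "\<sigma>\<^sub>0\<^sup>2 * E \<le> B * t" .
  have E1: "0 \<le> \<sigma>\<^sub>0\<^sup>2 * E" using E by simp
  show ?thesis unfolding f g
  proof (rule ratio_deviation_bound[OF B t])
    show "B * (1 - t) \<le> \<theta> * (gap_var \<alpha>\<^sub>0 a b / \<alpha>\<^sub>0) + \<sigma>\<^sub>0\<^sup>2 * E"
      using G(1)[OF pos(2) m(2)] E1 by linarith
    have "B * (1 + 2 * t) = B * (1 + t) + B * t" by (simp add: algebra_simps)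
    thus "\<theta> * (gap_var \<alpha>\<^sub>0 a b / \<alpha>\<^sub>0) + \<sigma>\<^sub>0\<^sup>2 * E \<le> B * (1 + 2 * t)"
      using G(2)[OF pos(2) m(2)] E2 by linarith
  qed (use G[OF pos(3) m(1)] in auto)
qed

text \<open>With one neighbour the weights differ already by order m b, but the leading term is of
  order b. The relative excess is thus of order m^2 / n, which \<open>c3\<close> budgets.\<close>

lemma mspe_ratio_boundary:
  fixes \<sigma>\<^sub>0 \<alpha>\<^sub>0 :: real
  assumes fam: "matern_gp_family P X" and pos: "0 < \<sigma>\<^sub>0" "0 < \<alpha>\<^sub>0" "0 < \<alpha>" "0 < n"
    and m: "\<alpha> \<le> m" "\<alpha>\<^sub>0 \<le> m" and t: "0 \<le> t" "t \<le> 1 / 3"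
    and c1: "m / real n \<le> t / 4" and c3: "m\<^sup>2 / real n \<le> 2 * \<alpha>\<^sub>0 * t"
    and s: "0 \<le> s" "s < 1 / real n"
    and \<beta>: "\<beta> \<in> {\<alpha>, \<alpha>\<^sub>0}"
  shows "\<bar>mspe (P (\<sigma>\<^sub>0\<^sup>2 * \<alpha>\<^sub>0 / \<alpha>) \<alpha>) n X s \<alpha> / mspe (P (\<sigma>\<^sub>0\<^sup>2) \<alpha>\<^sub>0) n X s \<beta> - 1\<bar> \<le> 3 * t"
proof -
  define b where "b = 1 / real n - s"
  have b: "0 < b" "b \<le> 1 / real n" using s by (simp_all add: b_def)
  have \<beta>0: "0 < \<beta>" "\<beta> \<le> m" using \<beta> pos m by auto
  have \<theta>: "0 < \<sigma>\<^sub>0\<^sup>2 * \<alpha>\<^sub>0" "0 < \<sigma>\<^sub>0\<^sup>2 * \<alpha>\<^sub>0 / \<alpha>" "0 < \<sigma>\<^sub>0\<^sup>2" using pos by simp_all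
  define \<theta> where "\<theta> = \<sigma>\<^sub>0\<^sup>2 * \<alpha>\<^sub>0"
  define H where "H \<gamma> = (1 - (exp (- (\<gamma> * b)))\<^sup>2) / \<gamma>" for \<gamma>
  define B where "B = \<theta> * (2 * b)"
  define E where "E = (exp (- \<beta> * b) - exp (- \<alpha>\<^sub>0 * b))\<^sup>2"
  have B: "0 < B" using b \<theta> by (simp add: B_def \<theta>_def)
  have f: "mspe (P (\<sigma>\<^sub>0\<^sup>2 * \<alpha>\<^sub>0 / \<alpha>) \<alpha>) n X s \<alpha> = \<theta> * H \<alpha>"
    using mspe_boundary[OF gp_of_family[OF fam \<theta>(2) pos(3)] pos(3) pos(4) s]
    by (simp add: b_def \<theta>_def H_def)
  have g: "mspe (P (\<sigma>\<^sub>0\<^sup>2) \<alpha>\<^sub>0) n X s \<beta> = \<theta> * H \<alpha>\<^sub>0 + \<sigma>\<^sub>0\<^sup>2 * E"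
    using mspe_boundary[OF gp_of_family[OF fam \<theta>(3) pos(2)] \<beta>0(1) pos(4) s] pos(2)
    by (simp add: b_def \<theta>_def E_def H_def distrib_left)
  have G: "B * (1 - t) \<le> \<theta> * H \<gamma>" "\<theta> * H \<gamma> \<le> B * (1 + t)" if "0 < \<gamma>" "\<gamma> \<le> m" for \<gamma>
  proof -
    have "\<gamma> * b \<le> m * (1 / real n)" using that b m pos by (intro mult_mono) auto
    hence "\<gamma> * b \<le> m / real n" by simp
    hence "\<gamma> * b \<le> t" using c1 t by linarith
    hence "2 * b * (1 - t) \<le> 2 * b * (1 - \<gamma> * b)"
      using b by (intro mult_left_mono) auto
    also have "\<dots> \<le> H \<gamma>"
      using one_minus_exp_square_bounds(1)[of "\<gamma> * b"] that b
      by (simp add: H_def pos_le_divide_eq mult_ac)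
    finally have "\<theta> * (2 * b * (1 - t)) \<le> \<theta> * H \<gamma>"
      using \<theta>(1) by (intro mult_left_mono) (auto simp: \<theta>_def)
    thus "B * (1 - t) \<le> \<theta> * H \<gamma>" by (simp only: B_def mult.assoc)
    have "H \<gamma> \<le> 2 * b"
      using one_minus_exp_square_bounds(2)[of "\<gamma> * b"] that b
      by (simp add: H_def pos_divide_le_eq mult_ac)
    also have "\<dots> \<le> 2 * b * (1 + t)" using b t by simp
    finally have "\<theta> * H \<gamma> \<le> \<theta> * (2 * b * (1 + t))"
      using \<theta>(1) by (intro mult_left_mono) (auto simp: \<theta>_def)
    thus "\<theta> * H \<gamma> \<le> B * (1 + t)" by (simp only: B_def mult.assoc)
  qed
  have e: "1 - m * b \<le> exp (- \<gamma> * b)" "exp (- \<gamma> * b) \<le> 1" if "0 < \<gamma>" "\<gamma> \<le> m" for \<gamma>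
  proof -
    have "\<gamma> * b \<le> m * b" "0 \<le> \<gamma> * b" using that b by (auto intro: mult_right_mono)
    thus "1 - m * b \<le> exp (- \<gamma> * b)" "exp (- \<gamma> * b) \<le> 1"
      using one_minus_exp_bounds(2)[of "\<gamma> * b"] unfolding mult_minus_left by simp_all
  qed
  have "\<bar>exp (- \<beta> * b) - exp (- \<alpha>\<^sub>0 * b)\<bar> \<le> m * b"
    using e[OF \<beta>0] e[OF pos(2) m(2)] by linarith
  hence "E \<le> (m * b)\<^sup>2" using power_mono[of "\<bar>exp (- \<beta> * b) - exp (- \<alpha>\<^sub>0 * b)\<bar>" "m * b" 2]
    by (simp add: E_def)
  hence "\<sigma>\<^sub>0\<^sup>2 * E \<le> \<sigma>\<^sub>0\<^sup>2 * (m * b)\<^sup>2" by (intro mult_left_mono) auto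
  also have "\<dots> = \<sigma>\<^sub>0\<^sup>2 * b * (m\<^sup>2 * b)" by (simp add: power2_eq_square)
  also have "\<dots> \<le> \<sigma>\<^sub>0\<^sup>2 * b * (m\<^sup>2 * (1 / real n))" using b by (intro mult_left_mono) auto
  also have "\<dots> \<le> \<sigma>\<^sub>0\<^sup>2 * b * (2 * \<alpha>\<^sub>0 * t)" using b c3 by (intro mult_left_mono) auto
  also have "\<dots> = B * t" by (simp add: B_def \<theta>_def)
  finally have E2: "\<sigma>\<^sub>0\<^sup>2 * E \<le> B * t" .
  have E1: "0 \<le> \<sigma>\<^sub>0\<^sup>2 * E" by (simp add: E_def)
  show ?thesis unfolding f g
  proof (rule ratio_deviation_bound[OF B t])
    show "B * (1 - t) \<le> \<theta> * H \<alpha>\<^sub>0 + \<sigma>\<^sub>0\<^sup>2 * E"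
      using G(1)[OF pos(2) m(2)] E1 by linarith
    have "B * (1 + 2 * t) = B * (1 + t) + B * t" by (simp add: algebra_simps)
    thus "\<theta> * H \<alpha>\<^sub>0 + \<sigma>\<^sub>0\<^sup>2 * E \<le> B * (1 + 2 * t)"
      using G(2)[OF pos(2) m(2)] E2 by linarith
  qed (use G[OF pos(3) m(1)] in auto)
qed

lemma varsigma_tendsto_0: "varsigma \<longlonglongrightarrow> 0"
  unfolding varsigma_def kappa_values by real_asymp

lemma mspe_ratio_eventually:
  fixes \<sigma>\<^sub>0 \<alpha>\<^sub>0 :: real
  assumes fam: "matern_gp_family P X" and pos: "0 < \<sigma>\<^sub>0" "0 < \<alpha>\<^sub>0"
  shows "\<forall>\<^sub>F n in sequentially. \<forall>\<alpha>\<in>{alpha_lower n..alpha_upper n}. \<forall>s\<in>{0..1} - sites n. \<forall>\<beta>\<in>{\<alpha>, \<alpha>\<^sub>0}.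
    \<bar>mspe (P (\<sigma>\<^sub>0\<^sup>2 * \<alpha>\<^sub>0 / \<alpha>) \<alpha>) n X s \<alpha> / mspe (P (\<sigma>\<^sub>0\<^sup>2) \<alpha>\<^sub>0) n X s \<beta> - 1\<bar> \<le> varsigma n"
proof -
  \<comment> \<open>\<open>t\<close> is a third of \<open>varsigma\<close>, and \<open>m\<close> is
    \<open>alpha_upper\<close>, which eventually exceeds \<open>\<alpha>\<^sub>0\<close> as
    well.\<close>
  define t where "t n = real n powr (- 197 / 400)" for n
  define m where "m n = real n powr (1 / 200)" for n
  have "\<forall>\<^sub>F n in sequentially. \<alpha>\<^sub>0 \<le> m n" "\<forall>\<^sub>F n in sequentially. t n \<le> 1 / 3"
    "\<forall>\<^sub>F n in sequentially. m n / real n \<le> t n / 4"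
    unfolding m_def t_def by real_asymp+
  moreover have "\<forall>\<^sub>F n in sequentially. 2 * m n ^ 4 * (1 / real n) ^ 3 \<le> \<alpha>\<^sub>0 * t n"
    "\<forall>\<^sub>F n in sequentially. (m n)\<^sup>2 / real n \<le> 2 * \<alpha>\<^sub>0 * t n"
    unfolding m_def t_def using pos by real_asymp+
  moreover have "\<forall>\<^sub>F n::nat in sequentially. 0 < n" by real_asymp
  ultimately show ?thesis
  proof eventually_elim
    case (elim n)
    have v: "varsigma n = 3 * t n" by (simp add: varsigma_def kappa_values t_def)
    have t0: "0 \<le> t n" by (simp add: t_def)
    show ?case
    proof (intro ballI)
      fix \<alpha> s \<beta>
      assume \<alpha>: "\<alpha> \<in> {alpha_lower n..alpha_upper n}" and s: "s \<in> {0..1} - sites n"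
        and \<beta>: "\<beta> \<in> {\<alpha>, \<alpha>\<^sub>0}"
      have "0 < alpha_lower n" using elim by (simp add: alpha_lower_def)
      hence \<alpha>': "0 < \<alpha>" "\<alpha> \<le> m n" using \<alpha> by (auto simp: alpha_upper_def m_def kappa_values)
      from site_location[OF elim(6) s]
      show "\<bar>mspe (P (\<sigma>\<^sub>0\<^sup>2 * \<alpha>\<^sub>0 / \<alpha>) \<alpha>) n X s \<alpha> / mspe (P (\<sigma>\<^sub>0\<^sup>2) \<alpha>\<^sub>0) n X s \<beta> - 1\<bar> \<le> varsigma n"
      proof
        assume "s < 1 / real n"
        thus ?thesis unfolding v
          using mspe_ratio_boundary[OF fam pos \<alpha>'(1) elim(6) \<alpha>'(2) elim(1) t0 elim(2,3,5)] s \<beta> by simp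
      next
        assume "\<exists>i. Suc i < n \<and> site n (Suc i) < s \<and> s < site n (Suc (Suc i))"
        thus ?thesis unfolding v
          using mspe_ratio_interior[OF fam pos \<alpha>'(1) elim(6) \<alpha>'(2) elim(1) t0 elim(2,3,4)] \<beta> by blast
      qed
    qed
  qed
qed

text \<open>The predictor does not involve the variance, which therefore enters the error as a mere
  factor. Changing \<theta> at fixed \<alpha> multiplies the ratio by the same constant at every
  point.\<close>

lemma mspe_rescale:
  assumes fam: "matern_gp_family P X" and "0 < \<alpha>" "0 < \<sigma>2" "0 < c" "0 < n" and s: "s \<in> {0..1} - sites n"
  shows "mspe (P (c * \<sigma>2) \<alpha>) n X s \<alpha> = c * mspe (P \<sigma>2 \<alpha>) n X s \<alpha>"
  using site_location[OF assms(5) s]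
proof
  assume "s < 1 / real n"
  thus ?thesis using mspe_boundary[OF gp_of_family[OF fam]] assms by simp
next
  assume "\<exists>i. Suc i < n \<and> site n (Suc i) < s \<and> s < site n (Suc (Suc i))"
  then obtain i where "Suc i < n" "site n (Suc i) < s" "s < site n (Suc (Suc i))" by blast
  thus ?thesis using mspe_interior[OF gp_of_family[OF fam]] assms by simp
qed

text \<open>A large deviation of the ratio of mean squared errors forces \<open>\<theta> / \<theta>\<^sub>0\<close> away from one,
  because \<open>(1 + 2 q) (1 + 3 q) - 1 \<le> 6 q\<close> for small \<open>q\<close>.\<close>

lemma ratio_dev_large_imp:
  fixes \<sigma>\<^sub>0 \<alpha>\<^sub>0 :: real
  assumes fam: "matern_gp_family P X" and pos: "0 < \<sigma>\<^sub>0" "0 < \<alpha>\<^sub>0"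
  shows "\<forall>\<^sub>F n in sequentially. \<forall>\<alpha>\<in>{alpha_lower n..alpha_upper n}. \<forall>\<theta>>0. \<forall>\<beta>\<in>{\<alpha>, \<alpha>\<^sub>0}.
    ratio_dev n (\<lambda>s. mspe (P (\<theta> / \<alpha>) \<alpha>) n X s \<alpha>) (\<lambda>s. mspe (P (\<sigma>\<^sub>0\<^sup>2) \<alpha>\<^sub>0) n X s \<beta>)
      > ereal (2 * varsigma n) \<longrightarrow> \<bar>\<theta> / (\<sigma>\<^sub>0\<^sup>2 * \<alpha>\<^sub>0) - 1\<bar> > 2 / 3 * varsigma n"
proof -
  have "\<forall>\<^sub>F n in sequentially. varsigma n < 1 / 2"
    by (rule order_tendstoD(2)[OF varsigma_tendsto_0]) simp
  moreover have "\<forall>\<^sub>F n::nat in sequentially. 0 < n" by real_asymp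
  ultimately show ?thesis using mspe_ratio_eventually[OF assms]
  proof eventually_elim
    case (elim n)
    show ?case
    proof (intro ballI allI impI, rule ccontr)
      fix \<alpha> \<theta> \<beta>
      assume \<alpha>: "\<alpha> \<in> {alpha_lower n..alpha_upper n}" and \<theta>: "0 < \<theta>" and \<beta>: "\<beta> \<in> {\<alpha>, \<alpha>\<^sub>0}"
        and large: "ratio_dev n (\<lambda>s. mspe (P (\<theta> / \<alpha>) \<alpha>) n X s \<alpha>)
          (\<lambda>s. mspe (P (\<sigma>\<^sub>0\<^sup>2) \<alpha>\<^sub>0) n X s \<beta>) > ereal (2 * varsigma n)"
        and near: "\<not> \<bar>\<theta> / (\<sigma>\<^sub>0\<^sup>2 * \<alpha>\<^sub>0) - 1\<bar> > 2 / 3 * varsigma n"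
      define c where "c = \<theta> / (\<sigma>\<^sub>0\<^sup>2 * \<alpha>\<^sub>0)"
      have c: "0 < c" using \<theta> pos by (simp add: c_def)
      have "0 < alpha_lower n" using elim by (simp add: alpha_lower_def)
      hence \<alpha>0: "0 < \<alpha>" using \<alpha> by simp
      have \<sigma>: "0 < \<sigma>\<^sub>0\<^sup>2 * \<alpha>\<^sub>0 / \<alpha>" using pos \<alpha>0 by simp
      have \<theta>_eq: "\<theta> / \<alpha> = c * (\<sigma>\<^sub>0\<^sup>2 * \<alpha>\<^sub>0 / \<alpha>)" using pos by (simp add: c_def)
      from large obtain s where s: "s \<in> {0..1} - sites n"
        and l: "2 * varsigma n < \<bar>mspe (P (\<theta> / \<alpha>) \<alpha>) n X s \<alpha> / mspe (P (\<sigma>\<^sub>0\<^sup>2) \<alpha>\<^sub>0) n X s \<beta> - 1\<bar>"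
        unfolding ratio_dev_def less_SUP_iff by auto
      define r where "r = mspe (P (\<sigma>\<^sub>0\<^sup>2 * \<alpha>\<^sub>0 / \<alpha>) \<alpha>) n X s \<alpha> / mspe (P (\<sigma>\<^sub>0\<^sup>2) \<alpha>\<^sub>0) n X s \<beta>"
      have r: "\<bar>r - 1\<bar> \<le> varsigma n" using elim(3) \<alpha> s \<beta> unfolding r_def by blast
      have l': "2 * varsigma n < \<bar>c * r - 1\<bar>"
        using l unfolding \<theta>_eq mspe_rescale[OF fam \<alpha>0 \<sigma> c elim(2) s] r_def by simp
      have v: "0 \<le> varsigma n" by (simp add: varsigma_def)
      have cc: "\<bar>c - 1\<bar> \<le> 2 / 3 * varsigma n" using near by (simp add: c_def)
      have "c * r - 1 = (c - 1) * r + (r - 1)" by (simp add: algebra_simps)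
      hence "\<bar>c * r - 1\<bar> \<le> \<bar>c - 1\<bar> * \<bar>r\<bar> + \<bar>r - 1\<bar>" by (metis abs_mult abs_triangle_ineq)
      \<comment> \<open>\<open>varsigma n < 1/2\<close> gives |r| \<le> 3/2, which cancels the
        factor 2/3.\<close>
      also have "\<dots> \<le> (2 / 3 * varsigma n) * (3 / 2) + varsigma n"
        using cc r elim(1) v by (intro add_mono mult_mono) auto
      also have "\<dots> = 2 * varsigma n" by simp
      finally show False using l' by simp
    qed
  qed
qed

section \<open>Chi-square tails\<close>

lemma std_normal_exp_square:
  assumes "\<tau> < 1 / 2"
  shows "(\<integral>\<^sup>+x. ennreal (std_normal_density x) * ennreal (exp (\<tau> * x\<^sup>2)) \<partial>lborel)
      = ennreal ((1 - 2 * \<tau>) powr (- 1 / 2))"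
    and "has_bochner_integral std_normal_distribution (\<lambda>x. exp (\<tau> * x\<^sup>2)) ((1 - 2 * \<tau>) powr (- 1 / 2))"
proof -
  define s where "s = 1 / sqrt (1 - 2 * \<tau>)"
  have s: "0 < s" using assms by (simp add: s_def)
  have s_eq: "(1 - 2 * \<tau>) powr (- 1 / 2) = s"
    using assms by (simp add: s_def powr_minus_divide powr_half_sqrt)
  have s2: "1 / s\<^sup>2 = 1 - 2 * \<tau>" using assms by (simp add: s_def power_divide)
  have e: "std_normal_density x * exp (\<tau> * x\<^sup>2) = s * normal_density 0 s x" for x
  proof -
    have "- x\<^sup>2 / 2 + \<tau> * x\<^sup>2 = - ((1 / s\<^sup>2) * x\<^sup>2) / 2" unfolding s2 by (simp add: field_simps)
    also have "\<dots> = - x\<^sup>2 / (2 * s\<^sup>2)" by simp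
    finally have "exp (- x\<^sup>2 / 2) * exp (\<tau> * x\<^sup>2) = exp (- x\<^sup>2 / (2 * s\<^sup>2))"
      by (simp only: exp_add[symmetric])
    thus ?thesis using s by (simp add: normal_density_def real_sqrt_mult field_simps)
  qed
  hence "(\<integral>\<^sup>+x. ennreal (std_normal_density x) * ennreal (exp (\<tau> * x\<^sup>2)) \<partial>lborel)
      = (\<integral>\<^sup>+x. ennreal s * ennreal (normal_density 0 s x) \<partial>lborel)"
    using s by (simp add: ennreal_mult''[symmetric])
  also have "\<dots> = ennreal s * (\<integral>\<^sup>+x. ennreal (normal_density 0 s x) \<partial>lborel)"
    by (rule nn_integral_cmult) simp
  also have "(\<integral>\<^sup>+x. ennreal (normal_density 0 s x) \<partial>lborel) = 1"
    using s by (subst nn_integral_eq_integral) auto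
  finally show 1: "(\<integral>\<^sup>+x. ennreal (std_normal_density x) * ennreal (exp (\<tau> * x\<^sup>2)) \<partial>lborel)
      = ennreal ((1 - 2 * \<tau>) powr (- 1 / 2))"
    by (simp only: s_eq mult_1_right)
  have "(\<integral>\<^sup>+x. ennreal (exp (\<tau> * x\<^sup>2)) \<partial>std_normal_distribution)
      = ennreal ((1 - 2 * \<tau>) powr (- 1 / 2))"
    using 1 by (subst nn_integral_density) auto
  thus "has_bochner_integral std_normal_distribution (\<lambda>x. exp (\<tau> * x\<^sup>2)) ((1 - 2 * \<tau>) powr (- 1 / 2))"
    by (intro has_bochner_integral_nn_integral) auto
qed

text \<open>The Gaussian linearisation \<open>exp (\<tau> z\<^sup>2) = E exp (\<surd>(2 \<tau>) g z)\<close>, with \<open>g\<close> standard normal,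
  reduces the transform of a sum of squares to that of linear combinations; no independence
  of the variables has to be established.\<close>

lemma mgf_sum_squares_partial:
  fixes Z :: "nat \<Rightarrow> 'a \<Rightarrow> real"
  assumes "prob_space M" and Z [measurable]: "\<And>i. Z i \<in> borel_measurable M"
    and mgf: "\<And>c. (\<integral>\<^sup>+\<omega>. ennreal (exp (\<Sum>i<N. c i * Z i \<omega>)) \<partial>M)
        = ennreal (exp ((\<Sum>i<N. (c i)\<^sup>2) / 2))"
    and \<tau>: "0 \<le> \<tau>" "\<tau> < 1 / 2" and k: "k \<le> N"
  shows "(\<integral>\<^sup>+\<omega>. ennreal (exp (\<tau> * (\<Sum>i<k. (Z i \<omega>)\<^sup>2) + (\<Sum>i=k..<N. c i * Z i \<omega>))) \<partial>M)
      = ennreal ((1 - 2 * \<tau>) powr (- real k / 2) * exp ((\<Sum>i=k..<N. (c i)\<^sup>2) / 2))"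
  using k
proof (induction k arbitrary: c)
  case 0
  thus ?case using mgf[of c] \<tau> by (simp add: lessThan_atLeast0)
next
  case (Suc k)
  interpret prob_space M by fact
  interpret pair_sigma_finite M lborel ..
  define a where "a = sqrt (2 * \<tau>)"
  have a2: "a\<^sup>2 = 2 * \<tau>" using \<tau> by (simp add: a_def)
  define R where "R \<omega> = (\<Sum>i=Suc k..<N. c i * Z i \<omega>)" for \<omega>
  define C where "C = (\<Sum>i=Suc k..<N. (c i)\<^sup>2)"
  have [measurable]: "R \<in> borel_measurable M" unfolding R_def by measurable
  have split: "{k..<N} = insert k {Suc k..<N}" using Suc.prems by auto
  have lin: "ennreal (exp (\<tau> * z\<^sup>2))
      = (\<integral>\<^sup>+g. ennreal (std_normal_density g) * ennreal (exp (a * z * g)) \<partial>lborel)" for z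
    using mgf_normal_density[of 1 "a * z"] by (simp add: power_mult_distrib a2)
  have IH: "(\<integral>\<^sup>+\<omega>. ennreal (exp (\<tau> * (\<Sum>i<k. (Z i \<omega>)\<^sup>2) + (a * Z k \<omega> * g + R \<omega>))) \<partial>M)
      = ennreal ((1 - 2 * \<tau>) powr (- real k / 2) * exp (\<tau> * g\<^sup>2 + C / 2))" for g
  proof -
    \<comment> \<open>Given \<open>g\<close>, the k-th square has become a linear term. The
      induction hypothesis absorbs it through a new k-th coefficient, hence the generalisation over
      \<open>c\<close>.\<close>
    define c' where "c' = c(k := a * g)"
    have "(\<Sum>i=k..<N. c' i * Z i \<omega>) = a * Z k \<omega> * g + R \<omega>" for \<omega>
      unfolding split R_def by (simp add: c'_def)
    moreover have "(\<Sum>i=k..<N. (c' i)\<^sup>2) / 2 = \<tau> * g\<^sup>2 + C / 2"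
      unfolding split C_def by (simp add: c'_def power_mult_distrib a2 add_divide_distrib)
    ultimately show ?thesis using Suc.IH[of c'] Suc.prems by simp
  qed
  have "(\<integral>\<^sup>+\<omega>. ennreal (exp (\<tau> * (\<Sum>i<Suc k. (Z i \<omega>)\<^sup>2) + R \<omega>)) \<partial>M)
      = (\<integral>\<^sup>+\<omega>. (\<integral>\<^sup>+g. ennreal (std_normal_density g)
          * ennreal (exp (\<tau> * (\<Sum>i<k. (Z i \<omega>)\<^sup>2) + (a * Z k \<omega> * g + R \<omega>))) \<partial>lborel) \<partial>M)"
  proof (rule nn_integral_cong)
    fix \<omega>
    have "ennreal (exp (\<tau> * (\<Sum>i<Suc k. (Z i \<omega>)\<^sup>2) + R \<omega>))
        = ennreal (exp (\<tau> * (\<Sum>i<k. (Z i \<omega>)\<^sup>2) + R \<omega>)) * ennreal (exp (\<tau> * (Z k \<omega>)\<^sup>2))"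
      by (simp add: ennreal_mult''[symmetric] exp_add[symmetric] algebra_simps)
    also have "\<dots> = (\<integral>\<^sup>+g. ennreal (exp (\<tau> * (\<Sum>i<k. (Z i \<omega>)\<^sup>2) + R \<omega>))
        * (ennreal (std_normal_density g) * ennreal (exp (a * Z k \<omega> * g))) \<partial>lborel)"
      unfolding lin by (rule nn_integral_cmult[symmetric]) simp
    also have "\<dots> = (\<integral>\<^sup>+g. ennreal (std_normal_density g)
          * ennreal (exp (\<tau> * (\<Sum>i<k. (Z i \<omega>)\<^sup>2) + (a * Z k \<omega> * g + R \<omega>))) \<partial>lborel)"
      by (rule nn_integral_cong) (simp add: ennreal_mult''[symmetric] exp_add mult_ac)
    finally show "ennreal (exp (\<tau> * (\<Sum>i<Suc k. (Z i \<omega>)\<^sup>2) + R \<omega>)) = \<dots>" .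
  qed
  also have "\<dots> = (\<integral>\<^sup>+g. (\<integral>\<^sup>+\<omega>. ennreal (std_normal_density g)
          * ennreal (exp (\<tau> * (\<Sum>i<k. (Z i \<omega>)\<^sup>2) + (a * Z k \<omega> * g + R \<omega>))) \<partial>M) \<partial>lborel)"
    by (rule Fubini'[symmetric]) measurable
  also have "\<dots> = (\<integral>\<^sup>+g. ennreal (std_normal_density g)
      * ennreal ((1 - 2 * \<tau>) powr (- real k / 2) * exp (\<tau> * g\<^sup>2 + C / 2)) \<partial>lborel)"
    by (rule nn_integral_cong) (simp add: nn_integral_cmult IH)
  also have "\<dots> = (\<integral>\<^sup>+g. ennreal ((1 - 2 * \<tau>) powr (- real k / 2) * exp (C / 2))
      * (ennreal (std_normal_density g) * ennreal (exp (\<tau> * g\<^sup>2))) \<partial>lborel)"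
    by (rule nn_integral_cong) (simp add: ennreal_mult''[symmetric] exp_add mult_ac)
  also have "\<dots> = ennreal ((1 - 2 * \<tau>) powr (- real k / 2) * exp (C / 2))
      * ennreal ((1 - 2 * \<tau>) powr (- 1 / 2))"
    by (simp only: std_normal_exp_square(1)[OF \<tau>(2), symmetric]) (rule nn_integral_cmult, simp)
  also have "\<dots> = ennreal ((1 - 2 * \<tau>) powr (- real (Suc k) / 2) * exp (C / 2))"
  proof -
    have "- real (Suc k) / 2 = - real k / 2 + - 1 / 2" by simp
    hence "(1 - 2 * \<tau>) powr (- real (Suc k) / 2)
        = (1 - 2 * \<tau>) powr (- real k / 2) * (1 - 2 * \<tau>) powr (- 1 / 2)"
      by (simp only: powr_add)
    thus ?thesis by (simp add: ennreal_mult''[symmetric] mult_ac)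
  qed
  finally show ?case unfolding R_def C_def .
qed

text \<open>A negative exponent has no real linearisation of this kind; the identity is now
  exp(-\<tau> z^2) = E exp(i sqrt(2 \<tau>) g z), so the input consists of characteristic functions.
  The integrands are complex but bounded by 1, which justifies Fubini on a product of probability
  spaces.\<close>

lemma laplace_sum_squares_partial:
  fixes Z :: "nat \<Rightarrow> 'a \<Rightarrow> real"
  assumes "prob_space M" and Z [measurable]: "\<And>i. Z i \<in> borel_measurable M"
    and chf: "\<And>c. (CLINT \<omega>|M. iexp (\<Sum>i<N. c i * Z i \<omega>))
        = complex_of_real (exp (- (\<Sum>i<N. (c i)\<^sup>2) / 2))"
    and \<tau>: "0 \<le> \<tau>" and k: "k \<le> N"
  shows "(CLINT \<omega>|M. complex_of_real (exp (- \<tau> * (\<Sum>i<k. (Z i \<omega>)\<^sup>2)))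
            * iexp (\<Sum>i=k..<N. c i * Z i \<omega>))
      = complex_of_real ((1 + 2 * \<tau>) powr (- real k / 2) * exp (- (\<Sum>i=k..<N. (c i)\<^sup>2) / 2))"
  using k
proof (induction k arbitrary: c)
  case 0
  thus ?case using chf[of c] \<tau> by (simp add: lessThan_atLeast0)
next
  case (Suc k)
  interpret prob_space M by fact
  interpret G: prob_space std_normal_distribution
    by (rule prob_space_normal_density) simp
  interpret pair_prob_space M std_normal_distribution ..
  define a where "a = sqrt (2 * \<tau>)"
  have a2: "a\<^sup>2 = 2 * \<tau>" using \<tau> by (simp add: a_def)
  define R where "R \<omega> = (\<Sum>i=Suc k..<N. c i * Z i \<omega>)" for \<omega>
  define S where "S \<omega> = (\<Sum>i<k. (Z i \<omega>)\<^sup>2)" for \<omega>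
  define C where "C = (\<Sum>i=Suc k..<N. (c i)\<^sup>2)"
  have [measurable]: "R \<in> borel_measurable M" "S \<in> borel_measurable M"
    unfolding R_def S_def by measurable
  have split: "{k..<N} = insert k {Suc k..<N}" using Suc.prems by auto
  have lin: "complex_of_real (exp (- \<tau> * z\<^sup>2)) = (CLINT g|std_normal_distribution. iexp (a * z * g))" for z
  proof -
    have "complex_of_real (exp (- \<tau> * z\<^sup>2)) = char std_normal_distribution (a * z)"
      by (simp add: char_std_normal_distribution power_mult_distrib a2)
    thus ?thesis by (simp add: char_def)
  qed
  have IH: "(CLINT \<omega>|M. complex_of_real (exp (- \<tau> * S \<omega>)) * iexp (a * Z k \<omega> * g + R \<omega>))
      = complex_of_real ((1 + 2 * \<tau>) powr (- real k / 2) * exp (- C / 2)) * complex_of_real (exp (- \<tau> * g\<^sup>2))" for g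
  proof -
    define c' where "c' = c(k := a * g)"
    have lin': "(\<Sum>i=k..<N. c' i * Z i \<omega>) = a * Z k \<omega> * g + R \<omega>" for \<omega>
      unfolding split R_def by (simp add: c'_def)
    have "- (\<Sum>i=k..<N. (c' i)\<^sup>2) / 2 = - C / 2 + - \<tau> * g\<^sup>2"
      unfolding split C_def by (simp add: c'_def power_mult_distrib a2 add_divide_distrib)
    hence e: "exp (- (\<Sum>i=k..<N. (c' i)\<^sup>2) / 2) = exp (- C / 2) * exp (- \<tau> * g\<^sup>2)"
      by (simp only: exp_add)
    from Suc.IH[of c', OF Suc_leD[OF Suc.prems]] show ?thesis
      unfolding lin' e S_def by (simp only: of_real_mult mult.assoc)
  qed
  have "(CLINT \<omega>|M. complex_of_real (exp (- \<tau> * (\<Sum>i<Suc k. (Z i \<omega>)\<^sup>2))) * iexp (R \<omega>))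
      = (CLINT \<omega>|M. CLINT g|std_normal_distribution.
          complex_of_real (exp (- \<tau> * S \<omega>)) * iexp (a * Z k \<omega> * g + R \<omega>))"
  proof (rule Bochner_Integration.integral_cong[OF refl])
    fix \<omega>
    have "complex_of_real (exp (- \<tau> * (\<Sum>i<Suc k. (Z i \<omega>)\<^sup>2))) * iexp (R \<omega>)
        = complex_of_real (exp (- \<tau> * S \<omega>)) * iexp (R \<omega>) * complex_of_real (exp (- \<tau> * (Z k \<omega>)\<^sup>2))"
      by (simp add: S_def distrib_left exp_add exp_diff exp_minus divide_inverse mult_ac)
    also have "\<dots> = (CLINT g|std_normal_distribution.
        complex_of_real (exp (- \<tau> * S \<omega>)) * iexp (R \<omega>) * iexp (a * Z k \<omega> * g))"
      unfolding lin by simp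
    also have "\<dots> = (CLINT g|std_normal_distribution.
          complex_of_real (exp (- \<tau> * S \<omega>)) * iexp (a * Z k \<omega> * g + R \<omega>))"
      by (rule Bochner_Integration.integral_cong[OF refl]) (simp add: distrib_left exp_add mult_ac)
    finally show "complex_of_real (exp (- \<tau> * (\<Sum>i<Suc k. (Z i \<omega>)\<^sup>2))) * iexp (R \<omega>) = \<dots>" .
  qed
  also have "\<dots> = (CLINT g|std_normal_distribution. CLINT \<omega>|M.
          complex_of_real (exp (- \<tau> * S \<omega>)) * iexp (a * Z k \<omega> * g + R \<omega>))"
  proof (rule Fubini_integral[symmetric])
    have "0 \<le> \<tau> * S \<omega>" for \<omega> using \<tau> by (simp add: S_def sum_nonneg)
    thus "integrable (M \<Otimes>\<^sub>M std_normal_distribution)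
      (\<lambda>(\<omega>, g). complex_of_real (exp (- \<tau> * S \<omega>)) * iexp (a * Z k \<omega> * g + R \<omega>))"
      by (intro P.integrable_const_bound[of _ 1]) (auto simp: norm_mult simp del: of_real_exp)
  qed
  also have "\<dots> = (CLINT g|std_normal_distribution.
      complex_of_real ((1 + 2 * \<tau>) powr (- real k / 2) * exp (- C / 2)) * complex_of_real (exp (- \<tau> * g\<^sup>2)))"
    unfolding IH ..
  also have "\<dots> = complex_of_real ((1 + 2 * \<tau>) powr (- real k / 2) * exp (- C / 2))
      * complex_of_real (LINT g|std_normal_distribution. exp (- \<tau> * g\<^sup>2))"
    by (simp del: of_real_exp of_real_mult)
  also have "(LINT g|std_normal_distribution. exp (- \<tau> * g\<^sup>2)) = (1 + 2 * \<tau>) powr (- 1 / 2)"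
    using has_bochner_integral_integral_eq[OF std_normal_exp_square(2)[of "- \<tau>"]] \<tau> by simp
  also have "complex_of_real ((1 + 2 * \<tau>) powr (- real k / 2) * exp (- C / 2))
      * complex_of_real ((1 + 2 * \<tau>) powr (- 1 / 2))
      = complex_of_real ((1 + 2 * \<tau>) powr (- real (Suc k) / 2) * exp (- C / 2))"
  proof -
    have "- real (Suc k) / 2 = - real k / 2 + - 1 / 2" by simp
    hence "(1 + 2 * \<tau>) powr (- real (Suc k) / 2)
        = (1 + 2 * \<tau>) powr (- real k / 2) * (1 + 2 * \<tau>) powr (- 1 / 2)"
      by (simp only: powr_add)
    thus ?thesis by (simp add: mult_ac)
  qed
  finally show ?case unfolding R_def C_def .
qed

lemma chi_square_tail:
  fixes Z :: "nat \<Rightarrow> 'a \<Rightarrow> real"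
  assumes M: "prob_space M" and Z [measurable]: "\<And>i. Z i \<in> borel_measurable M"
    and mgf: "\<And>c. (\<integral>\<^sup>+\<omega>. ennreal (exp (\<Sum>i<N. c i * Z i \<omega>)) \<partial>M)
        = ennreal (exp ((\<Sum>i<N. (c i)\<^sup>2) / 2))"
    and chf: "\<And>c. (CLINT \<omega>|M. iexp (\<Sum>i<N. c i * Z i \<omega>))
        = complex_of_real (exp (- (\<Sum>i<N. (c i)\<^sup>2) / 2))"
    and t: "0 < t" "t \<le> 1"
  shows "emeasure M {\<omega>\<in>space M. \<bar>(\<Sum>i<N. (Z i \<omega>)\<^sup>2) - real N\<bar> \<ge> real N * t}
    \<le> ennreal (2 * exp (- real N * t\<^sup>2 / 16))"
proof -
  interpret prob_space M by (rule M)
  define S where "S \<omega> = (\<Sum>i<N. (Z i \<omega>)\<^sup>2)" for \<omega>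
  have [measurable]: "S \<in> borel_measurable M" unfolding S_def by measurable
  \<comment> \<open>Exponent of the Chernoff bounds. Once the logarithm is bounded quadratically,
    the upper tail has exponent N (4 l^2 - l t), minimal at l = t / 8; the same value serves the
    lower tail.\<close>
  define l where "l = t / 8"
  have l: "0 < l" "l \<le> 1 / 8" using t by (simp_all add: l_def)
  have "emeasure M {\<omega>\<in>space M. S \<omega> \<ge> real N * (1 + t)}
      \<le> ennreal (exp (- l * (real N * (1 + t)))) * (\<integral>\<^sup>+\<omega>. ennreal (exp (l * S \<omega>)) * indicator (space M) \<omega> \<partial>M)"
    by (rule Chernoff_ineq_nn_integral_ge) (use l in auto)
  also have "(\<integral>\<^sup>+\<omega>. ennreal (exp (l * S \<omega>)) * indicator (space M) \<omega> \<partial>M)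
      = (\<integral>\<^sup>+\<omega>. ennreal (exp (l * S \<omega>)) \<partial>M)"
    by (rule nn_integral_cong) simp
  also have "\<dots> = ennreal ((1 - 2 * l) powr (- real N / 2))"
    using mgf_sum_squares_partial[OF M Z mgf, of l N "\<lambda>_. 0"] l by (simp add: S_def)
  also have "ennreal (exp (- l * (real N * (1 + t)))) * \<dots>
      = ennreal (exp (- l * (real N * (1 + t)) + (- real N / 2) * ln (1 - 2 * l)))"
  proof -
    have "(1 - 2 * l) powr (- real N / 2) = exp ((- real N / 2) * ln (1 - 2 * l))"
      using l by (simp add: powr_def)
    thus ?thesis by (simp only: exp_add ennreal_mult''[OF exp_ge_zero])
  qed
  also have "\<dots> \<le> ennreal (exp (- real N * t\<^sup>2 / 16))"
  proof -
    have "real N / 2 * (- ln (1 - 2 * l)) \<le> real N / 2 * (2 * l + 2 * (2 * l)\<^sup>2)"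
      using l ln_one_minus_pos_lower_bound[of "2 * l"] by (intro mult_left_mono) auto
    thus ?thesis
      by (intro ennreal_leI) (simp add: l_def power2_eq_square field_simps)
  qed
  finally have up: "emeasure M {\<omega>\<in>space M. S \<omega> \<ge> real N * (1 + t)} \<le> ennreal (exp (- real N * t\<^sup>2 / 16))" .
  have S0: "0 \<le> S \<omega>" for \<omega> by (simp add: S_def sum_nonneg)
  have int: "integrable M (\<lambda>\<omega>. exp (- l * S \<omega>))"
    by (rule integrable_const_bound[of _ 1]) (use S0 l in auto)
  have "complex_of_real (expectation (\<lambda>\<omega>. exp (- l * S \<omega>)))
      = (CLINT \<omega>|M. complex_of_real (exp (- l * S \<omega>)))"
    by (rule integral_complex_of_real[symmetric])
  also have "\<dots> = complex_of_real ((1 + 2 * l) powr (- real N / 2))"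
    using laplace_sum_squares_partial[OF M Z chf, of l N "\<lambda>_. 0"] l by (simp add: S_def)
  finally have E: "expectation (\<lambda>\<omega>. exp (- l * S \<omega>)) = (1 + 2 * l) powr (- real N / 2)"
    by (simp only: of_real_eq_iff)
  have "emeasure M {\<omega>\<in>space M. S \<omega> \<le> real N * (1 - t)}
      \<le> ennreal (exp (l * (real N * (1 - t)))) * (\<integral>\<^sup>+\<omega>. ennreal (exp (- l * S \<omega>)) * indicator (space M) \<omega> \<partial>M)"
    by (rule Chernoff_ineq_nn_integral_le) (use l in auto)
  also have "(\<integral>\<^sup>+\<omega>. ennreal (exp (- l * S \<omega>)) * indicator (space M) \<omega> \<partial>M)
      = (\<integral>\<^sup>+\<omega>. ennreal (exp (- l * S \<omega>)) \<partial>M)"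
    by (rule nn_integral_cong) simp
  also have "\<dots> = ennreal ((1 + 2 * l) powr (- real N / 2))"
    using nn_integral_eq_integral[OF int] E by simp
  also have "ennreal (exp (l * (real N * (1 - t)))) * \<dots>
      = ennreal (exp (l * (real N * (1 - t)) + (- real N / 2) * ln (1 + 2 * l)))"
  proof -
    have "(1 + 2 * l) powr (- real N / 2) = exp ((- real N / 2) * ln (1 + 2 * l))"
      using l by (simp add: powr_def)
    thus ?thesis by (simp only: exp_add ennreal_mult''[OF exp_ge_zero])
  qed
  also have "\<dots> \<le> ennreal (exp (- real N * t\<^sup>2 / 16))"
  proof -
    have "real N / 2 * (2 * l - (2 * l)\<^sup>2) \<le> real N / 2 * ln (1 + 2 * l)"
      using l ln_one_plus_pos_lower_bound[of "2 * l"] by (intro mult_left_mono) auto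
    moreover have "0 \<le> t * (t * real N)" using t by simp
    ultimately show ?thesis
      by (intro ennreal_leI) (simp add: l_def power2_eq_square field_simps)
  qed
  finally have low: "emeasure M {\<omega>\<in>space M. S \<omega> \<le> real N * (1 - t)} \<le> ennreal (exp (- real N * t\<^sup>2 / 16))" .
  have "emeasure M {\<omega>\<in>space M. \<bar>S \<omega> - real N\<bar> \<ge> real N * t}
      \<le> emeasure M ({\<omega>\<in>space M. S \<omega> \<ge> real N * (1 + t)} \<union> {\<omega>\<in>space M. S \<omega> \<le> real N * (1 - t)})"
    by (rule emeasure_mono) (auto simp: algebra_simps abs_if split: if_splits)
  also have "\<dots> \<le> emeasure M {\<omega>\<in>space M. S \<omega> \<ge> real N * (1 + t)}
      + emeasure M {\<omega>\<in>space M. S \<omega> \<le> real N * (1 - t)}"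
    by (rule emeasure_subadditive) auto
  also have "\<dots> \<le> ennreal (exp (- real N * t\<^sup>2 / 16)) + ennreal (exp (- real N * t\<^sup>2 / 16))"
    by (intro add_mono up low)
  also have "\<dots> = ennreal (2 * exp (- real N * t\<^sup>2 / 16))"
    by (simp add: ennreal_plus[symmetric] del: ennreal_plus)
  finally show ?thesis by (simp add: S_def)
qed

section \<open>Typical paths\<close>

text \<open>The four terms expand the covariance of two innovations. For i \<noteq> j the geometric
  decay cancels them in pairs.\<close>

lemma innovation_covariance:
  fixes \<alpha> :: real and n i j :: nat
  defines "K \<equiv> \<lambda>i j. matern \<alpha> (site n i - site n j)" and "r \<equiv> step_corr n \<alpha>"
  shows "K (Suc (Suc i)) (Suc (Suc j)) - r * K (Suc (Suc i)) (Suc j)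
      - r * K (Suc i) (Suc (Suc j)) + r\<^sup>2 * K (Suc i) (Suc j)
    = (if i = j then 1 - r\<^sup>2 else 0)"
proof -
  consider "i = j" | "i < j" | "j < i" by linarith
  thus ?thesis
  proof cases
    case 1
    thus ?thesis
      using matern_site[of j "Suc j" \<alpha> n] matern_site[of j j \<alpha> n] matern_site[of "Suc j" "Suc j" \<alpha> n]
      by (simp add: K_def r_def power2_eq_square)
  next
    case 2
    then obtain d where d: "j = Suc (i + d)" using less_imp_Suc_add by blast
    show ?thesis
      using matern_site(1)[of "Suc i" "Suc j" \<alpha> n] matern_site(1)[of "Suc i" j \<alpha> n]
        matern_site(1)[of i "Suc j" \<alpha> n] matern_site(1)[of i j \<alpha> n]
      by (simp add: K_def r_def d power2_eq_square Suc_diff_le)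
  next
    case 3
    then obtain d where d: "i = Suc (j + d)" using less_imp_Suc_add by blast
    show ?thesis
      using matern_site(2)[of "Suc j" "Suc i" \<alpha> n] matern_site(2)[of "Suc j" i \<alpha> n]
        matern_site(2)[of j "Suc i" \<alpha> n] matern_site(2)[of j i \<alpha> n]
      by (simp add: K_def r_def d power2_eq_square Suc_diff_le)
  qed
qed

lemma site_in_unit: "i \<le> n \<Longrightarrow> site n i \<in> {0..1}"
  by (auto simp: site_def divide_le_eq_1)

context
  fixes M :: "'a measure" and X :: "real \<Rightarrow> 'a \<Rightarrow> real" and \<sigma>2 \<alpha> :: real
  assumes gp: "centered_gaussian_process M {0..1} X (\<lambda>s t. \<sigma>2 * matern \<alpha> (s - t))"
    and \<sigma>2: "0 < \<sigma>2" and \<alpha>: "0 < \<alpha>"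
begin

text \<open>Chernoff with exponent 1 for both signs. The result is weaker than the Gaussian tail but
  suffices at height n^(1/5).\<close>

lemma matern_gp_tail:
  assumes s: "s \<in> {0..1}"
  shows "emeasure M {\<omega>\<in>space M. \<bar>X s \<omega>\<bar> \<ge> a} \<le> ennreal (2 * exp (\<sigma>2 / 2 - a))"
proof -
  interpret prob_space M by (rule gp_prob_space[OF gp])
  have [measurable]: "X s \<in> borel_measurable M" by (rule gp_measurable[OF gp s])
  have tail: "emeasure M {\<omega>\<in>space M. c * X s \<omega> \<ge> a} \<le> ennreal (exp (\<sigma>2 / 2 - a))" if c: "c\<^sup>2 = 1" for c
  proof -
    have "emeasure M {\<omega>\<in>space M. c * X s \<omega> \<ge> a}
      \<le> ennreal (exp (- 1 * a)) * (\<integral>\<^sup>+\<omega>. ennreal (exp (1 * (c * X s \<omega>))) * indicator (space M) \<omega> \<partial>M)"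
      by (rule Chernoff_ineq_nn_integral_ge) auto
    also have "(\<integral>\<^sup>+\<omega>. ennreal (exp (1 * (c * X s \<omega>))) * indicator (space M) \<omega> \<partial>M)
        = (\<integral>\<^sup>+\<omega>. ennreal (exp (c * X s \<omega>)) \<partial>M)"
      by (rule nn_integral_cong) simp
    also have "\<dots> = ennreal (exp (\<sigma>2 / 2))"
      using gp_combination_moments(4)[OF gp, of "{()}" "\<lambda>_. s" "\<lambda>_. c"] s c
      by (simp add: matern_def power2_eq_square[symmetric])
    also have "ennreal (exp (- 1 * a)) * \<dots> = ennreal (exp (\<sigma>2 / 2 - a))"
      by (simp add: ennreal_mult''[symmetric] exp_add[symmetric])
    finally show ?thesis .
  qed
  have "emeasure M {\<omega>\<in>space M. \<bar>X s \<omega>\<bar> \<ge> a}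
      \<le> emeasure M ({\<omega>\<in>space M. 1 * X s \<omega> \<ge> a} \<union> {\<omega>\<in>space M. - 1 * X s \<omega> \<ge> a})"
    by (rule emeasure_mono) auto
  also have "\<dots> \<le> emeasure M {\<omega>\<in>space M. 1 * X s \<omega> \<ge> a} + emeasure M {\<omega>\<in>space M. - 1 * X s \<omega> \<ge> a}"
    by (rule emeasure_subadditive) auto
  also have "\<dots> \<le> ennreal (exp (\<sigma>2 / 2 - a)) + ennreal (exp (\<sigma>2 / 2 - a))"
    by (intro add_mono tail) auto
  finally show ?thesis by (simp add: ennreal_plus[symmetric] del: ennreal_plus)
qed

text \<open>Standardised innovations are white noise, so a linear combination of them has the sum of
  its squared coefficients as variance. This determines the two transforms that
  \<open>chi_square_tail\<close> asks for.\<close>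

lemma innovation_tail:
  assumes n: "0 < n" and t: "0 < t" "t \<le> 1"
  defines "r \<equiv> step_corr n \<alpha>"
  shows "emeasure M {\<omega>\<in>space M. \<bar>(\<Sum>i<n - 1. (X (site n (Suc (Suc i))) \<omega> - r * X (site n (Suc i)) \<omega>)\<^sup>2)
      - real (n - 1) * (\<sigma>2 * (1 - r\<^sup>2))\<bar> \<ge> real (n - 1) * (\<sigma>2 * (1 - r\<^sup>2)) * t}
    \<le> ennreal (2 * exp (- real (n - 1) * t\<^sup>2 / 16))"
proof -
  define v where "v = \<sigma>2 * (1 - r\<^sup>2)"
  have v: "0 < v" using step_corr_bounds(3)[OF n \<alpha>] \<sigma>2 by (simp add: v_def r_def)
  define \<epsilon> where "\<epsilon> i \<omega> = X (site n (Suc (Suc i))) \<omega> - r * X (site n (Suc i)) \<omega>" for i \<omega>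
  define w where "w = 1 / sqrt v"
  have w: "w * w = 1 / v" using v by (simp add: w_def)
  \<comment> \<open>Zero beyond the last innovation, because \<open>chi_square_tail\<close> requires
    measurability for every index.\<close>
  define Z where "Z i \<omega> = (if i < n - 1 then \<epsilon> i \<omega> * w else 0)" for i \<omega>
  have Zm: "Z i \<in> borel_measurable M" for i
  proof (cases "i < n - 1")
    case True
    hence [measurable]: "X (site n (Suc (Suc i))) \<in> borel_measurable M" "X (site n (Suc i)) \<in> borel_measurable M"
      by (auto intro!: gp_measurable[OF gp] site_in_unit)
    show ?thesis using True by (simp add: Z_def[abs_def] \<epsilon>_def)
  qed (simp add: Z_def[abs_def])
  \<comment> \<open>An innovation combines two sites: \<open>True\<close> selects the newer one with
    coefficient 1, \<open>False\<close> the older one with coefficient -r. The map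
    \<open>\<tau>\<close> below is not injective.\<close>
  define I where "I = {..<n - 1} \<times> (UNIV :: bool set)"
  define \<tau> where "\<tau> = (\<lambda>(i, b). site n (if b then Suc (Suc i) else Suc i))"
  have I: "finite I" "\<tau> ` I \<subseteq> {0..1}"
    by (auto simp: I_def \<tau>_def simp del: atLeastAtMost_iff intro!: site_in_unit)
  define d where "d c = (\<lambda>(i, b). c i * w * (if b then 1 else - r))" for c :: "nat \<Rightarrow> real"
  have sumI: "(\<Sum>p\<in>I. f p) = (\<Sum>i<n - 1. f (i, True) + f (i, False))" for f :: "nat \<times> bool \<Rightarrow> real"
    unfolding I_def sum.cartesian_product[symmetric, of "\<lambda>i b. f (i, b)", simplified]
    by (simp add: UNIV_bool add.commute)
  have comb: "(\<Sum>i<n - 1. c i * Z i \<omega>) = (\<Sum>p\<in>I. d c p * X (\<tau> p) \<omega>)" for c \<omega>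
    unfolding sumI by (rule sum.cong) (simp_all add: d_def \<tau>_def Z_def \<epsilon>_def algebra_simps diff_divide_distrib)
  have var: "(\<Sum>p\<in>I. \<Sum>q\<in>I. d c p * d c q * (\<sigma>2 * matern \<alpha> (\<tau> p - \<tau> q))) = (\<Sum>i<n - 1. (c i)\<^sup>2)" for c
  proof -
    have "(\<Sum>p\<in>I. \<Sum>q\<in>I. d c p * d c q * (\<sigma>2 * matern \<alpha> (\<tau> p - \<tau> q)))
      = (\<Sum>i<n - 1. \<Sum>j<n - 1. c i * c j * (if i = j then 1 else 0))"
      unfolding sumI sum.distrib[symmetric]
    proof (intro sum.cong refl)
      fix i j
      define k where "k a b = matern \<alpha> (site n a - site n b)" for a b
      have "k (Suc (Suc i)) (Suc (Suc j)) - r * k (Suc (Suc i)) (Suc j)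
        - r * k (Suc i) (Suc (Suc j)) + r\<^sup>2 * k (Suc i) (Suc j) = (if i = j then 1 - r\<^sup>2 else 0)"
        unfolding k_def r_def by (rule innovation_covariance)
      moreover have "w * w * \<sigma>2 * (1 - r\<^sup>2) = 1"
        using v unfolding w mult.assoc v_def[symmetric] by simp
      ultimately have "w * w * \<sigma>2 * (k (Suc (Suc i)) (Suc (Suc j)) - r * k (Suc (Suc i)) (Suc j)
        - r * k (Suc i) (Suc (Suc j)) + r\<^sup>2 * k (Suc i) (Suc j)) = (if i = j then 1 else 0)"
        by (cases "i = j") (simp_all only: if_True if_False mult_zero_right simp_thms)
      hence "c i * c j * (if i = j then 1 else 0) = c i * c j * (w * w * \<sigma>2
        * (k (Suc (Suc i)) (Suc (Suc j)) - r * k (Suc (Suc i)) (Suc j)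
          - r * k (Suc i) (Suc (Suc j)) + r\<^sup>2 * k (Suc i) (Suc j)))"
        by (rule arg_cong[OF sym])
      thus "d c (i, True) * d c (j, True) * (\<sigma>2 * matern \<alpha> (\<tau> (i, True) - \<tau> (j, True)))
          + d c (i, True) * d c (j, False) * (\<sigma>2 * matern \<alpha> (\<tau> (i, True) - \<tau> (j, False)))
          + (d c (i, False) * d c (j, True) * (\<sigma>2 * matern \<alpha> (\<tau> (i, False) - \<tau> (j, True)))
          + d c (i, False) * d c (j, False) * (\<sigma>2 * matern \<alpha> (\<tau> (i, False) - \<tau> (j, False))))
        = c i * c j * (if i = j then 1 else 0)"
        by (simp only: d_def \<tau>_def k_def[symmetric] prod.case if_True if_False power2_eq_square)
          (simp add: algebra_simps)
    qed
    also have "\<dots> = (\<Sum>i<n - 1. \<Sum>j<n - 1. if j = i then (c i)\<^sup>2 else 0)"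
      by (intro sum.cong) (auto simp: power2_eq_square)
    also have "\<dots> = (\<Sum>i<n - 1. (c i)\<^sup>2)"
      by (intro sum.cong) (auto simp: sum.delta)
    finally show ?thesis .
  qed
  have tail: "emeasure M {\<omega>\<in>space M. \<bar>(\<Sum>i<n - 1. (Z i \<omega>)\<^sup>2) - real (n - 1)\<bar> \<ge> real (n - 1) * t}
      \<le> ennreal (2 * exp (- real (n - 1) * t\<^sup>2 / 16))"
  proof (rule chi_square_tail[OF gp_prob_space[OF gp] Zm _ _ t])
    fix c :: "nat \<Rightarrow> real"
    show "(\<integral>\<^sup>+\<omega>. ennreal (exp (\<Sum>i<n - 1. c i * Z i \<omega>)) \<partial>M) = ennreal (exp ((\<Sum>i<n - 1. (c i)\<^sup>2) / 2))"
      "(CLINT \<omega>|M. iexp (\<Sum>i<n - 1. c i * Z i \<omega>)) = complex_of_real (exp (- (\<Sum>i<n - 1. (c i)\<^sup>2) / 2))"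
      unfolding comb using gp_combination_moments(4,5)[OF gp I, of "d c"] unfolding var by simp_all
  qed
  have "(\<Sum>i<n - 1. (Z i \<omega>)\<^sup>2) = (\<Sum>i<n - 1. (\<epsilon> i \<omega>)\<^sup>2) / v" for \<omega>
    unfolding sum_divide_distrib by (rule sum.cong) (use v in \<open>simp_all add: Z_def power2_eq_square w_def\<close>)
  moreover have "\<bar>a / v - b\<bar> \<ge> b * t \<longleftrightarrow> \<bar>a - b * v\<bar> \<ge> b * v * t" for a b :: real
  proof -
    have "a / v - b = (a - b * v) / v" using v by (simp add: field_simps)
    hence "\<bar>a / v - b\<bar> = \<bar>a - b * v\<bar> / v" using v by (simp add: abs_divide)
    thus ?thesis using v by (simp add: pos_le_divide_eq mult_ac)
  qed
  ultimately show ?thesis using tail by (simp add: \<epsilon>_def v_def)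
qed

end

text \<open>As \<open>\<kappa>\<^sub>l = \<kappa>\<^sub>u = 1 / 200\<close>, the radius in the theorem is of order \<open>n\<close> to the power
  \<open>- 1 / 2 + 3 / 400 = - 197 / 400\<close>. The tolerance here has the smaller exponent
  \<open>- 1 / 2 + 2 / 400 = - 99 / 200\<close>, which still leaves summable chi-square tails.\<close>

definition typical_path :: "real \<Rightarrow> real \<Rightarrow> nat \<Rightarrow> (nat \<Rightarrow> real) \<Rightarrow> bool" where
  "typical_path \<sigma>2 \<alpha> n f \<longleftrightarrow>
     \<bar>(\<Sum>i<n - 1. (f (Suc i) - step_corr n \<alpha> * f i)\<^sup>2) - real (n - 1) * (\<sigma>2 * (1 - (step_corr n \<alpha>)\<^sup>2))\<bar>
       \<le> real (n - 1) * (\<sigma>2 * (1 - (step_corr n \<alpha>)\<^sup>2)) * real n powr (- 99 / 200) \<and>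
     (\<forall>i<n. \<bar>f i\<bar> \<le> real n powr (1 / 5))"

lemma AE_typical_path:
  fixes M :: "'a measure"
  assumes gp: "centered_gaussian_process M {0..1} X (\<lambda>s t. \<sigma>2 * matern \<alpha> (s - t))"
    and \<sigma>2: "0 < \<sigma>2" and \<alpha>: "0 < \<alpha>"
  shows "AE \<omega> in M. \<forall>\<^sub>F n in sequentially. typical_path \<sigma>2 \<alpha> n (\<lambda>i. X (site n (Suc i)) \<omega>)"
proof -
  interpret prob_space M by (rule gp_prob_space[OF gp])
  have X [measurable]: "X (site n (Suc i)) \<in> borel_measurable M" if "i < n" for n i
    using that by (intro gp_measurable[OF gp] site_in_unit) simp
  define t where "t n = real n powr (- 99 / 200)" for n
  define a where "a n = real n powr (1 / 5)" for n
  define r where "r n = step_corr n \<alpha>" for n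
  define v where "v n = real (n - 1) * (\<sigma>2 * (1 - (r n)\<^sup>2))" for n
  define W where "W n \<omega> = (\<Sum>i<n - 1. (X (site n (Suc (Suc i))) \<omega> - r n * X (site n (Suc i)) \<omega>)\<^sup>2)" for n \<omega>
  have W [measurable]: "W n \<in> borel_measurable M" for n
    unfolding W_def by (intro borel_measurable_sum borel_measurable_power borel_measurable_diff
        borel_measurable_times borel_measurable_const X) auto
  define A where "A n = {\<omega>\<in>space M. \<bar>W n \<omega> - v n\<bar> \<ge> v n * t n}" for n
  define B where "B n i = {\<omega>\<in>space M. \<bar>X (site n (Suc i)) \<omega>\<bar> \<ge> a n}" for n i
  define C where "C n = A n \<union> (\<Union>i<n. B n i)" for n
  have sets: "A n \<in> sets M" "i < n \<Longrightarrow> B n i \<in> sets M" for n i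
    unfolding A_def B_def using X[of i n] by measurable
  have C_sets: "C n \<in> sets M" for n unfolding C_def using sets by auto
  \<comment> \<open>Since n t^2 = n^(1/100) and a = n^(1/5), both terms are stretched exponentials
    up to powers of n, hence eventually below 1 / n^2.\<close>
  define b where "b n = 2 * exp (- real (n - 1) * (t n)\<^sup>2 / 16) + real n * (2 * exp (\<sigma>2 / 2 - a n))" for n
  have bound: "measure M (C n) \<le> b n" if n: "0 < n" for n
  proof -
    have t: "0 < t n" "t n \<le> 1" 
      using n powr_mono[of "- 99 / 200" 0 "real n"] by (simp_all add: t_def)
    have "emeasure M (C n) \<le> emeasure M (A n) + emeasure M (\<Union>i<n. B n i)"
      unfolding C_def by (rule emeasure_subadditive) (use sets in auto)
    also have "emeasure M (\<Union>i<n. B n i) \<le> (\<Sum>i<n. emeasure M (B n i))"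
      by (rule emeasure_subadditive_finite) (use sets in auto)
    also have "\<dots> \<le> (\<Sum>i<n. ennreal (2 * exp (\<sigma>2 / 2 - a n)))"
      unfolding B_def by (intro sum_mono matern_gp_tail[OF gp \<sigma>2 \<alpha>] site_in_unit) auto
    also have "\<dots> = ennreal (real n * (2 * exp (\<sigma>2 / 2 - a n)))"
      by (simp add: ennreal_mult' ennreal_of_nat_eq_real_of_nat)
    also have "emeasure M (A n) \<le> ennreal (2 * exp (- real (n - 1) * (t n)\<^sup>2 / 16))"
      unfolding A_def W_def v_def r_def by (rule innovation_tail[OF gp \<sigma>2 \<alpha> n t])
    finally have "emeasure M (C n) \<le> ennreal (b n)"
      by (simp add: b_def ennreal_plus[symmetric] add_mono del: ennreal_plus)
    moreover have "0 \<le> b n" by (simp add: b_def)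
    ultimately show ?thesis by (simp add: emeasure_eq_measure)
  qed
  have "\<forall>\<^sub>F n in sequentially. b n \<le> 1 / real n ^ 2"
  proof -
    have "\<forall>\<^sub>F n in sequentially. 2 * exp (- (real n - 1) * (t n)\<^sup>2 / 16)
        + real n * (2 * exp (\<sigma>2 / 2 - a n)) \<le> 1 / real n ^ 2"
      unfolding t_def a_def by real_asymp
    moreover have "\<forall>\<^sub>F n::nat in sequentially. 0 < n" by real_asymp
    ultimately show ?thesis by eventually_elim (simp add: b_def of_nat_diff)
  qed
  moreover have "\<forall>\<^sub>F n::nat in sequentially. 0 < n" by real_asymp
  ultimately have "\<forall>\<^sub>F n in sequentially. norm (measure M (C n)) \<le> 1 / real n ^ 2"
  proof eventually_elim
    case (elim n)
    show ?case using order_trans[OF bound[OF elim(2)] elim(1)] by simp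
  qed
  moreover have "summable (\<lambda>n. 1 / real n ^ 2)"
    using inverse_power_summable[of 2, where 'a = real] by (simp add: inverse_eq_divide)
  ultimately have "summable (\<lambda>n. measure M (C n))"
    by (rule summable_comparison_test_ev)
  hence "AE \<omega> in M. \<forall>\<^sub>F n in sequentially. \<omega> \<in> space M - C n"
    by (intro borel_cantelli_AE1 C_sets) (simp_all add: less_top[symmetric])
  thus ?thesis
  proof (eventually_elim, elim eventually_mono)
    fix \<omega> n assume \<omega>: "\<omega> \<in> space M - C n"
    show "typical_path \<sigma>2 \<alpha> n (\<lambda>i. X (site n (Suc i)) \<omega>)"
      using \<omega> unfolding typical_path_def
      by (auto simp: C_def A_def B_def W_def v_def t_def a_def r_def not_le less_imp_le)
  qed
qed

section \<open>The quadratic form of the likelihood\<close>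

definition quad_form :: "nat \<Rightarrow> (nat \<Rightarrow> real) \<Rightarrow> real \<Rightarrow> real" where
  "quad_form n f r = (1 - r\<^sup>2) * (f 0)\<^sup>2 + (\<Sum>i<n - 1. (f (Suc i) - r * f i)\<^sup>2)"

definition quad_var :: "nat \<Rightarrow> (nat \<Rightarrow> real) \<Rightarrow> real" where
  "quad_var n f = (\<Sum>i<n - 1. (f (Suc i) - f i)\<^sup>2)"

text \<open>All terms on the right are nonnegative for \<open>0 \<le> r \<le> 1\<close>, which yields a lower bound for the
  quadratic form that is uniform in the correlation.\<close>

lemma quad_form_decomposition:
  assumes "2 \<le> n"
  shows "quad_form n f r = r * quad_var n f + (1 - r) * ((f 0)\<^sup>2 + (f (n - 1))\<^sup>2)
    + (1 - r)\<^sup>2 * (\<Sum>i<n - 2. (f (Suc i))\<^sup>2)"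
proof -
  obtain m where m: "n = Suc (Suc m)" using assms by (metis add_2_eq_Suc le_Suc_ex)
  define T where "T = (\<Sum>i<m. (f (Suc i))\<^sup>2)"
  have "(f (Suc i) - r * f i)\<^sup>2 = r * (f (Suc i) - f i)\<^sup>2 + ((1 - r) * (f (Suc i))\<^sup>2 - r * (1 - r) * (f i)\<^sup>2)" for i
    by (simp add: power2_eq_square algebra_simps)
  hence main: "(\<Sum>i<Suc m. (f (Suc i) - r * f i)\<^sup>2) = r * (\<Sum>i<Suc m. (f (Suc i) - f i)\<^sup>2)
      + ((1 - r) * (\<Sum>i<Suc m. (f (Suc i))\<^sup>2) - r * (1 - r) * (\<Sum>i<Suc m. (f i)\<^sup>2))"
    by (simp only: sum.distrib sum_subtractf sum_distrib_left)
  have 1: "(\<Sum>i<Suc m. (f (Suc i))\<^sup>2) = T + (f (Suc m))\<^sup>2" by (simp add: T_def)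
  have 2: "(\<Sum>i<Suc m. (f i)\<^sup>2) = (f 0)\<^sup>2 + T" unfolding T_def by (rule sum.lessThan_Suc_shift)
  have q: "quad_form n f r = (1 - r\<^sup>2) * (f 0)\<^sup>2 + (r * quad_var n f
      + ((1 - r) * (T + (f (Suc m))\<^sup>2) - r * (1 - r) * ((f 0)\<^sup>2 + T)))"
    unfolding quad_form_def quad_var_def m diff_Suc_1 main 1 2 ..
  have "n - 1 = Suc m" "(\<Sum>i<n - 2. (f (Suc i))\<^sup>2) = T" by (simp_all add: m T_def)
  thus ?thesis
    unfolding q by (simp add: power2_eq_square algebra_simps)
qed

text \<open>For r \<ge> 1/2 the first term of the decomposition already gives V / 2. For smaller r
  the other terms have coefficients at least 1/4, and V is at most 4 times the sum of all squares;
  hence 1/16.\<close>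

lemma quad_form_lower:
  assumes "2 \<le> n" and r: "0 \<le> r" "r \<le> 1"
  shows "quad_var n f / 16 \<le> quad_form n f r"
proof -
  obtain m where m: "n = Suc (Suc m)" using assms(1) by (metis add_2_eq_Suc le_Suc_ex)
  define T where "T = (\<Sum>i<m. (f (Suc i))\<^sup>2)"
  define e where "e = (f 0)\<^sup>2 + (f (Suc m))\<^sup>2"
  define V where "V = quad_var n f"
  have nonneg: "0 \<le> T" "0 \<le> e" "0 \<le> V" by (simp_all add: T_def e_def V_def quad_var_def sum_nonneg)
  have "(f (Suc i) - f i)\<^sup>2 \<le> 2 * (f (Suc i))\<^sup>2 + 2 * (f i)\<^sup>2" for i
    using zero_le_power2[of "f (Suc i) + f i"] by (simp add: power2_sum power2_diff)
  hence "V \<le> (\<Sum>i<Suc m. 2 * (f (Suc i))\<^sup>2 + 2 * (f i)\<^sup>2)"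
    unfolding V_def quad_var_def m diff_Suc_1 by (intro sum_mono)
  also have "\<dots> = 2 * (\<Sum>i<Suc m. (f (Suc i))\<^sup>2) + 2 * (\<Sum>i<Suc m. (f i)\<^sup>2)"
    by (simp only: sum.distrib sum_distrib_left)
  also have "(\<Sum>i<Suc m. (f (Suc i))\<^sup>2) = T + (f (Suc m))\<^sup>2" by (simp add: T_def)
  also have "(\<Sum>i<Suc m. (f i)\<^sup>2) = (f 0)\<^sup>2 + T" unfolding T_def by (rule sum.lessThan_Suc_shift)
  finally have VT: "V \<le> 4 * (e + T)" using nonneg(2) unfolding e_def by argo
  have eq: "quad_form n f r = r * V + (1 - r) * e + (1 - r)\<^sup>2 * T"
    using quad_form_decomposition[OF assms(1)] by (simp add: m V_def e_def T_def)
  show ?thesis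
  proof (cases "1 / 2 \<le> r")
    case True
    hence "1 / 2 * V \<le> r * V" using nonneg by (intro mult_right_mono) auto
    moreover have "0 \<le> (1 - r) * e" "0 \<le> (1 - r)\<^sup>2 * T" using nonneg r by simp_all
    ultimately show ?thesis using nonneg unfolding eq V_def[symmetric] by linarith
  next
    case False
    have "(1 / 2)\<^sup>2 \<le> (1 - r)\<^sup>2" using False by (intro power_mono) auto
    hence "1 / 4 * T \<le> (1 - r)\<^sup>2 * T" using nonneg by (intro mult_right_mono) (auto simp: power2_eq_square)
    moreover have "1 / 4 * e \<le> (1 - r) * e" using nonneg False by (intro mult_right_mono) auto
    moreover have "0 \<le> r * V" using nonneg r by simp
    ultimately have "0 + 1 / 4 * e + 1 / 4 * T \<le> quad_form n f r"
      unfolding eq by (intro add_mono)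
    moreover have "V / 16 \<le> 1 / 4 * e + 1 / 4 * T" using VT by simp
    ultimately show ?thesis by (simp add: V_def)
  qed
qed

section \<open>The likelihood\<close>

text \<open>Maximiser in \<theta> of the likelihood at fixed \<alpha>: \<alpha> / n times the
  quadratic form of the inverse correlation matrix.\<close>

definition theta_hat :: "nat \<Rightarrow> (nat \<Rightarrow> real) \<Rightarrow> real \<Rightarrow> real" where
  "theta_hat n f \<alpha> = \<alpha> * quad_form n f (step_corr n \<alpha>) / (real n * (1 - (step_corr n \<alpha>)\<^sup>2))"

lemma one_minus_step_corr_square:
  assumes "0 < n" "0 < \<alpha>"
  shows "2 * (\<alpha> / real n) * (1 - \<alpha> / real n) \<le> 1 - (step_corr n \<alpha>)\<^sup>2"
    "1 - (step_corr n \<alpha>)\<^sup>2 \<le> 2 * (\<alpha> / real n)"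
  using one_minus_exp_square_bounds[of "\<alpha> / real n"] assms by (simp_all add: step_corr_def)

lemma one_minus_step_corr:
  "1 - step_corr n \<alpha> \<le> \<alpha> / real n"
  using exp_ge_add_one_self[of "- \<alpha> / real n"] by (simp add: step_corr_def)

text \<open>Bookkeeping of relative errors: \<open>W\<close> is the sum of squared innovations, \<open>S0\<close> and \<open>S\<close> are
  the quadratic forms at the true and at another correlation, \<open>V\<close> is the quadratic variation.\<close>

lemma relative_error_arithmetic:
  fixes W S0 S V K r0 r R0 R e t :: real
  assumes e: "0 \<le> e" "e \<le> t / 100" "t \<le> 1 / 100"
    and W: "2 * (1 - e) * (1 - t) \<le> W" "W \<le> 2 * (1 + t)"
    and S0: "W \<le> S0" "S0 \<le> W + e"
    and r0: "1 - e \<le> r0" "r0 \<le> 1" and r: "1 - e \<le> r" "r \<le> 1"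
    and V: "0 \<le> V" "S0 = r0 * V + R0" "S = r * V + R"
    and R: "0 \<le> R0" "R0 \<le> e" "0 \<le> R" "R \<le> e"
    and K: "1 / 2 \<le> K" "K * (1 - e) \<le> 1 / 2"
  shows "1 \<le> V" "S \<le> 3" "\<bar>K * S - 1\<bar> \<le> 2 * t"
proof -
  have t: "0 \<le> t" using e by linarith
  have et: "e * t \<le> e * (1 / 100)" "0 \<le> e * t" using e t
    by (simp_all only: mult_left_mono mult_nonneg_nonneg)
  have Wl: "2 - 2 * t - 2 * e \<le> W" using W(1) et by (simp add: algebra_simps)
  have "r0 * V \<le> 1 * V" using r0 V by (intro mult_right_mono) auto
  hence Vl: "2 - 2 * t - 3 * e \<le> V" using Wl S0 V R by linarith
  thus "1 \<le> V" using e t by linarith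
  have "(1 - e) * V \<le> r0 * V" using r0 V by (intro mult_right_mono) auto
  hence Vu0: "V - e * V \<le> 2 + 2 * t + e" using W S0 V R by (simp add: algebra_simps)
  \<comment> \<open>Bootstrapping: the crude bound V \<le> 3 turns the error e V into 3 e. The same
    device is applied to K S below.\<close>
  have eV0: "e * V \<le> 1 / 10000 * V" using e V by (intro mult_right_mono) auto
  hence "V \<le> 3" using Vu0 e by linarith
  hence eV: "e * V \<le> e * 3" "0 \<le> e * V" using e V by (auto intro: mult_left_mono)
  hence Vu: "V \<le> 2 + 2 * t + 4 * e" using Vu0 by linarith
  have "r * V \<le> 1 * V" using r V by (intro mult_right_mono) auto
  hence Su: "S \<le> 2 + 2 * t + 5 * e" using Vu V R by linarith
  thus S3: "S \<le> 3" using e t by linarith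
  have "(1 - e) * V \<le> r * V" using r V by (intro mult_right_mono) auto
  hence Sl: "2 - 2 * t - 6 * e \<le> S" using Vl V R eV by (simp add: algebra_simps)
  have S0: "0 \<le> S" using Sl e t by linarith
  have "1 / 2 * S \<le> K * S" using K S0 by (intro mult_right_mono) auto
  hence low: "1 - t - 3 * e \<le> K * S" using Sl by linarith
  have "K * (1 - e) * S \<le> 1 / 2 * S" using K S0 by (intro mult_right_mono) auto
  moreover have "K * (1 - e) * S = K * S - e * (K * S)" by (simp add: algebra_simps)
  ultimately have "K * S - e * (K * S) \<le> 1 + t + 3 * e" using Su e by linarith
  moreover have "e * (K * S) \<le> 1 / 10000 * (K * S)" using e low t by (intro mult_right_mono) auto
  ultimately have "K * S \<le> 2" using e t by linarith
  hence "e * (K * S) \<le> e * 2" using e by (intro mult_left_mono) auto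
  hence "K * S \<le> 1 + t + 5 * e" using \<open>K * S - e * (K * S) \<le> 1 + t + 3 * e\<close> by linarith
  thus "\<bar>K * S - 1\<bar> \<le> 2 * t" using low e t by linarith
qed

text \<open>Probability controls the innovations at \<open>\<alpha>\<^sub>0\<close> only. The
  quadratic variation does not depend on \<alpha> and carries this information to other
  correlations: the decomposition is read at \<open>r0\<close> to locate \<open>V\<close> and at
  \<open>r\<close> to recover the form. Its remainders are small because 1 - r \<le> m / n while
  squared observations are at most n^(2/5).\<close>

lemma typical_path_bounds_at:
  fixes \<sigma>2 \<alpha>\<^sub>0 :: real
  assumes pos: "0 < \<sigma>2" "0 < \<alpha>\<^sub>0" and n: "2 \<le> n"
    and \<alpha>: "0 < \<alpha>" "\<alpha> \<le> m" "\<alpha>\<^sub>0 \<le> m" and e0: "0 \<le> e"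
    and e: "(1 + m) / real n \<le> e" "3 * (1 + m)\<^sup>2 * (real n powr (2 / 5)) / real n \<le> e * (\<sigma>2 * \<alpha>\<^sub>0)"
    and t: "e \<le> real n powr (- 99 / 200) / 100" "real n powr (- 99 / 200) \<le> 1 / 100"
    and f: "typical_path \<sigma>2 \<alpha>\<^sub>0 n f"
  shows "\<sigma>2 * \<alpha>\<^sub>0 \<le> quad_var n f" "quad_form n f (step_corr n \<alpha>) \<le> 3 * (\<sigma>2 * \<alpha>\<^sub>0)"
    "\<bar>theta_hat n f \<alpha> / (\<sigma>2 * \<alpha>\<^sub>0) - 1\<bar> \<le> 2 * real n powr (- 99 / 200)"
proof -
  define \<theta> where "\<theta> = \<sigma>2 * \<alpha>\<^sub>0"
  have \<theta>: "0 < \<theta>" using pos by (simp add: \<theta>_def)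
  define t where "t = real n powr (- 99 / 200)"
  define z where "z = real n powr (2 / 5)"
  define r0 where "r0 = step_corr n \<alpha>\<^sub>0"
  define r where "r = step_corr n \<alpha>"
  define W where "W = (\<Sum>i<n - 1. (f (Suc i) - r0 * f i)\<^sup>2)"
  define V where "V = quad_var n f"
  define R where "R s = (1 - s) * ((f 0)\<^sup>2 + (f (n - 1))\<^sup>2) + (1 - s)\<^sup>2 * (\<Sum>i<n - 2. (f (Suc i))\<^sup>2)" for s
  have n0: "0 < n" using n by simp
  have m0: "0 < m" using \<alpha> by linarith
  have fz: "(f i)\<^sup>2 \<le> z" if "i < n" for i
  proof -
    have "\<bar>f i\<bar> \<le> real n powr (1 / 5)" using f that by (simp add: typical_path_def)
    hence "\<bar>f i\<bar>\<^sup>2 \<le> (real n powr (1 / 5))\<^sup>2" by (intro power_mono) auto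
    also have "\<dots> = z" using n0 by (simp add: z_def powr_power)
    finally show ?thesis by simp
  qed
  have z0: "0 \<le> z" by (simp add: z_def)
  have step: "0 < step_corr n \<gamma>" "step_corr n \<gamma> < 1" "1 - step_corr n \<gamma> \<le> m / real n" "m / real n \<le> e"
    "\<gamma> / real n \<le> e"
    if "0 < \<gamma>" "\<gamma> \<le> m" for \<gamma>
  proof -
    show "0 < step_corr n \<gamma>" "step_corr n \<gamma> < 1" using step_corr_bounds[OF n0 that(1)] by auto
    have "\<gamma> / real n \<le> m / real n" using that by (simp add: divide_right_mono)
    thus "1 - step_corr n \<gamma> \<le> m / real n" using one_minus_step_corr[of n \<gamma>] by linarith
    have "m / real n \<le> (1 + m) / real n" by (simp add: divide_right_mono)
    thus "m / real n \<le> e" using e(1) by linarith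
    thus "\<gamma> / real n \<le> e" using \<open>\<gamma> / real n \<le> m / real n\<close> by linarith
  qed
  have Rb: "0 \<le> R (step_corr n \<gamma>)" "R (step_corr n \<gamma>) \<le> e * \<theta>"
      "(1 - (step_corr n \<gamma>)\<^sup>2) * (f 0)\<^sup>2 \<le> e * \<theta>"
    if \<gamma>: "0 < \<gamma>" "\<gamma> \<le> m" for \<gamma>
  proof -
    define u where "u = 1 - step_corr n \<gamma>"
    have u: "0 \<le> u" "u \<le> m / real n" using step[OF \<gamma>] by (simp_all add: u_def)
    define T where "T = (\<Sum>i<n - 2. (f (Suc i))\<^sup>2)"
    have "T \<le> (\<Sum>i<n - 2. z)" unfolding T_def by (intro sum_mono fz) auto
    also have "\<dots> \<le> real n * z" using z0 by (simp add: mult_right_mono)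
    finally have T: "0 \<le> T" "T \<le> real n * z" by (simp_all add: T_def sum_nonneg)
    show "0 \<le> R (step_corr n \<gamma>)" using u T by (simp add: R_def u_def[symmetric] T_def[symmetric])
    have "u * ((f 0)\<^sup>2 + (f (n - 1))\<^sup>2) \<le> m / real n * (z + z)"
      using u fz[of 0] fz[of "n - 1"] n m0 by (intro mult_mono add_mono) auto
    moreover have "u\<^sup>2 * T \<le> (m / real n)\<^sup>2 * (real n * z)"
      using u T by (intro mult_mono power_mono) auto
    moreover have "(m / real n)\<^sup>2 * (real n * z) = m\<^sup>2 * z / real n"
      using n0 by (simp add: power2_eq_square)
    moreover have "m / real n * (z + z) + m\<^sup>2 * z / real n = (2 * m + m\<^sup>2) * z / real n"
      by (simp add: algebra_simps add_divide_distrib)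
    moreover have "(2 * m + m\<^sup>2) * z / real n \<le> 3 * (1 + m)\<^sup>2 * z / real n"
      using m0 z0 by (intro divide_right_mono mult_right_mono) (auto simp: power2_eq_square algebra_simps)
    ultimately show "R (step_corr n \<gamma>) \<le> e * \<theta>"
      using e(2) by (simp add: R_def u_def[symmetric] T_def[symmetric] z_def[symmetric] \<theta>_def[symmetric])
    have "(1 - (step_corr n \<gamma>)\<^sup>2) * (f 0)\<^sup>2 \<le> 2 * (\<gamma> / real n) * z"
      using one_minus_step_corr_square(2)[OF n0 \<gamma>(1)] fz[of 0] n \<gamma> by (intro mult_mono) auto
    also have "\<dots> \<le> 2 * (m / real n) * z"
      using \<gamma> z0 by (intro mult_right_mono mult_left_mono divide_right_mono) auto
    also have "\<dots> = (2 * m) * z / real n" by simp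
    also have "\<dots> \<le> 3 * (1 + m)\<^sup>2 * z / real n"
      using m0 z0 by (intro divide_right_mono mult_right_mono) (auto simp: power2_eq_square algebra_simps)
    finally show "(1 - (step_corr n \<gamma>)\<^sup>2) * (f 0)\<^sup>2 \<le> e * \<theta>"
      using e(2) by (simp add: z_def[symmetric] \<theta>_def[symmetric])
  qed
  define Nv where "Nv = real (n - 1) * (\<sigma>2 * (1 - r0\<^sup>2))"
  have W: "\<bar>W - Nv\<bar> \<le> Nv * t" using f by (simp add: typical_path_def W_def Nv_def t_def r0_def)
  have Nv_up: "Nv \<le> 2 * \<theta>"
  proof -
    have "Nv \<le> real n * (\<sigma>2 * (2 * (\<alpha>\<^sub>0 / real n)))"
      unfolding Nv_def r0_def using one_minus_step_corr_square(2)[OF n0 pos(2)] step_corr_bounds(3)[OF n0 pos(2)] pos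
      by (intro mult_mono mult_left_mono) auto
    also have "\<dots> = 2 * \<theta>" using n0 by (simp add: \<theta>_def)
    finally show ?thesis .
  qed
  have Nv_low: "2 * \<theta> * (1 - e) \<le> Nv"
  proof -
    have a0: "\<alpha>\<^sub>0 / real n \<le> m / real n" using \<alpha> by (simp add: divide_right_mono)
    have "2 * \<theta> * (1 - e) \<le> 2 * \<theta> * (1 - (1 / real n + \<alpha>\<^sub>0 / real n))"
      using \<theta> e(1) a0 by (intro mult_left_mono) (auto simp: add_divide_distrib)
    also have "\<dots> \<le> 2 * \<theta> * ((1 - 1 / real n) * (1 - \<alpha>\<^sub>0 / real n))"
      using \<theta> pos by (intro mult_left_mono) (auto simp: algebra_simps)
    also have "\<dots> = real (n - 1) * (\<sigma>2 * (2 * (\<alpha>\<^sub>0 / real n) * (1 - \<alpha>\<^sub>0 / real n)))"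
    proof -
      have "1 - 1 / real n = real (n - 1) / real n" using n0 by (simp add: of_nat_diff diff_divide_distrib)
      thus ?thesis unfolding \<theta>_def by simp
    qed
    also have "\<dots> \<le> Nv"
      unfolding Nv_def r0_def using one_minus_step_corr_square(1)[OF n0 pos(2)] pos
      by (intro mult_left_mono) auto
    finally show ?thesis .
  qed
  have t0: "0 \<le> t" by (simp add: t_def)
  have t1: "t \<le> 1 / 100" and et: "e \<le> t / 100" using t by (simp_all add: t_def)
  have Wl: "2 * (1 - e) * (1 - t) * \<theta> \<le> W"
  proof -
    have "2 * \<theta> * (1 - e) * (1 - t) \<le> Nv * (1 - t)" using Nv_low t1 by (intro mult_right_mono) auto
    also have "\<dots> \<le> W" using W by (simp add: algebra_simps abs_le_iff)
    finally show ?thesis by (simp add: mult_ac)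
  qed
  have Wu: "W \<le> 2 * (1 + t) * \<theta>"
  proof -
    have "W \<le> Nv * (1 + t)" using W by (simp add: algebra_simps abs_le_iff)
    also have "\<dots> \<le> 2 * \<theta> * (1 + t)" using Nv_up t0 by (intro mult_right_mono) auto
    finally show ?thesis by (simp add: mult_ac)
  qed
  have S0_eq: "quad_form n f r0 = (1 - r0\<^sup>2) * (f 0)\<^sup>2 + W" by (simp add: quad_form_def W_def)
  have dec: "quad_form n f s = s * V + R s" for s
    using quad_form_decomposition[OF n, of f s] by (simp add: V_def R_def)
  \<comment> \<open>Close to 1/2, as 1 - r^2 is 2 \<alpha> / n to first order; it converts the
    quadratic form into \<open>theta_hat\<close>.\<close>
  define K where "K = \<alpha> / real n / (1 - r\<^sup>2)"
  have r2: "0 < 1 - r\<^sup>2" using step_corr_bounds(3)[OF n0 \<alpha>(1)] by (simp add: r_def)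
  have K1: "1 / 2 \<le> K"
  proof -
    have "1 / 2 * (1 - r\<^sup>2) \<le> 1 / 2 * (2 * (\<alpha> / real n))"
      unfolding r_def by (intro mult_left_mono one_minus_step_corr_square(2)[OF n0 \<alpha>(1)]) simp
    hence "1 / 2 * (1 - r\<^sup>2) \<le> \<alpha> / real n" by simp
    thus ?thesis unfolding K_def using r2 by (simp only: pos_le_divide_eq)
  qed
  have K2: "K * (1 - e) \<le> 1 / 2"
  proof -
    have "\<alpha> / real n * (1 - e) \<le> \<alpha> / real n * (1 - \<alpha> / real n)"
      using step(5)[OF \<alpha>(1,2)] \<alpha>(1) by (intro mult_left_mono) auto
    also have "\<dots> \<le> (1 - r\<^sup>2) / 2"
      using one_minus_step_corr_square(1)[OF n0 \<alpha>(1)] by (simp add: r_def mult_ac)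
    finally have *: "\<alpha> / real n * (1 - e) \<le> 1 / 2 * (1 - r\<^sup>2)" by simp
    have "K * (1 - e) = \<alpha> / real n * (1 - e) / (1 - r\<^sup>2)" by (simp add: K_def)
    thus ?thesis using * r2 by (simp only: pos_divide_le_eq)
  qed
  have hat: "theta_hat n f \<alpha> = K * quad_form n f r" by (simp add: theta_hat_def K_def r_def)
  have V0: "0 \<le> V" by (simp add: V_def quad_var_def sum_nonneg)
  have "1 \<le> V / \<theta>" "quad_form n f r / \<theta> \<le> 3" "\<bar>K * (quad_form n f r / \<theta>) - 1\<bar> \<le> 2 * t"
  proof (atomize (full), intro conjI)
    note A = relative_error_arithmetic[of e t "W / \<theta>" "quad_form n f r0 / \<theta>" r0 r "V / \<theta>" "R r0 / \<theta>"
        "quad_form n f r / \<theta>" "R r / \<theta>" K]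
    have "2 * (1 - e) * (1 - t) \<le> W / \<theta>" "W / \<theta> \<le> 2 * (1 + t)"
      using Wl Wu \<theta> by (simp_all add: pos_le_divide_eq pos_divide_le_eq)
    moreover have "W / \<theta> \<le> quad_form n f r0 / \<theta>"
      using step_corr_bounds(3)[OF n0 pos(2), folded r0_def] \<theta> unfolding S0_eq
      by (intro divide_right_mono) auto
    moreover have "quad_form n f r0 / \<theta> \<le> W / \<theta> + e"
      using Rb(3)[OF pos(2) \<alpha>(3), folded r0_def] \<theta> unfolding S0_eq
      by (simp add: add_divide_distrib pos_divide_le_eq)
    moreover have "1 - e \<le> r0" "r0 \<le> 1" "1 - e \<le> r" "r \<le> 1"
      using step[OF pos(2) \<alpha>(3)] step[OF \<alpha>(1,2)] by (simp_all add: r0_def r_def)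
    moreover have "0 \<le> V / \<theta>" "quad_form n f r0 / \<theta> = r0 * (V / \<theta>) + R r0 / \<theta>"
      "quad_form n f r / \<theta> = r * (V / \<theta>) + R r / \<theta>"
      using V0 \<theta> by (simp_all add: dec add_divide_distrib)
    moreover have "0 \<le> R r0 / \<theta>" "R r0 / \<theta> \<le> e" "0 \<le> R r / \<theta>" "R r / \<theta> \<le> e"
      using Rb(1,2)[OF pos(2) \<alpha>(3)] Rb(1,2)[OF \<alpha>(1,2)] \<theta>
      by (simp_all add: r0_def r_def pos_divide_le_eq)
    ultimately show "1 \<le> V / \<theta>" "quad_form n f r / \<theta> \<le> 3" "\<bar>K * (quad_form n f r / \<theta>) - 1\<bar> \<le> 2 * t"
      using A e0 et t1 K1 K2 by auto
  qed
  thus "\<sigma>2 * \<alpha>\<^sub>0 \<le> quad_var n f" "quad_form n f (step_corr n \<alpha>) \<le> 3 * (\<sigma>2 * \<alpha>\<^sub>0)"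
    "\<bar>theta_hat n f \<alpha> / (\<sigma>2 * \<alpha>\<^sub>0) - 1\<bar> \<le> 2 * real n powr (- 99 / 200)"
    using \<theta> unfolding hat
    by (simp_all add: \<theta>_def[symmetric] V_def r_def t_def pos_le_divide_eq pos_divide_le_eq)
qed

lemma typical_path_bounds:
  fixes \<sigma>2 \<alpha>\<^sub>0 :: real
  assumes pos: "0 < \<sigma>2" "0 < \<alpha>\<^sub>0"
  shows "\<forall>\<^sub>F n in sequentially. \<forall>f. typical_path \<sigma>2 \<alpha>\<^sub>0 n f \<longrightarrow>
    \<sigma>2 * \<alpha>\<^sub>0 \<le> quad_var n f \<and> (\<forall>\<alpha>\<in>{alpha_lower n..alpha_upper n}.
      quad_form n f (step_corr n \<alpha>) \<le> 3 * (\<sigma>2 * \<alpha>\<^sub>0) \<and>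
      \<bar>theta_hat n f \<alpha> / (\<sigma>2 * \<alpha>\<^sub>0) - 1\<bar> \<le> 2 * real n powr (- 99 / 200))"
proof -
  define \<theta> where "\<theta> = \<sigma>2 * \<alpha>\<^sub>0"
  have \<theta>: "0 < \<theta>" using pos by (simp add: \<theta>_def)
  define m where "m n = real n powr (1 / 200)" for n
  \<comment> \<open>Any exponent strictly between that of the remainder, 1/100 + 2/5 - 1 = -59/100,
    and that of the tolerance, -99/200, would do.\<close>
  define e where "e n = real n powr (- 11 / 20)" for n
  have "\<forall>\<^sub>F n::nat in sequentially. 2 \<le> n" "\<forall>\<^sub>F n in sequentially. \<alpha>\<^sub>0 \<le> m n"
    "\<forall>\<^sub>F n in sequentially. (1 + m n) / real n \<le> e n"
    "\<forall>\<^sub>F n in sequentially. e n \<le> real n powr (- 99 / 200) / 100"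
    "\<forall>\<^sub>F n in sequentially. real n powr (- 99 / 200) \<le> 1 / 100"
    unfolding m_def e_def by real_asymp+
  moreover have "\<forall>\<^sub>F n in sequentially. 3 * (1 + m n)\<^sup>2 * (real n powr (2 / 5)) / real n \<le> e n * \<theta>"
    unfolding m_def e_def using \<theta> by real_asymp
  ultimately show ?thesis
  proof eventually_elim
    case (elim n)
    have l: "0 < alpha_lower n" using elim by (simp add: alpha_lower_def)
    have e0: "0 \<le> e n" by (simp add: e_def)
    show ?case
    proof (intro allI impI)
      fix f assume f: "typical_path \<sigma>2 \<alpha>\<^sub>0 n f"
      note B = typical_path_bounds_at[OF pos elim(1) _ _ elim(2) e0 elim(3) elim(6)[unfolded \<theta>_def] elim(4,5) f]
      \<comment> \<open>\<open>quad_var\<close> does not involve \<alpha>, so one admissible value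
        is enough.\<close>
      have "\<sigma>2 * \<alpha>\<^sub>0 \<le> quad_var n f" by (rule B(1)[of \<alpha>\<^sub>0]) (use pos elim in auto)
      moreover have "\<alpha> \<in> {alpha_lower n..alpha_upper n} \<Longrightarrow> 0 < \<alpha> \<and> \<alpha> \<le> m n" for \<alpha>
        using l by (auto simp: alpha_upper_def m_def kappa_values)
      ultimately show "\<sigma>2 * \<alpha>\<^sub>0 \<le> quad_var n f \<and> (\<forall>\<alpha>\<in>{alpha_lower n..alpha_upper n}.
        quad_form n f (step_corr n \<alpha>) \<le> 3 * (\<sigma>2 * \<alpha>\<^sub>0) \<and>
        \<bar>theta_hat n f \<alpha> / (\<sigma>2 * \<alpha>\<^sub>0) - 1\<bar> \<le> 2 * real n powr (- 99 / 200))"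
        using B(2,3) by blast
    qed
  qed
qed

section \<open>Loss function and factorisation of the likelihood\<close>

definition loss :: "real \<Rightarrow> real" where
  "loss x = x - 1 - ln x"

lemma loss_upper:
  assumes "0 < x"
  shows "loss x \<le> (x - 1)\<^sup>2 / x"
proof -
  have "- ln x \<le> 1 / x - 1" using ln_le_minus_one[of "1 / x"] assms by (simp add: ln_div)
  moreover have "(x - 1)\<^sup>2 / x = x - 1 + (1 / x - 1)"
    using assms by (simp add: power2_eq_square field_simps)
  ultimately show ?thesis by (simp add: loss_def)
qed

text \<open>For x \<ge> 1 the source is ln x \<le> (x - 1/x) / 2, for x < 1 the bound (1 - x)^2 / 2
  \<le> loss x. The common form is increasing in \<open>d\<close>, so a lower bound on the distance
  from 1 is all one has to know.\<close>

lemma loss_lower: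
  assumes x: "0 < x" and d: "0 \<le> d" "d \<le> \<bar>x - 1\<bar>"
  shows "d\<^sup>2 / (2 * (1 + d)) \<le> loss x"
proof (cases "1 \<le> x")
  case True
  have "(1 - 1 / 1) / 2 - ln 1 \<le> (x - 1 / x) / 2 - ln x"
  proof (rule DERIV_nonneg_imp_nondecreasing[OF True])
    fix y :: real assume y: "1 \<le> y" "y \<le> x"
    have "((\<lambda>y. (y - 1 / y) / 2 - ln y) has_real_derivative (1 + 1 / y\<^sup>2) / 2 - 1 / y) (at y)"
      using y by (auto intro!: derivative_eq_intros simp: power2_eq_square)
    moreover have "(1 + 1 / y\<^sup>2) / 2 - 1 / y = (1 - 1 / y)\<^sup>2 / 2"
      using y by (simp add: power2_eq_square field_simps)
    ultimately show "\<exists>D. ((\<lambda>y. (y - 1 / y) / 2 - ln y) has_real_derivative D) (at y) \<and> 0 \<le> D"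
      by (metis divide_nonneg_pos zero_le_power2 zero_less_numeral)
  qed
  hence "ln x \<le> (x - 1 / x) / 2" by simp
  moreover have "x - 1 - (x - 1 / x) / 2 = (x - 1)\<^sup>2 / (2 * x)"
    using x by (simp add: power2_eq_square field_simps)
  ultimately have 1: "(x - 1)\<^sup>2 / (2 * x) \<le> loss x" unfolding loss_def by linarith
  define u where "u = x - 1"
  have u: "d \<le> u" "0 \<le> u" "x = 1 + u" using True d by (simp_all add: u_def)
  have "d\<^sup>2 * (2 * (1 + u)) \<le> u\<^sup>2 * (2 * (1 + d))"
  proof -
    have "d\<^sup>2 \<le> u\<^sup>2" using u d by (intro power_mono) auto
    moreover have "d * (d * u) \<le> u * (d * u)" using u d by (intro mult_right_mono) auto
    ultimately show ?thesis by (simp add: power2_eq_square algebra_simps)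
  qed
  hence "d\<^sup>2 / (2 * (1 + d)) \<le> (x - 1)\<^sup>2 / (2 * x)"
    using u d by (simp add: u(3) frac_le_eq divide_le_eq pos_divide_le_eq pos_le_divide_eq)
  thus ?thesis using 1 by linarith
next
  case False
  have "loss 1 - (1 - 1)\<^sup>2 / 2 \<le> loss x - (1 - x)\<^sup>2 / 2"
  proof (rule DERIV_nonpos_imp_nonincreasing[where f = "\<lambda>y. loss y - (1 - y)\<^sup>2 / 2"])
    show "x \<le> 1" using False by simp
    fix y :: real assume y: "x \<le> y" "y \<le> 1"
    hence y0: "0 < y" using x by linarith
    have "((\<lambda>y. loss y - (1 - y)\<^sup>2 / 2) has_real_derivative 1 - 1 / y + (1 - y)) (at y)"
      unfolding loss_def using y0 by (auto intro!: derivative_eq_intros simp: field_simps)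
    moreover have "1 - 1 / y + (1 - y) = - ((1 - y)\<^sup>2 / y)"
      using y0 by (simp add: power2_eq_square field_simps)
    ultimately show "\<exists>D. ((\<lambda>y. loss y - (1 - y)\<^sup>2 / 2) has_real_derivative D) (at y) \<and> D \<le> 0"
      using y0 by (metis divide_nonneg_pos neg_le_0_iff_le zero_le_power2)
  qed
  hence "(1 - x)\<^sup>2 / 2 \<le> loss x" by (simp add: loss_def)
  moreover have "d\<^sup>2 \<le> (1 - x)\<^sup>2" using d False by (intro power_mono) auto
  moreover have "d\<^sup>2 / (2 * (1 + d)) \<le> d\<^sup>2 / 2" using d by (intro divide_left_mono) auto
  ultimately show ?thesis by linarith
qed

lemma loss_nonneg: "0 < x \<Longrightarrow> 0 \<le> loss x"
  using loss_lower[of x 0] by simp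

text \<open>Maximum over \<theta> of the exponential of \<open>log_lik\<close> at fixed \<alpha>,
  attained at \<open>theta_hat\<close>, provided the quadratic form is positive.\<close>

definition profile_lik :: "nat \<Rightarrow> (nat \<Rightarrow> real) \<Rightarrow> real \<Rightarrow> real" where
  "profile_lik n f \<alpha> = exp (real n / 2 * (ln (real n) - ln (quad_form n f (step_corr n \<alpha>)) - 1)
     + 1 / 2 * ln (1 - (step_corr n \<alpha>)\<^sup>2))"

text \<open>\<theta> enters only through its quotient with the maximiser. In twice the log
  likelihood, the determinant accounts for n - 1 terms ln (1 - r^2) and the substitution of
  \<open>theta_hat\<close> for n of them; the surplus is the square root in
  \<open>profile_lik\<close>.\<close>

lemma exp_log_lik:
  assumes n: "0 < n" and \<theta>: "0 < \<theta>" and \<alpha>: "0 < \<alpha>" and y: "y \<in> carrier_vec n"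
    and q: "0 < quad_form n (vec_index y) (step_corr n \<alpha>)"
  shows "exp (log_lik n y (\<theta> / \<alpha>) \<alpha>)
    = profile_lik n (vec_index y) \<alpha> * exp (- (real n / 2) * loss (theta_hat n (vec_index y) \<alpha> / \<theta>))"
proof -
  define f where "f = vec_index y"
  define r where "r = step_corr n \<alpha>"
  define S where "S = quad_form n f r"
  define u where "u = 1 - r\<^sup>2"
  have u: "0 < u" using step_corr_bounds(3)[OF n \<alpha>] by (simp add: u_def r_def)
  have S: "0 < S" using q by (simp add: S_def f_def r_def)
  obtain m where m: "n = Suc m" using n gr0_implies_Suc by blast
  have "scalar_prod y (corr_inv n \<alpha> *\<^sub>v y)
    = (\<Sum>i<n. (f i - (if i = 0 then 0 else r * f (i - 1)))\<^sup>2 / innov_var r i)"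
    unfolding f_def r_def by (rule corr_inv_quadratic_form[OF n \<alpha> y])
  also have "\<dots> = (f 0)\<^sup>2 + (\<Sum>i<m. (f (Suc i) - r * f i)\<^sup>2 / u)"
    unfolding m by (subst sum.lessThan_Suc_shift) (simp add: innov_var_def u_def)
  also have "\<dots> = S / u"
    using u by (simp add: S_def quad_form_def m u_def[symmetric] add_divide_distrib sum_divide_distrib)
  finally have quad: "scalar_prod y (corr_inv n \<alpha> *\<^sub>v y) = S / u" .
  have det: "ln (Determinant.det (corr_mat n \<alpha>)) = (real n - 1) * ln u"
    using u n by (simp add: det_corr_mat[OF n] r_def[symmetric] u_def[symmetric] ln_realpow of_nat_diff)
  have hat: "theta_hat n f \<alpha> = \<alpha> * S / (real n * u)" by (simp add: theta_hat_def S_def r_def u_def)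
  have lnhat: "ln (theta_hat n f \<alpha> / \<theta>) = ln \<alpha> + ln S - ln (real n) - ln u - ln \<theta>"
    using \<alpha> S u n \<theta> by (simp add: hat ln_div ln_mult)
  have "real n / 2 * (theta_hat n f \<alpha> / \<theta>) = 1 / (2 * (\<theta> / \<alpha>)) * (S / u)"
    using n u \<theta> \<alpha> by (simp add: hat field_simps)
  hence "log_lik n y (\<theta> / \<alpha>) \<alpha>
     = real n / 2 * (ln (real n) - ln S - 1) + 1 / 2 * ln u + - (real n / 2) * loss (theta_hat n f \<alpha> / \<theta>)"
    unfolding log_lik_def quad det loss_def lnhat using \<theta> \<alpha>
    by (simp add: ln_div algebra_simps add_divide_distrib diff_divide_distrib)
  thus ?thesis
    unfolding profile_lik_def f_def[symmetric] r_def[symmetric] S_def[symmetric] u_def[symmetric]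
    by (simp only: exp_add)
qed

text \<open>A bound on the logarithmic derivative keeps a nonnegative function away from zero: at a zero
  the derivative vanishes, so \<open>\<bar>g'\<bar> \<le> K g\<close> holds everywhere.\<close>

lemma lower_bound_of_log_derivative:
  fixes g D :: "real \<Rightarrow> real"
  assumes nonneg: "\<And>t. 0 < t \<Longrightarrow> 0 \<le> g t" and D: "\<And>t. 0 < t \<Longrightarrow> (g has_real_derivative D t) (at t)"
    and lip: "\<And>t. t \<in> {a<..<b} \<Longrightarrow> \<bar>deriv (\<lambda>t. ln (g t)) t\<bar> \<le> K"
    and ab: "0 \<le> a" "x \<in> {a<..<b}" "y \<in> {a<..<b}"
  shows "g x * exp (- K * \<bar>y - x\<bar>) \<le> g y"
proof -
  have DK: "\<bar>D t\<bar> \<le> K * g t" if t: "t \<in> {a<..<b}" for t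
  proof (cases "g t = 0")
    case True
    have t0: "0 < t" using t ab by auto
    have "D t = 0"
    proof (rule DERIV_local_min[OF D[OF t0] t0])
      show "\<forall>s. \<bar>t - s\<bar> < t \<longrightarrow> g t \<le> g s" using nonneg True by auto
    qed
    thus ?thesis using True by simp
  next
    case False
    have t0: "0 < t" using t ab by auto
    have pos: "0 < g t" using False nonneg[OF t0] by simp
    have "((\<lambda>t. ln (g t)) has_real_derivative D t / g t) (at t)"
      using DERIV_chain2[OF DERIV_ln[OF pos] D[OF t0]] by (simp add: divide_inverse mult.commute)
    hence "\<bar>D t / g t\<bar> \<le> K" using lip[OF t] by (simp add: DERIV_imp_deriv)
    thus ?thesis using pos by (simp add: abs_divide pos_divide_le_eq)
  qed
  have dE: "((\<lambda>t. g t * exp (c * t)) has_real_derivative (D t + c * g t) * exp (c * t)) (at t)"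
    if "0 < t" for c t
    using D[OF that] by (auto intro!: derivative_eq_intros simp: algebra_simps)
  show ?thesis
  proof (cases "x \<le> y")
    case True
    \<comment> \<open>Gronwall argument: |g'| \<le> K g makes g exp(K t) nondecreasing and, for the
      other case, g exp(-K t) nonincreasing.\<close>
    have "g x * exp (K * x) \<le> g y * exp (K * y)"
    proof (rule DERIV_nonneg_imp_nondecreasing[OF True])
      fix t assume t: "x \<le> t" "t \<le> y"
      hence ti: "t \<in> {a<..<b}" "0 < t" using ab by auto
      have "0 \<le> (D t + K * g t) * exp (K * t)" using DK[OF ti(1)] by (simp add: abs_le_iff)
      thus "\<exists>D. ((\<lambda>t. g t * exp (K * t)) has_real_derivative D) (at t) \<and> 0 \<le> D"
        using dE[OF ti(2)] by blast
    qed
    hence "g x * exp (K * x) * exp (- K * y) \<le> g y * exp (K * y) * exp (- K * y)"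
      by (rule mult_right_mono) simp
    thus ?thesis using True by (simp add: mult.assoc exp_add[symmetric] algebra_simps)
  next
    case False
    have "g y * exp (- K * y) \<ge> g x * exp (- K * x)"
    proof (rule DERIV_nonpos_imp_nonincreasing[where f = "\<lambda>t. g t * exp (- K * t)"])
      show "y \<le> x" using False by simp
      fix t assume t: "y \<le> t" "t \<le> x"
      hence ti: "t \<in> {a<..<b}" "0 < t" using ab by auto
      have "(D t + (- K) * g t) * exp (- K * t) \<le> 0"
        using DK[OF ti(1)] by (simp add: abs_le_iff mult_nonpos_nonneg)
      thus "\<exists>D. ((\<lambda>t. g t * exp (- K * t)) has_real_derivative D) (at t) \<and> D \<le> 0"
        using dE[OF ti(2), of "- K"] by blast
    qed
    hence "g x * exp (- K * x) * exp (K * y) \<le> g y * exp (- K * y) * exp (K * y)"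
      by (intro mult_right_mono) auto
    thus ?thesis using False by (simp add: mult.assoc exp_add[symmetric] algebra_simps)
  qed
qed

section \<open>Posterior concentration\<close>

text \<open>With \<open>h\<close> the maximiser and \<open>g\<close> the conditional prior density,
  this is the integral over \<open>A\<close> of likelihood times conditional prior, divided by
  \<open>profile_lik\<close>.\<close>

definition likelihood_mass :: "nat \<Rightarrow> real \<Rightarrow> (real \<Rightarrow> real) \<Rightarrow> real set \<Rightarrow> ennreal" where
  "likelihood_mass n h g A = (\<integral>\<^sup>+\<theta>\<in>{0<..} \<inter> A. ennreal (exp (- (real n / 2) * loss (h / \<theta>)) * g \<theta>) \<partial>lborel)"

lemma likelihood_mass_le:
  assumes "0 < h" and g: "\<And>\<theta>. 0 < \<theta> \<Longrightarrow> 0 \<le> g \<theta>"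
    and "(\<integral>\<^sup>+\<theta>\<in>{0<..}. ennreal (g \<theta>) \<partial>lborel) = 1"
  shows "likelihood_mass n h g A \<le> 1"
proof -
  have "likelihood_mass n h g A \<le> (\<integral>\<^sup>+\<theta>\<in>{0<..}. ennreal (g \<theta>) \<partial>lborel)"
    unfolding likelihood_mass_def
  proof (rule nn_integral_mono)
    fix \<theta>
    have "exp (- (real n / 2) * loss (h / \<theta>)) * g \<theta> \<le> 1 * g \<theta>" if "0 < \<theta>"
      using that assms(1) loss_nonneg[of "h / \<theta>"] g by (intro mult_right_mono) auto
    thus "ennreal (exp (- (real n / 2) * loss (h / \<theta>)) * g \<theta>) * indicator ({0<..} \<inter> A) \<theta>
      \<le> ennreal (g \<theta>) * indicator {0<..} \<theta>"
      by (auto simp: indicator_def intro: ennreal_leI)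
  qed
  thus ?thesis using assms(3) by simp
qed

text \<open>The relative errors 2 p and p combine to at most 4 p, and the quadratic upper bound on
  \<open>loss\<close> with x \<ge> 1/2 gives 2 (4 p)^2.\<close>

lemma loss_near:
  fixes \<theta>\<^sub>0 h \<theta> p :: real
  assumes "0 < \<theta>\<^sub>0" "\<bar>h / \<theta>\<^sub>0 - 1\<bar> \<le> 2 * p" "p \<le> 1 / 100" "\<bar>\<theta> / \<theta>\<^sub>0 - 1\<bar> \<le> p"
  shows "loss (h / \<theta>) \<le> 32 * p\<^sup>2"
proof -
  define c where "c = h / \<theta>\<^sub>0"
  define d where "d = \<theta> / \<theta>\<^sub>0"
  define x where "x = c / d"
  have x_eq: "h / \<theta> = x" using assms(1) by (simp add: x_def c_def d_def)
  have c: "\<bar>c - 1\<bar> \<le> 2 * p" and d: "\<bar>d - 1\<bar> \<le> p" using assms by (simp_all add: c_def d_def)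
  have p: "0 \<le> p" using d by linarith
  have d0: "99 / 100 \<le> d" using d assms(3) by linarith
  have "\<bar>c - d\<bar> \<le> 3 * p" using c d by linarith
  also have "\<dots> \<le> 4 * p * d"
    using mult_left_mono[OF d0, of "4 * p"] p by linarith
  finally have "\<bar>c - d\<bar> / d \<le> 4 * p" using d0 by (simp add: pos_divide_le_eq)
  moreover have "x - 1 = (c - d) / d" using d0 by (simp add: x_def diff_divide_distrib)
  ultimately have x1: "\<bar>x - 1\<bar> \<le> 4 * p" using d0 by (simp add: abs_divide)
  hence x2: "1 / 2 \<le> x" using assms(3) by linarith
  have "loss x \<le> (x - 1)\<^sup>2 / x" by (rule loss_upper) (use x2 in simp)
  also have "\<dots> \<le> (4 * p)\<^sup>2 / (1 / 2)"
    using x1 x2 power_mono[OF x1, of 2] by (intro frac_le) auto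
  finally show ?thesis unfolding x_eq by (simp add: power2_eq_square)
qed

text \<open>Two regimes, because the prior density is controlled pointwise only on the window around
  \<open>\<theta>\<^sub>0\<close>. Inside, a deviation 2 q less the estimation error 2 p \<le> q
  keeps the quotient away from 1 by q / 2; outside, its distance from 1 is at least a
  constant.\<close>

lemma loss_far:
  fixes \<theta>\<^sub>0 h \<theta> p :: real
  assumes "0 < \<theta>\<^sub>0" "\<bar>h / \<theta>\<^sub>0 - 1\<bar> \<le> 2 * p" "p \<le> 1 / 100" "0 < \<theta>" "0 < h"
  shows "p \<le> q / 2 \<Longrightarrow> 0 \<le> q \<Longrightarrow> q \<le> 1 / 4 \<Longrightarrow> \<bar>\<theta> / \<theta>\<^sub>0 - 1\<bar> > 2 * q \<Longrightarrow> q\<^sup>2 / 12 \<le> loss (h / \<theta>)"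
    and "\<theta> \<notin> {\<theta>\<^sub>0 / 2<..<2 * \<theta>\<^sub>0} \<Longrightarrow> 1 / 20 \<le> loss (h / \<theta>)"
proof -
  define c where "c = h / \<theta>\<^sub>0"
  define d where "d = \<theta> / \<theta>\<^sub>0"
  define x where "x = c / d"
  have x_eq: "h / \<theta> = x" using assms(1) by (simp add: x_def c_def d_def)
  have x0: "0 < x" using assms by (simp add: x_eq[symmetric])
  have c: "\<bar>c - 1\<bar> \<le> 2 * p" using assms by (simp add: c_def)
  have d: "0 < d" using assms by (simp add: d_def)
  have p: "0 \<le> p" using c by linarith
  {
    assume q: "p \<le> q / 2" "0 \<le> q" "q \<le> 1 / 4" and "\<bar>\<theta> / \<theta>\<^sub>0 - 1\<bar> > 2 * q"
    hence "d > 1 + 2 * q \<or> d < 1 - 2 * q" by (simp add: d_def) linarith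
    hence "q / 2 \<le> \<bar>x - 1\<bar>"
    proof
      assume l: "d > 1 + 2 * q"
      have "(1 - q / 2) * (1 + 2 * q) \<le> (1 - q / 2) * d" using l q by (intro mult_left_mono) auto
      moreover have "(1 - q / 2) * (1 + 2 * q) = 1 + q + q * (1 / 2 - q)" by (simp add: algebra_simps)
      moreover have "0 \<le> q * (1 / 2 - q)" using q by simp
      ultimately have "c \<le> (1 - q / 2) * d" using c q by linarith
      hence "x \<le> 1 - q / 2" using d by (simp add: x_def pos_divide_le_eq)
      thus ?thesis by linarith
    next
      assume l: "d < 1 - 2 * q"
      have "(1 + q / 2) * d \<le> (1 + q / 2) * (1 - 2 * q)" using l q by (intro mult_left_mono) auto
      moreover have "(1 + q / 2) * (1 - 2 * q) = 1 - q - q * (1 / 2 + q)" by (simp add: algebra_simps)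
      moreover have "0 \<le> q * (1 / 2 + q)" using q by simp
      ultimately have "(1 + q / 2) * d \<le> c" using c q by linarith
      hence "1 + q / 2 \<le> x" using d by (simp add: x_def pos_le_divide_eq)
      thus ?thesis by linarith
    qed
    hence "(q / 2)\<^sup>2 / (2 * (1 + q / 2)) \<le> loss x" using x0 q by (intro loss_lower) auto
    moreover have "q\<^sup>2 / 12 \<le> (q / 2)\<^sup>2 / (2 * (1 + q / 2))"
    proof -
      have "(q / 2)\<^sup>2 / 3 \<le> (q / 2)\<^sup>2 / (2 * (1 + q / 2))"
        using q by (intro divide_left_mono) auto
      thus ?thesis by (simp add: power_divide)
    qed
    ultimately show "q\<^sup>2 / 12 \<le> loss (h / \<theta>)" unfolding x_eq by linarith
  }
  {
    assume "\<theta> \<notin> {\<theta>\<^sub>0 / 2<..<2 * \<theta>\<^sub>0}"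
    hence "\<theta> \<le> \<theta>\<^sub>0 / 2 \<or> 2 * \<theta>\<^sub>0 \<le> \<theta>" by auto
    hence "d \<le> 1 / 2 \<or> 2 \<le> d" using assms(1) by (auto simp: d_def pos_divide_le_eq pos_le_divide_eq)
    hence "2 / 5 \<le> \<bar>x - 1\<bar>"
    proof
      assume "d \<le> 1 / 2"
      hence "7 / 5 * d \<le> c" using c assms(3) by linarith
      hence "7 / 5 \<le> x" using d by (simp add: x_def pos_le_divide_eq)
      thus ?thesis by linarith
    next
      assume "2 \<le> d"
      hence "c \<le> 3 / 5 * d" using c assms(3) by linarith
      hence "x \<le> 3 / 5" using d by (simp add: x_def pos_divide_le_eq)
      thus ?thesis by linarith
    qed
    hence "(2 / 5)\<^sup>2 / (2 * (1 + 2 / 5)) \<le> loss x" using x0 by (intro loss_lower) auto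
    thus "1 / 20 \<le> loss (h / \<theta>)" unfolding x_eq by (simp add: power2_eq_square)
  }
qed

text \<open>A Laplace-type bound: only the interval of relative radius \<delta> is retained. There
  the loss is at most 32 p^2, and K \<delta> \<le> 1 keeps the prior density above its central value
  times exp(-\<open>\<theta>\<^sub>0\<close>). Taking \<delta> below p costs no more than the length
  of the interval.\<close>

lemma likelihood_mass_lower:
  fixes \<theta>\<^sub>0 h p \<delta> K :: real
  assumes \<theta>: "0 < \<theta>\<^sub>0" and h: "\<bar>h / \<theta>\<^sub>0 - 1\<bar> \<le> 2 * p" "p \<le> 1 / 100" and \<delta>: "0 < \<delta>" "\<delta> \<le> p" "K * \<delta> \<le> 1"
    and g: "\<And>\<theta>. \<theta> \<in> {\<theta>\<^sub>0 / 2<..<2 * \<theta>\<^sub>0} \<Longrightarrow> g0 * exp (- K * \<bar>\<theta> - \<theta>\<^sub>0\<bar>) \<le> g \<theta>"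
    and g0: "0 \<le> g0" and K: "0 \<le> K"
  shows "ennreal (g0 * (exp (- (16 * real n * p\<^sup>2)) * exp (- \<theta>\<^sub>0) * (2 * \<theta>\<^sub>0 * \<delta>))) \<le> likelihood_mass n h g UNIV"
proof -
  define D where "D = {\<theta>\<^sub>0 - \<theta>\<^sub>0 * \<delta>..\<theta>\<^sub>0 + \<theta>\<^sub>0 * \<delta>}"
  define C where "C = exp (- (16 * real n * p\<^sup>2)) * (g0 * exp (- \<theta>\<^sub>0))"
  have C0: "0 \<le> C" using g0 by (simp add: C_def)
  have \<delta>': "\<theta>\<^sub>0 * \<delta> \<le> \<theta>\<^sub>0 * (1 / 100)" using \<delta> h \<theta> by (intro mult_left_mono) auto
  have "g0 * (exp (- (16 * real n * p\<^sup>2)) * exp (- \<theta>\<^sub>0) * (2 * \<theta>\<^sub>0 * \<delta>)) = C * (2 * (\<theta>\<^sub>0 * \<delta>))"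
    by (simp add: C_def)
  hence "ennreal (g0 * (exp (- (16 * real n * p\<^sup>2)) * exp (- \<theta>\<^sub>0) * (2 * \<theta>\<^sub>0 * \<delta>)))
      = ennreal C * ennreal (2 * (\<theta>\<^sub>0 * \<delta>))"
    by (simp only: ennreal_mult'[OF C0])
  also have "ennreal (2 * (\<theta>\<^sub>0 * \<delta>)) = emeasure lborel D"
    using \<theta> \<delta> by (simp add: D_def)
  also have "ennreal C * emeasure lborel D = (\<integral>\<^sup>+\<theta>. ennreal C * indicator D \<theta> \<partial>lborel)"
    by (rule nn_integral_cmult_indicator[symmetric]) (simp add: D_def)
  also have "\<dots> \<le> likelihood_mass n h g UNIV"
    unfolding likelihood_mass_def
  proof (rule nn_integral_mono)
    fix \<theta>
    show "ennreal C * indicator D \<theta>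
      \<le> ennreal (exp (- (real n / 2) * loss (h / \<theta>)) * g \<theta>) * indicator ({0<..} \<inter> UNIV) \<theta>"
    proof (cases "\<theta> \<in> D")
      case True
      have in_D: "\<bar>\<theta> - \<theta>\<^sub>0\<bar> \<le> \<theta>\<^sub>0 * \<delta>" using True unfolding D_def by auto
      have "\<theta>\<^sub>0 / 2 < \<theta>" "\<theta> < 2 * \<theta>\<^sub>0" using in_D \<delta>' \<theta> by linarith+
      hence \<theta>i: "\<theta> \<in> {\<theta>\<^sub>0 / 2<..<2 * \<theta>\<^sub>0}" by simp
      have \<theta>0: "0 < \<theta>" using \<theta>i \<theta> by auto
      have "\<theta> / \<theta>\<^sub>0 - 1 = (\<theta> - \<theta>\<^sub>0) / \<theta>\<^sub>0" using \<theta> by (simp add: diff_divide_distrib)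
      hence "\<bar>\<theta> / \<theta>\<^sub>0 - 1\<bar> \<le> \<delta>" using in_D \<theta> by (simp add: abs_divide pos_divide_le_eq mult.commute)
      hence "loss (h / \<theta>) \<le> 32 * p\<^sup>2" using \<delta> by (intro loss_near[OF \<theta> h]) auto
      hence "real n / 2 * loss (h / \<theta>) \<le> real n / 2 * (32 * p\<^sup>2)" by (intro mult_left_mono) auto
      hence e1: "exp (- (16 * real n * p\<^sup>2)) \<le> exp (- (real n / 2) * loss (h / \<theta>))" by simp
      have "K * \<bar>\<theta> - \<theta>\<^sub>0\<bar> \<le> K * (\<theta>\<^sub>0 * \<delta>)" using in_D K by (intro mult_left_mono) auto
      also have "\<dots> = \<theta>\<^sub>0 * (K * \<delta>)" by simp
      also have "\<dots> \<le> \<theta>\<^sub>0 * 1" using \<delta> \<theta> by (intro mult_left_mono) auto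
      finally have "g0 * exp (- \<theta>\<^sub>0) \<le> g0 * exp (- K * \<bar>\<theta> - \<theta>\<^sub>0\<bar>)"
        using g0 by (intro mult_left_mono) auto
      also have "\<dots> \<le> g \<theta>" by (rule g[OF \<theta>i])
      finally have "C \<le> exp (- (real n / 2) * loss (h / \<theta>)) * g \<theta>"
        unfolding C_def using e1 g0 by (intro mult_mono) auto
      thus ?thesis using \<theta>0 True by (simp add: ennreal_leI)
    qed simp
  qed
  finally show ?thesis .
qed

text \<open>On the window the density is at most \<open>G\<close> and the exponent comes from q. Off
  the window the total mass 1 replaces a pointwise bound, and the loss is at least a
  constant.\<close>

lemma likelihood_mass_tail:
  fixes \<theta>\<^sub>0 h p q G :: real
  assumes \<theta>: "0 < \<theta>\<^sub>0" and h: "\<bar>h / \<theta>\<^sub>0 - 1\<bar> \<le> 2 * p" "p \<le> 1 / 100" "0 < h"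
    and q: "p \<le> q / 2" "0 \<le> q" "q \<le> 1 / 4"
    and g: "\<And>\<theta>. 0 < \<theta> \<Longrightarrow> 0 \<le> g \<theta>" and meas: "(\<lambda>\<theta>. ennreal (g \<theta>) * indicator {0<..} \<theta>) \<in> borel_measurable borel"
    and one: "(\<integral>\<^sup>+\<theta>\<in>{0<..}. ennreal (g \<theta>) \<partial>lborel) = 1"
    and G: "\<And>\<theta>. \<theta> \<in> {\<theta>\<^sub>0 / 2<..<2 * \<theta>\<^sub>0} \<Longrightarrow> g \<theta> \<le> G" "0 \<le> G"
  shows "likelihood_mass n h g {\<theta>. \<bar>\<theta> / \<theta>\<^sub>0 - 1\<bar> > 2 * q}
    \<le> ennreal (exp (- (real n * q\<^sup>2 / 24)) * G * (3 / 2 * \<theta>\<^sub>0) + exp (- (real n / 40)))"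
proof -
  define E where "E = {\<theta>\<^sub>0 / 2<..<2 * \<theta>\<^sub>0}"
  define C where "C = exp (- (real n * q\<^sup>2 / 24)) * G"
  have C0: "0 \<le> C" using G by (simp add: C_def)
  have "likelihood_mass n h g {\<theta>. \<bar>\<theta> / \<theta>\<^sub>0 - 1\<bar> > 2 * q}
      \<le> (\<integral>\<^sup>+\<theta>. ennreal C * indicator E \<theta>
          + ennreal (exp (- (real n / 40))) * (ennreal (g \<theta>) * indicator {0<..} \<theta>) \<partial>lborel)"
    unfolding likelihood_mass_def
  proof (rule nn_integral_mono)
    fix \<theta>
    show "ennreal (exp (- (real n / 2) * loss (h / \<theta>)) * g \<theta>)
        * indicator ({0<..} \<inter> {\<theta>. \<bar>\<theta> / \<theta>\<^sub>0 - 1\<bar> > 2 * q}) \<theta>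
      \<le> ennreal C * indicator E \<theta>
        + ennreal (exp (- (real n / 40))) * (ennreal (g \<theta>) * indicator {0<..} \<theta>)"
    proof (cases "\<theta> \<in> {0<..} \<inter> {\<theta>. \<bar>\<theta> / \<theta>\<^sub>0 - 1\<bar> > 2 * q}")
      case True
      hence \<theta>': "0 < \<theta>" "\<bar>\<theta> / \<theta>\<^sub>0 - 1\<bar> > 2 * q" by auto
      show ?thesis
      proof (cases "\<theta> \<in> E")
        case E: True
        have "real n / 2 * (q\<^sup>2 / 12) \<le> real n / 2 * loss (h / \<theta>)"
          using loss_far(1)[OF \<theta> h(1,2) \<theta>'(1) h(3) q \<theta>'(2)] by (intro mult_left_mono) auto
        hence "exp (- (real n / 2) * loss (h / \<theta>)) \<le> exp (- (real n * q\<^sup>2 / 24))" by simp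
        hence "exp (- (real n / 2) * loss (h / \<theta>)) * g \<theta> \<le> C"
          unfolding C_def using G(1)[of \<theta>] g[OF \<theta>'(1)] E by (intro mult_mono) (auto simp: E_def)
        thus ?thesis using True E by (simp add: ennreal_leI add_increasing2)
      next
        case E: False
        have "real n / 2 * (1 / 20) \<le> real n / 2 * loss (h / \<theta>)"
          using loss_far(2)[OF \<theta> h(1,2) \<theta>'(1) h(3)] E by (intro mult_left_mono) (auto simp: E_def)
        hence "exp (- (real n / 2) * loss (h / \<theta>)) \<le> exp (- (real n / 40))" by simp
        hence "exp (- (real n / 2) * loss (h / \<theta>)) * g \<theta> \<le> exp (- (real n / 40)) * g \<theta>"
          using g[OF \<theta>'(1)] by (rule mult_right_mono)
        thus ?thesis using True E g[OF \<theta>'(1)] by (simp add: ennreal_leI ennreal_mult''[symmetric])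
      qed
    qed simp
  qed
  also have "\<dots> = (\<integral>\<^sup>+\<theta>. ennreal C * indicator E \<theta> \<partial>lborel)
      + (\<integral>\<^sup>+\<theta>. ennreal (exp (- (real n / 40))) * (ennreal (g \<theta>) * indicator {0<..} \<theta>) \<partial>lborel)"
    using meas by (intro nn_integral_add) (auto simp: E_def)
  also have "(\<integral>\<^sup>+\<theta>. ennreal C * indicator E \<theta> \<partial>lborel) = ennreal C * ennreal (3 / 2 * \<theta>\<^sub>0)"
    using \<theta> by (subst nn_integral_cmult_indicator) (auto simp: E_def intro!: arg_cong[where f = ennreal])
  also have "(\<integral>\<^sup>+\<theta>. ennreal (exp (- (real n / 40))) * (ennreal (g \<theta>) * indicator {0<..} \<theta>) \<partial>lborel)
      = ennreal (exp (- (real n / 40)))"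
    using meas one by (subst nn_integral_cmult) auto
  also have "ennreal C * ennreal (3 / 2 * \<theta>\<^sub>0) + ennreal (exp (- (real n / 40)))
      = ennreal (C * (3 / 2 * \<theta>\<^sub>0) + exp (- (real n / 40)))"
    using C0 \<theta> by (simp add: ennreal_mult'[symmetric] ennreal_plus[symmetric] del: ennreal_plus)
  finally show ?thesis by (simp add: C_def)
qed

text \<open>Upper bound for the tail over lower bound for the total, after division by the prior
  density at \<open>\<theta>\<^sub>0\<close>; \<open>exp c\<close> bounds the reciprocal of that
  density, which is left over in the second term.\<close>

definition tail_ratio :: "real \<Rightarrow> nat \<Rightarrow> real \<Rightarrow> real \<Rightarrow> real" where
  "tail_ratio \<theta>\<^sub>0 n G c = (exp (- (real n * (real n powr (- 197 / 400))\<^sup>2 / 24)) * G * (3 / 2 * \<theta>\<^sub>0) + exp (- (real n / 40)) * exp c)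
    / (exp (- (16 * real n * (real n powr (- 99 / 200))\<^sup>2)) * exp (- \<theta>\<^sub>0) * (2 * \<theta>\<^sub>0 * real n powr (- 1 / 2)))"

lemma likelihood_mass_tail_ratio:
  fixes \<theta>\<^sub>0 h G c K :: real and n :: nat
  defines "p \<equiv> real n powr (- 99 / 200)" and "q \<equiv> real n powr (- 197 / 400)" and "\<delta> \<equiv> real n powr (- 1 / 2)"
  assumes n: "0 < n" and \<theta>: "0 < \<theta>\<^sub>0" and h: "\<bar>h / \<theta>\<^sub>0 - 1\<bar> \<le> 2 * p" "p \<le> 1 / 100" "0 < h"
    and q: "p \<le> q / 2" "q \<le> 1 / 4" and \<delta>: "\<delta> \<le> p" "K * \<delta> \<le> 1" and K: "0 \<le> K"
    and g: "\<And>\<theta>. 0 < \<theta> \<Longrightarrow> 0 \<le> g \<theta>" and meas: "(\<lambda>\<theta>. ennreal (g \<theta>) * indicator {0<..} \<theta>) \<in> borel_measurable borel"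
    and one: "(\<integral>\<^sup>+\<theta>\<in>{0<..}. ennreal (g \<theta>) \<partial>lborel) = 1"
    and G: "\<And>\<theta>. \<theta> \<in> {\<theta>\<^sub>0 / 2<..<2 * \<theta>\<^sub>0} \<Longrightarrow> g \<theta> \<le> G * g \<theta>\<^sub>0" "0 \<le> G"
    and low: "\<And>\<theta>. \<theta> \<in> {\<theta>\<^sub>0 / 2<..<2 * \<theta>\<^sub>0} \<Longrightarrow> g \<theta>\<^sub>0 * exp (- K * \<bar>\<theta> - \<theta>\<^sub>0\<bar>) \<le> g \<theta>"
    and c: "1 \<le> g \<theta>\<^sub>0 * exp c"
  shows "likelihood_mass n h g {\<theta>. \<bar>\<theta> / \<theta>\<^sub>0 - 1\<bar> > 2 * q}
      \<le> ennreal (tail_ratio \<theta>\<^sub>0 n G c) * likelihood_mass n h g UNIV"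
proof -
  define A where "A = exp (- (real n * q\<^sup>2 / 24)) * G * (3 / 2 * \<theta>\<^sub>0) + exp (- (real n / 40)) * exp c"
  define B where "B = exp (- (16 * real n * p\<^sup>2)) * exp (- \<theta>\<^sub>0) * (2 * \<theta>\<^sub>0 * \<delta>)"
  have \<delta>0: "0 < \<delta>" and q0: "0 \<le> q" using n by (simp_all add: \<delta>_def q_def)
  have A0: "0 \<le> A" and B0: "0 < B" using \<theta> G \<delta>0 by (simp_all add: A_def B_def)
  have g0: "0 \<le> g \<theta>\<^sub>0" using g \<theta> by simp
  have T: "tail_ratio \<theta>\<^sub>0 n G c = A / B" by (simp add: tail_ratio_def A_def B_def p_def q_def \<delta>_def)
  have "likelihood_mass n h g {\<theta>. \<bar>\<theta> / \<theta>\<^sub>0 - 1\<bar> > 2 * q}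
      \<le> ennreal (exp (- (real n * q\<^sup>2 / 24)) * (G * g \<theta>\<^sub>0) * (3 / 2 * \<theta>\<^sub>0) + exp (- (real n / 40)))"
    using likelihood_mass_tail[OF \<theta> h q(1) q0 q(2) g meas one, of "G * g \<theta>\<^sub>0" n] G g0 by simp
  also have "\<dots> \<le> ennreal (A / B * (g \<theta>\<^sub>0 * B))"
  proof (rule ennreal_leI)
    have "exp (- (real n / 40)) * 1 \<le> exp (- (real n / 40)) * (g \<theta>\<^sub>0 * exp c)"
      using c by (intro mult_left_mono) auto
    moreover have "A / B * (g \<theta>\<^sub>0 * B) = g \<theta>\<^sub>0 * A" using B0 by simp
    ultimately show "exp (- (real n * q\<^sup>2 / 24)) * (G * g \<theta>\<^sub>0) * (3 / 2 * \<theta>\<^sub>0) + exp (- (real n / 40))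
        \<le> A / B * (g \<theta>\<^sub>0 * B)"
      by (simp add: A_def algebra_simps)
  qed
  also have "\<dots> = ennreal (A / B) * ennreal (g \<theta>\<^sub>0 * B)"
    using A0 B0 g0 by (intro ennreal_mult) auto
  also have "\<dots> \<le> ennreal (A / B) * likelihood_mass n h g UNIV"
    unfolding B_def
    by (intro mult_left_mono likelihood_mass_lower[OF \<theta> h(1,2) \<delta>0 \<delta> low g0 K]) auto
  finally show ?thesis by (simp add: T)
qed

text \<open>A separately continuous function is the pointwise limit of functions that are piecewise
  constant in the first argument.\<close>

lemma borel_measurable_separately_continuous:
  fixes g :: "real \<Rightarrow> real \<Rightarrow> real"
  assumes c1: "\<And>y. 0 < y \<Longrightarrow> continuous_on {0<..} (\<lambda>x. g x y)"
    and c2: "\<And>x. 0 < x \<Longrightarrow> continuous_on {0<..} (\<lambda>y. g x y)"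
  shows "(\<lambda>z. if 0 < fst z \<and> 0 < snd z then g (fst z) (snd z) else 0) \<in> borel_measurable (borel \<Otimes>\<^sub>M borel)"
proof -
  define \<phi> where "\<phi> c y = (if 0 < c \<and> 0 < y then g c y else 0)" for c y
  have [measurable]: "\<phi> c \<in> borel_measurable borel" for c
  proof (cases "0 < c")
    case True
    have "(\<lambda>y. indicator {0<..} y *\<^sub>R g c y) \<in> borel_measurable borel"
      by (rule borel_measurable_continuous_on_indicator[OF _ c2[OF True]]) simp
    moreover have "\<phi> c = (\<lambda>y. indicator {0<..} y *\<^sub>R g c y)"
      using True by (auto simp: \<phi>_def indicator_def fun_eq_iff)
    ultimately show ?thesis by simp
  qed (simp add: \<phi>_def[abs_def])
  \<comment> \<open>Rounding to floor + 1 places the grid point to the right of the first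
    coordinate, hence inside the open half-line where continuity is known.\<close>
  define u where "u k z = (if 0 < fst z then \<phi> ((real_of_int \<lfloor>real (Suc k) * fst z\<rfloor> + 1) / real (Suc k)) (snd z) else 0)"
    for k :: nat and z :: "real \<times> real"
  show ?thesis
  proof (rule borel_measurable_LIMSEQ_real)
    fix k
    have "(\<lambda>z. \<phi> ((real_of_int \<lfloor>real (Suc k) * fst z\<rfloor> + 1) / real (Suc k)) (snd z)) \<in> borel_measurable (borel \<Otimes>\<^sub>M borel)"
      by (rule measurable_compose_countable[where f = "\<lambda>i z. \<phi> ((real_of_int i + 1) / real (Suc k)) (snd z)"]) measurable
    thus "u k \<in> borel_measurable (borel \<Otimes>\<^sub>M borel)"
      unfolding u_def by measurable
  next
    fix z :: "real \<times> real"
    obtain x y where z: "z = (x, y)" by (cases z)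
    show "(\<lambda>k. u k z) \<longlonglongrightarrow> (if 0 < fst z \<and> 0 < snd z then g (fst z) (snd z) else 0)"
    proof (cases "0 < x \<and> 0 < y")
      case True
      define c where "c k = (real_of_int \<lfloor>real (Suc k) * x\<rfloor> + 1) / real (Suc k)" for k
      have cb: "x \<le> c k" "c k \<le> x + 1 / real (Suc k)" for k
      proof -
        have "real (Suc k) * x \<le> real_of_int \<lfloor>real (Suc k) * x\<rfloor> + 1" by linarith
        thus "x \<le> c k" by (simp add: c_def pos_le_divide_eq mult.commute del: of_nat_Suc)
        have "real_of_int \<lfloor>real (Suc k) * x\<rfloor> + 1 \<le> real (Suc k) * x + 1" by linarith
        hence "c k \<le> (real (Suc k) * x + 1) / real (Suc k)"
          unfolding c_def by (rule divide_right_mono) simp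
        thus "c k \<le> x + 1 / real (Suc k)" by (simp add: add_divide_distrib del: of_nat_Suc)
      qed
      have "(\<lambda>k. x + 1 / real (Suc k)) \<longlonglongrightarrow> x + 0"
        by (intro tendsto_add tendsto_const) (use LIMSEQ_inverse_real_of_nat in \<open>simp add: inverse_eq_divide\<close>)
      hence "c \<longlonglongrightarrow> x"
        by (intro tendsto_sandwich[OF _ _ tendsto_const, of x c _ "\<lambda>k. x + 1 / real (Suc k)"]) (use cb in auto)
      moreover have "c k \<in> {0<..}" for k using cb(1)[of k] True by simp
      ultimately have "(\<lambda>k. g (c k) y) \<longlonglongrightarrow> g x y"
        using True by (intro continuous_on_tendsto_compose[OF c1]) auto
      moreover have "u k z = g (c k) y" for k
        using True \<open>c k \<in> {0<..}\<close> by (simp add: u_def z \<phi>_def c_def)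
      ultimately show ?thesis using True by (simp add: z)
    next
      case False
      hence "u k z = 0" for k by (auto simp: u_def z \<phi>_def)
      thus ?thesis using False by (auto simp: z)
    qed
  qed
qed

text \<open>A measurable set that contains the deviation event for large n: \<alpha> outside the
  interval counts as far whatever \<theta> is. The measurability of the event itself, given by a
  supremum over uncountably many points, is thereby avoided.\<close>

definition far_set :: "real \<Rightarrow> real \<Rightarrow> real \<Rightarrow> real \<Rightarrow> (real \<times> real) set" where
  "far_set \<theta>\<^sub>0 a b q = {(\<theta>, \<alpha>). 0 < \<theta> \<and> 0 < \<alpha> \<and> (\<alpha> \<in> {a..b} \<longrightarrow> \<bar>\<theta> / \<theta>\<^sub>0 - 1\<bar> > q)}"

lemma far_set_measurable: "far_set \<theta>\<^sub>0 a b q \<in> sets (borel \<Otimes>\<^sub>M borel)"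
proof -
  have "{z \<in> space (borel \<Otimes>\<^sub>M borel :: (real \<times> real) measure). 0 < fst z \<and> 0 < snd z
      \<and> (snd z \<in> {a..b} \<longrightarrow> \<bar>fst z / \<theta>\<^sub>0 - 1\<bar> > q)} \<in> sets (borel \<Otimes>\<^sub>M borel)"
    by measurable
  also have "{z \<in> space (borel \<Otimes>\<^sub>M borel :: (real \<times> real) measure). 0 < fst z \<and> 0 < snd z
      \<and> (snd z \<in> {a..b} \<longrightarrow> \<bar>fst z / \<theta>\<^sub>0 - 1\<bar> > q)} = far_set \<theta>\<^sub>0 a b q"
    by (auto simp: far_set_def space_pair_measure)
  finally show ?thesis .
qed

lemma cond_prior_continuous:
  assumes "cond_prior_regular \<theta>\<^sub>0 \<pi>" "0 < \<alpha>"
  shows "continuous_on {0<..} (\<lambda>\<theta>. \<pi> \<theta> \<alpha>)"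
proof -
  obtain D where "\<And>\<theta>. 0 < \<theta> \<Longrightarrow> ((\<lambda>t. \<pi> t \<alpha>) has_real_derivative D \<theta>) (at \<theta>)"
    using assms unfolding cond_prior_regular_def by blast
  thus ?thesis by (intro continuous_at_imp_continuous_on) (auto intro: DERIV_isCont)
qed

text \<open>The integral over \<theta> is taken for each fixed \<alpha>. Slices in the range obey
  \<open>ratio\<close>; the others have likelihood mass at most 1 and profile at most
  \<open>C\<close>, together at most C \<epsilon>. The range keeps prior mass at least 1/2, so the
  evidence is at least L / 2, and \<open>CL\<close> absorbs the outside part into \<eta>'.\<close>

lemma posterior_mass_bound:
  fixes \<theta>\<^sub>0 \<alpha>\<^sub>0 a b q \<eta> \<eta>' \<epsilon> C L :: real and y :: "real vec"
  defines "f \<equiv> vec_index y"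
  assumes reg: "cond_prior_regular \<theta>\<^sub>0 \<pi>" and rng: "range_prior_cond \<theta>\<^sub>0 \<alpha>\<^sub>0 \<pi> \<rho>"
    and n: "0 < n" and y: "y \<in> carrier_vec n" and \<theta>\<^sub>0: "0 < \<theta>\<^sub>0" and a: "0 < a"
    and quad: "\<And>\<alpha>. 0 < \<alpha> \<Longrightarrow> 0 < quad_form n f (step_corr n \<alpha>)"
    and C: "\<And>\<alpha>. 0 < \<alpha> \<Longrightarrow> profile_lik n f \<alpha> \<le> C"
    and ratio: "\<And>\<alpha>. \<alpha> \<in> {a..b} \<Longrightarrow>
      likelihood_mass n (theta_hat n f \<alpha>) (\<lambda>\<theta>. \<pi> \<theta> \<alpha>) {\<theta>. \<bar>\<theta> / \<theta>\<^sub>0 - 1\<bar> > q}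
        \<le> ennreal \<eta> * likelihood_mass n (theta_hat n f \<alpha>) (\<lambda>\<theta>. \<pi> \<theta> \<alpha>) UNIV"
    and L: "\<And>\<alpha>. \<alpha> \<in> {a..b} \<Longrightarrow>
      ennreal L \<le> ennreal (profile_lik n f \<alpha>) * likelihood_mass n (theta_hat n f \<alpha>) (\<lambda>\<theta>. \<pi> \<theta> \<alpha>) UNIV"
    and out: "(\<integral>\<^sup>+\<alpha>\<in>{0<..<a}. ennreal (\<rho> \<alpha>) \<partial>lborel) + (\<integral>\<^sup>+\<alpha>\<in>{b<..}. ennreal (\<rho> \<alpha>) \<partial>lborel) \<le> ennreal \<epsilon>"
    and \<epsilon>: "0 \<le> \<epsilon>" "\<epsilon> \<le> 1 / 2" and L0: "0 \<le> L" and \<eta>: "0 \<le> \<eta>" "0 \<le> \<eta>'" and CL: "C * \<epsilon> \<le> \<eta>' * (L / 2)"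
  shows "emeasure (unnormalized_posterior \<pi> \<rho> n y)
      (far_set \<theta>\<^sub>0 a b q)
    \<le> ennreal (\<eta> + \<eta>') * emeasure (unnormalized_posterior \<pi> \<rho> n y) UNIV"
proof -
  define N where "N = unnormalized_posterior \<pi> \<rho> n y"
  define mass where "mass \<alpha> A = likelihood_mass n (theta_hat n f \<alpha>) (\<lambda>\<theta>. \<pi> \<theta> \<alpha>) A" for \<alpha> A
  define w where "w \<theta> \<alpha> = exp (- (real n / 2) * loss (theta_hat n f \<alpha> / \<theta>))" for \<theta> \<alpha>
  \<comment> \<open>The priors are unconstrained at nonpositive arguments; extension by zero makes
    them measurable everywhere.\<close>
  define \<pi>' where "\<pi>' z = (if 0 < fst z \<and> 0 < snd z then \<pi> (fst z) (snd z) else 0)" for z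
  define \<rho>' where "\<rho>' \<alpha> = indicator {0<..} \<alpha> *\<^sub>R \<rho> \<alpha>" for \<alpha>
  define F where "F z = ennreal (profile_lik n f (snd z) * w (fst z) (snd z) * \<pi>' z * \<rho>' (snd z))" for z
  have \<pi>0: "0 \<le> \<pi> \<theta> \<alpha>" if "0 < \<theta>" "0 < \<alpha>" for \<theta> \<alpha>
    using reg that by (simp add: cond_prior_regular_def)
  have \<rho>0: "0 \<le> \<rho> \<alpha>" if "0 < \<alpha>" for \<alpha> using rng that by (simp add: range_prior_cond_def)
  note \<pi>cont = cond_prior_continuous[OF reg]
  have \<pi>m [measurable]: "\<pi>' \<in> borel_measurable (borel \<Otimes>\<^sub>M borel)"
    unfolding \<pi>'_def[abs_def]
    by (rule borel_measurable_separately_continuous) (use \<pi>cont reg in \<open>auto simp: cond_prior_regular_def\<close>)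
  have \<rho>m [measurable]: "\<rho>' \<in> borel_measurable borel"
    unfolding \<rho>'_def[abs_def]
    by (rule borel_measurable_continuous_on_indicator) (use rng in \<open>auto simp: range_prior_cond_def\<close>)
  have step [measurable]: "step_corr n \<in> borel_measurable borel"
    unfolding step_corr_def[abs_def] by measurable
  have [measurable]: "(\<lambda>\<alpha>. quad_form n f (step_corr n \<alpha>)) \<in> borel_measurable borel"
    unfolding quad_form_def by measurable
  have prof [measurable]: "profile_lik n f \<in> borel_measurable borel"
    unfolding profile_lik_def[abs_def] by measurable
  have [measurable]: "theta_hat n f \<in> borel_measurable borel"
    unfolding theta_hat_def[abs_def] by measurable
  have [measurable]: "(\<lambda>z. w (fst z) (snd z)) \<in> borel_measurable (borel \<Otimes>\<^sub>M borel)"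
    unfolding w_def loss_def by measurable
  have Fm [measurable]: "F \<in> borel_measurable (borel \<Otimes>\<^sub>M borel)"
    unfolding F_def[abs_def] by measurable
  have prod: "lborel = (lborel \<Otimes>\<^sub>M lborel :: (real \<times> real) measure)" by (rule lborel_prod[symmetric])
  have N_eq: "N = density (lborel \<Otimes>\<^sub>M lborel) F"
  proof -
    have "(if 0 < \<theta> \<and> 0 < \<alpha> then ennreal (exp (log_lik n y (\<theta> / \<alpha>) \<alpha>) * \<pi> \<theta> \<alpha> * \<rho> \<alpha>) else 0) = F (\<theta>, \<alpha>)" for \<theta> \<alpha>
      using exp_log_lik[OF n _ _ y, of \<theta> \<alpha>] quad[of \<alpha>]
      by (auto simp: F_def \<pi>'_def \<rho>'_def w_def f_def)
    thus ?thesis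
      unfolding N_def unnormalized_posterior_def prod by (simp add: split_beta)
  qed
  define M where "M \<alpha> A = (\<integral>\<^sup>+\<theta>. F (\<theta>, \<alpha>) * indicator A \<theta> \<partial>lborel)" for \<alpha> A
  have M_pos: "M \<alpha> A = ennreal (\<rho> \<alpha>) * (ennreal (profile_lik n f \<alpha>) * mass \<alpha> A)"
    if \<alpha>: "0 < \<alpha>" and A: "A \<in> sets borel" for \<alpha> A
  proof -
    have c: "(\<lambda>\<theta>. indicator {0<..} \<theta> *\<^sub>R \<pi> \<theta> \<alpha>) \<in> borel_measurable borel"
      by (rule borel_measurable_continuous_on_indicator[OF _ \<pi>cont[OF \<alpha>]]) simp
    have "(\<lambda>\<theta>. ennreal (w \<theta> \<alpha> * (indicator {0<..} \<theta> *\<^sub>R \<pi> \<theta> \<alpha>)) * indicator ({0<..} \<inter> A) \<theta>) \<in> borel_measurable borel"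
      using c A unfolding w_def loss_def by measurable
    also have "(\<lambda>\<theta>. ennreal (w \<theta> \<alpha> * (indicator {0<..} \<theta> *\<^sub>R \<pi> \<theta> \<alpha>)) * indicator ({0<..} \<inter> A) \<theta>)
        = (\<lambda>\<theta>. ennreal (w \<theta> \<alpha> * \<pi> \<theta> \<alpha>) * indicator ({0<..} \<inter> A) \<theta>)"
      by (auto simp: fun_eq_iff indicator_def)
    finally have m: "(\<lambda>\<theta>. ennreal (w \<theta> \<alpha> * \<pi> \<theta> \<alpha>) * indicator ({0<..} \<inter> A) \<theta>) \<in> borel_measurable borel" .
    have "M \<alpha> A = (\<integral>\<^sup>+\<theta>. ennreal (\<rho> \<alpha> * profile_lik n f \<alpha>)
        * (ennreal (w \<theta> \<alpha> * \<pi> \<theta> \<alpha>) * indicator ({0<..} \<inter> A) \<theta>) \<partial>lborel)"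
      unfolding M_def
    proof (rule nn_integral_cong)
      fix \<theta>
      show "F (\<theta>, \<alpha>) * indicator A \<theta> = ennreal (\<rho> \<alpha> * profile_lik n f \<alpha>)
        * (ennreal (w \<theta> \<alpha> * \<pi> \<theta> \<alpha>) * indicator ({0<..} \<inter> A) \<theta>)"
        using \<alpha> \<rho>0[OF \<alpha>] \<pi>0[of \<theta> \<alpha>]
        by (auto simp: F_def \<pi>'_def \<rho>'_def w_def profile_lik_def indicator_def ennreal_mult'[symmetric] mult_ac)
    qed
    also have "\<dots> = ennreal (\<rho> \<alpha> * profile_lik n f \<alpha>) * mass \<alpha> A"
      using m unfolding mass_def likelihood_mass_def w_def by (intro nn_integral_cmult) simp
    finally show ?thesis using \<rho>0[OF \<alpha>] by (simp add: ennreal_mult' mult.assoc)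
  qed
  have M_neg: "M \<alpha> A = 0" if "\<not> 0 < \<alpha>" for \<alpha> A
    using that by (simp add: M_def F_def \<rho>'_def)
  have M_meas: "(\<lambda>\<alpha>. M \<alpha> UNIV) \<in> borel_measurable lborel"
    unfolding M_def by measurable
  have emeas: "emeasure N A = (\<integral>\<^sup>+\<alpha>. M \<alpha> {\<theta>. (\<theta>, \<alpha>) \<in> A} \<partial>lborel)" if A: "A \<in> sets (borel \<Otimes>\<^sub>M borel)" for A
  proof -
    have "emeasure N A = (\<integral>\<^sup>+z. F z * indicator A z \<partial>(lborel \<Otimes>\<^sub>M lborel))"
      unfolding N_eq using A by (intro emeasure_density) (auto cong: measurable_cong_sets)
    also have "\<dots> = (\<integral>\<^sup>+\<alpha>. \<integral>\<^sup>+\<theta>. F (\<theta>, \<alpha>) * indicator A (\<theta>, \<alpha>) \<partial>lborel \<partial>lborel)"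
      using A by (intro lborel_pair.nn_integral_snd[symmetric]) (auto cong: measurable_cong_sets)
    also have "\<dots> = (\<integral>\<^sup>+\<alpha>. M \<alpha> {\<theta>. (\<theta>, \<alpha>) \<in> A} \<partial>lborel)"
      unfolding M_def by (intro nn_integral_cong) (simp add: indicator_def)
    finally show ?thesis .
  qed
  have N_UNIV: "emeasure N UNIV = (\<integral>\<^sup>+\<alpha>. M \<alpha> UNIV \<partial>lborel)"
    using emeas[of UNIV] sets.top[of "borel \<Otimes>\<^sub>M borel :: (real \<times> real) measure"]
    by (simp add: space_pair_measure)
  define B where "B = (far_set \<theta>\<^sub>0 a b q)"
  have B_sets: "B \<in> sets (borel \<Otimes>\<^sub>M borel)" unfolding B_def by (rule far_set_measurable)
  define out where "out \<alpha> = ennreal (\<rho> \<alpha>) * indicator ({0<..<a} \<union> {b<..} \<inter> {0<..}) \<alpha>" for \<alpha>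
  have out_meas: "out \<in> borel_measurable lborel"
  proof -
    have "out = (\<lambda>\<alpha>. ennreal (\<rho>' \<alpha>) * indicator ({0<..<a} \<union> {b<..} \<inter> {0<..}) \<alpha>)"
      by (auto simp: out_def \<rho>'_def fun_eq_iff indicator_def)
    thus ?thesis by simp
  qed
  have C0: "0 \<le> C" using C[of 1] by (simp add: profile_lik_def) (meson exp_ge_zero order_trans)
  have out_int: "(\<integral>\<^sup>+\<alpha>. out \<alpha> \<partial>lborel) \<le> ennreal \<epsilon>"
  proof -
    have "(\<integral>\<^sup>+\<alpha>. out \<alpha> \<partial>lborel) \<le> (\<integral>\<^sup>+\<alpha>. ennreal (\<rho>' \<alpha>) * indicator {0<..<a} \<alpha>
        + ennreal (\<rho>' \<alpha>) * indicator ({b<..} \<inter> {0<..}) \<alpha> \<partial>lborel)"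
      by (rule nn_integral_mono) (auto simp: out_def \<rho>'_def indicator_def)
    also have "\<dots> = (\<integral>\<^sup>+\<alpha>. ennreal (\<rho>' \<alpha>) * indicator {0<..<a} \<alpha> \<partial>lborel)
        + (\<integral>\<^sup>+\<alpha>. ennreal (\<rho>' \<alpha>) * indicator ({b<..} \<inter> {0<..}) \<alpha> \<partial>lborel)"
      by (rule nn_integral_add) auto
    also have "\<dots> \<le> (\<integral>\<^sup>+\<alpha>\<in>{0<..<a}. ennreal (\<rho> \<alpha>) \<partial>lborel) + (\<integral>\<^sup>+\<alpha>\<in>{b<..}. ennreal (\<rho> \<alpha>) \<partial>lborel)"
      by (intro add_mono nn_integral_mono) (auto simp: \<rho>'_def indicator_def)
    also have "\<dots> \<le> ennreal \<epsilon>" by (rule out)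
    finally show ?thesis .
  qed
  have slice: "M \<alpha> {\<theta>. (\<theta>, \<alpha>) \<in> B} \<le> ennreal \<eta> * M \<alpha> UNIV + ennreal C * out \<alpha>" for \<alpha>
  proof (cases "0 < \<alpha>")
    case \<alpha>: True
    show ?thesis
    proof (cases "\<alpha> \<in> {a..b}")
      case True
      define T where "T = {\<theta>. \<bar>\<theta> / \<theta>\<^sub>0 - 1\<bar> > q}"
      have T: "T \<in> sets borel" unfolding T_def by measurable
      have "M \<alpha> {\<theta>. (\<theta>, \<alpha>) \<in> B} \<le> M \<alpha> T"
        unfolding M_def by (intro nn_integral_mono mult_left_mono) (use True in \<open>auto simp: B_def far_set_def T_def indicator_def\<close>)
      also have "\<dots> = ennreal (\<rho> \<alpha>) * (ennreal (profile_lik n f \<alpha>) * mass \<alpha> T)" by (rule M_pos[OF \<alpha> T])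
      also have "\<dots> \<le> ennreal (\<rho> \<alpha>) * (ennreal (profile_lik n f \<alpha>) * (ennreal \<eta> * mass \<alpha> UNIV))"
        using ratio[OF True] unfolding mass_def T_def by (intro mult_left_mono) auto
      also have "\<dots> = ennreal \<eta> * M \<alpha> UNIV" by (simp add: M_pos[OF \<alpha>] mult_ac)
      finally show ?thesis by (simp add: add_increasing2)
    next
      case False
      have m1: "mass \<alpha> UNIV \<le> 1"
        unfolding mass_def
      proof (rule likelihood_mass_le)
        show "0 < theta_hat n f \<alpha>"
          using quad[OF \<alpha>] \<alpha> n step_corr_bounds(3)[OF n \<alpha>] by (simp add: theta_hat_def)
      qed (use reg \<pi>0 \<alpha> in \<open>auto simp: cond_prior_regular_def\<close>)
      have "M \<alpha> {\<theta>. (\<theta>, \<alpha>) \<in> B} \<le> M \<alpha> UNIV"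
        unfolding M_def by (intro nn_integral_mono mult_left_mono) (auto simp: indicator_def)
      also have "\<dots> = ennreal (\<rho> \<alpha>) * (ennreal (profile_lik n f \<alpha>) * mass \<alpha> UNIV)" by (simp add: M_pos[OF \<alpha>])
      also have "\<dots> \<le> ennreal (\<rho> \<alpha>) * (ennreal C * 1)"
        using C[OF \<alpha>] m1 by (intro mult_left_mono mult_mono ennreal_leI) auto
      also have "\<dots> = ennreal C * out \<alpha>" using False \<alpha> by (auto simp: out_def mult.commute)
      finally show ?thesis by (simp add: add_increasing)
    qed
  qed (simp add: M_neg)
  have "emeasure N B \<le> (\<integral>\<^sup>+\<alpha>. ennreal \<eta> * M \<alpha> UNIV + ennreal C * out \<alpha> \<partial>lborel)"
    unfolding emeas[OF B_sets] by (intro nn_integral_mono slice)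
  also have "\<dots> = ennreal \<eta> * (\<integral>\<^sup>+\<alpha>. M \<alpha> UNIV \<partial>lborel) + ennreal C * (\<integral>\<^sup>+\<alpha>. out \<alpha> \<partial>lborel)"
    using M_meas out_meas by (simp add: nn_integral_add nn_integral_cmult)
  also have "(\<integral>\<^sup>+\<alpha>. M \<alpha> UNIV \<partial>lborel) = emeasure N UNIV" by (rule N_UNIV[symmetric])
  also have "ennreal C * (\<integral>\<^sup>+\<alpha>. out \<alpha> \<partial>lborel) \<le> ennreal C * ennreal \<epsilon>"
    by (intro mult_left_mono out_int) simp
  also have "\<dots> \<le> ennreal \<eta>' * ennreal (L / 2)"
    using C0 \<epsilon> \<eta> L0 CL by (simp add: ennreal_mult'[symmetric] ennreal_leI)
  also have "ennreal (L / 2) \<le> emeasure N UNIV"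
  proof -
    define R where "R \<alpha> = ennreal (\<rho>' \<alpha>) * indicator {a..b} \<alpha>" for \<alpha>
    have Rm: "R \<in> borel_measurable lborel" unfolding R_def[abs_def] by simp
    have "1 = (\<integral>\<^sup>+\<alpha>\<in>{0<..}. ennreal (\<rho> \<alpha>) \<partial>lborel)" using rng by (simp add: range_prior_cond_def)
    also have "\<dots> = (\<integral>\<^sup>+\<alpha>. out \<alpha> + R \<alpha> \<partial>lborel)"
      by (rule nn_integral_cong) (use a in \<open>auto simp: out_def R_def \<rho>'_def indicator_def\<close>)
    also have "\<dots> = (\<integral>\<^sup>+\<alpha>. out \<alpha> \<partial>lborel) + (\<integral>\<^sup>+\<alpha>. R \<alpha> \<partial>lborel)" by (rule nn_integral_add[OF out_meas Rm])
    also have "(\<integral>\<^sup>+\<alpha>. out \<alpha> \<partial>lborel) \<le> ennreal (1 / 2)" using out_int \<epsilon> by (meson ennreal_leI order_trans)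
    finally have "1 \<le> ennreal (1 / 2) + (\<integral>\<^sup>+\<alpha>. R \<alpha> \<partial>lborel)" by (simp add: add_right_mono)
    \<comment> \<open>Cancelling 1/2 is legitimate in the extended reals because it is
      finite.\<close>
    hence half: "ennreal (1 / 2) \<le> (\<integral>\<^sup>+\<alpha>. R \<alpha> \<partial>lborel)"
    proof -
      assume A: "1 \<le> ennreal (1 / 2) + (\<integral>\<^sup>+\<alpha>. R \<alpha> \<partial>lborel)"
      have "1 = ennreal (1 / 2 + 1 / 2)" by simp
      also have "\<dots> = ennreal (1 / 2) + ennreal (1 / 2)" by (rule ennreal_plus) auto
      finally have "ennreal (1 / 2) + ennreal (1 / 2) \<le> ennreal (1 / 2) + (\<integral>\<^sup>+\<alpha>. R \<alpha> \<partial>lborel)"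
        using A by (simp only:)
      thus ?thesis unfolding ennreal_add_left_cancel_le
        by (simp only: infinity_ennreal_def ennreal_neq_top simp_thms)
    qed
    have "ennreal (L / 2) = ennreal L * ennreal (1 / 2)"
      using ennreal_mult'[OF L0, of "1 / 2"] by simp
    also have "\<dots> \<le> ennreal L * (\<integral>\<^sup>+\<alpha>. R \<alpha> \<partial>lborel)" by (intro mult_left_mono half) simp
    also have "\<dots> = (\<integral>\<^sup>+\<alpha>. ennreal L * R \<alpha> \<partial>lborel)" using Rm by (simp add: nn_integral_cmult)
    also have "\<dots> \<le> (\<integral>\<^sup>+\<alpha>. M \<alpha> UNIV \<partial>lborel)"
    proof (rule nn_integral_mono)
      fix \<alpha>
      show "ennreal L * R \<alpha> \<le> M \<alpha> UNIV"
      proof (cases "\<alpha> \<in> {a..b}")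
        case True
        hence \<alpha>: "0 < \<alpha>" using a by simp
        have "ennreal L * R \<alpha> = ennreal (\<rho> \<alpha>) * ennreal L" using True \<alpha> by (simp add: R_def \<rho>'_def mult.commute)
        also have "\<dots> \<le> ennreal (\<rho> \<alpha>) * (ennreal (profile_lik n f \<alpha>) * mass \<alpha> UNIV)"
          using L[OF True] unfolding mass_def by (intro mult_left_mono) auto
        finally show ?thesis by (simp add: M_pos[OF \<alpha>])
      qed (simp add: R_def)
    qed
    also have "\<dots> = emeasure N UNIV" by (rule N_UNIV[symmetric])
    finally show ?thesis .
  qed
  finally have "emeasure N B \<le> ennreal \<eta> * emeasure N UNIV + ennreal \<eta>' * emeasure N UNIV"
    by (simp add: add_left_mono mult_left_mono)
  also have "\<dots> = ennreal (\<eta> + \<eta>') * emeasure N UNIV"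
    using \<eta> by (simp add: distrib_right)
  finally show ?thesis unfolding N_def B_def .
qed

text \<open>If \<open>A\<close> is not measurable, its mass is 0 by convention; otherwise
  monotonicity applies.\<close>

lemma measure_posterior_le:
  assumes B: "B \<in> sets borel" "A \<subseteq> B" and \<eta>: "0 \<le> \<eta>"
    and le: "emeasure (unnormalized_posterior \<pi> \<rho> n y) B
      \<le> ennreal \<eta> * emeasure (unnormalized_posterior \<pi> \<rho> n y) UNIV"
  shows "measure (posterior \<pi> \<rho> n y) A \<le> \<eta>"
proof -
  define N where "N = unnormalized_posterior \<pi> \<rho> n y"
  have sets_N: "sets N = sets borel" by (simp add: N_def unnormalized_posterior_def)
  have "emeasure (posterior \<pi> \<rho> n y) A \<le> ennreal \<eta>"
  proof (cases "A \<in> sets (posterior \<pi> \<rho> n y)")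
    case True
    have "emeasure (posterior \<pi> \<rho> n y) A = 1 / emeasure N UNIV * emeasure N A"
      by (simp add: posterior_def N_def[symmetric])
    also have "\<dots> \<le> 1 / emeasure N UNIV * (ennreal \<eta> * emeasure N UNIV)"
      using le emeasure_mono[of A B N] B by (intro mult_left_mono) (auto simp: N_def[symmetric] sets_N)
    also have "\<dots> \<le> ennreal \<eta>"
    \<comment> \<open>Degenerate evidence is harmless: for value 0 the right factor is 0, for value
      infinity the scaling factor is 0.\<close>
    proof (cases "emeasure N UNIV = 0 \<or> emeasure N UNIV = \<infinity>")
      case False
      then obtain u where u: "emeasure N UNIV = ennreal u" "0 < u"
        by (cases "emeasure N UNIV") (auto simp: less_le)
      have "1 / ennreal u = ennreal (1 / u)" using u by (simp add: divide_ennreal[symmetric])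
      thus ?thesis using u \<eta> by (simp add: ennreal_mult'[symmetric])
    qed auto
    finally show ?thesis .
  qed (simp add: emeasure_notin_sets)
  thus ?thesis using \<eta> by (simp add: measure_def enn2real_leI)
qed

section \<open>Prior mass outside the range of interest\<close>

lemma prior_mass_weighted:
  fixes \<rho> u :: "real \<Rightarrow> real"
  assumes rho: "continuous_on {0<..} \<rho>" "\<And>\<alpha>. 0 < \<alpha> \<Longrightarrow> 0 \<le> \<rho> \<alpha>" and S: "S \<in> sets borel" "S \<subseteq> {0<..}"
    and u: "u \<in> borel_measurable borel" "\<And>\<alpha>. \<alpha> \<in> S \<Longrightarrow> 1 \<le> k * u \<alpha>" and k: "0 \<le> k"
    and E: "(\<integral>\<^sup>+\<alpha>\<in>S. ennreal (u \<alpha> * \<rho> \<alpha>) \<partial>lborel) \<le> ennreal E"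
  shows "(\<integral>\<^sup>+\<alpha>\<in>S. ennreal (\<rho> \<alpha>) \<partial>lborel) \<le> ennreal (k * E)"
proof -
  define \<rho>' where "\<rho>' \<alpha> = indicator {0<..} \<alpha> *\<^sub>R \<rho> \<alpha>" for \<alpha>
  have [measurable]: "\<rho>' \<in> borel_measurable borel"
    unfolding \<rho>'_def[abs_def] by (rule borel_measurable_continuous_on_indicator[OF _ rho(1)]) simp
  have "(\<lambda>\<alpha>. ennreal (u \<alpha> * \<rho>' \<alpha>) * indicator S \<alpha>) \<in> borel_measurable borel"
    using u(1) S(1) by measurable
  also have "(\<lambda>\<alpha>. ennreal (u \<alpha> * \<rho>' \<alpha>) * indicator S \<alpha>) = (\<lambda>\<alpha>. ennreal (u \<alpha> * \<rho> \<alpha>) * indicator S \<alpha>)"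
    using S(2) by (auto simp: fun_eq_iff \<rho>'_def indicator_def)
  finally have m: "(\<lambda>\<alpha>. ennreal (u \<alpha> * \<rho> \<alpha>) * indicator S \<alpha>) \<in> borel_measurable lborel" by simp
  have "(\<integral>\<^sup>+\<alpha>\<in>S. ennreal (\<rho> \<alpha>) \<partial>lborel) \<le> (\<integral>\<^sup>+\<alpha>. ennreal k * (ennreal (u \<alpha> * \<rho> \<alpha>) * indicator S \<alpha>) \<partial>lborel)"
  proof (rule nn_integral_mono)
    fix \<alpha>
    show "ennreal (\<rho> \<alpha>) * indicator S \<alpha> \<le> ennreal k * (ennreal (u \<alpha> * \<rho> \<alpha>) * indicator S \<alpha>)"
    proof (cases "\<alpha> \<in> S")
      case True
      have "1 * \<rho> \<alpha> \<le> k * u \<alpha> * \<rho> \<alpha>"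
        using u(2)[OF True] rho(2)[of \<alpha>] True S(2) by (intro mult_right_mono) auto
      hence "ennreal (\<rho> \<alpha>) \<le> ennreal (k * (u \<alpha> * \<rho> \<alpha>))" by (intro ennreal_leI) (simp add: mult.assoc)
      thus ?thesis using True k by (simp add: ennreal_mult')
    qed simp
  qed
  also have "\<dots> = ennreal k * (\<integral>\<^sup>+\<alpha>\<in>S. ennreal (u \<alpha> * \<rho> \<alpha>) \<partial>lborel)" by (rule nn_integral_cmult[OF m])
  also have "\<dots> \<le> ennreal k * ennreal E" by (intro mult_left_mono E) simp
  finally show ?thesis using k by (simp add: ennreal_mult')
qed

text \<open>Markov's inequality with the weight of the tail condition: on the lower tail \<alpha>
  powr (-n) exceeds exp(kappa n ln n), and on the upper tail \<alpha> powr n does, with the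
  respective kappa. The strict gap between the constants and the kappas leaves a positive
  rate.\<close>

lemma prior_mass_outside:
  assumes rng: "range_prior_cond \<theta>\<^sub>0 \<alpha>\<^sub>0 \<pi> \<rho>"
  obtains c where "0 < c" "\<forall>\<^sub>F n in sequentially.
    (\<integral>\<^sup>+\<alpha>\<in>{0<..<alpha_lower n}. ennreal (\<rho> \<alpha>) \<partial>lborel) + (\<integral>\<^sup>+\<alpha>\<in>{alpha_upper n<..}. ennreal (\<rho> \<alpha>) \<partial>lborel)
      \<le> ennreal (2 * exp (- (c * real n * ln (real n))))"
proof -
  from rng obtain cl cu where c: "cl < \<kappa>\<^sub>l" "cu < \<kappa>\<^sub>u"
    and ev: "\<forall>\<^sub>F n in sequentially.
          max (\<integral>\<^sup>+\<alpha>\<in>{0<..<alpha_lower n}. ennreal (\<alpha> powr (- real n) * \<rho> \<alpha>) \<partial>lborel)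
              (\<integral>\<^sup>+\<alpha>\<in>{0<..<alpha_lower n}. ennreal (\<alpha> powr (- real n) * \<pi> \<theta>\<^sub>0 \<alpha> * \<rho> \<alpha>) \<partial>lborel)
            \<le> ennreal (exp (cl * real n * ln (real n))) \<and>
          max (\<integral>\<^sup>+\<alpha>\<in>{alpha_upper n<..}. ennreal (\<alpha> powr real n * \<rho> \<alpha>) \<partial>lborel)
              (\<integral>\<^sup>+\<alpha>\<in>{alpha_upper n<..}. ennreal (\<alpha> powr real n * \<pi> \<theta>\<^sub>0 \<alpha> * \<rho> \<alpha>) \<partial>lborel)
            \<le> ennreal (exp (cu * real n * ln (real n)))"
    unfolding range_prior_cond_def by blast
  have rho: "continuous_on {0<..} \<rho>" "\<And>\<alpha>. 0 < \<alpha> \<Longrightarrow> 0 \<le> \<rho> \<alpha>"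
    using rng by (auto simp: range_prior_cond_def)
  define d where "d = min (\<kappa>\<^sub>l - cl) (\<kappa>\<^sub>u - cu)"
  have d: "0 < d" "d \<le> \<kappa>\<^sub>l - cl" "d \<le> \<kappa>\<^sub>u - cu" using c by (auto simp: d_def)
  have "\<forall>\<^sub>F n::nat in sequentially. 0 < n" by real_asymp
  with ev have "\<forall>\<^sub>F n in sequentially.
    (\<integral>\<^sup>+\<alpha>\<in>{0<..<alpha_lower n}. ennreal (\<rho> \<alpha>) \<partial>lborel) + (\<integral>\<^sup>+\<alpha>\<in>{alpha_upper n<..}. ennreal (\<rho> \<alpha>) \<partial>lborel)
      \<le> ennreal (2 * exp (- (d * real n * ln (real n))))"
  proof eventually_elim
    case (elim n)
    have n: "0 < n" by (rule elim)
    have pos: "0 < alpha_lower n" "0 < alpha_upper n" using n by (simp_all add: alpha_lower_def alpha_upper_def)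
    have nl: "0 \<le> real n * ln (real n)" using n by simp
    have rate: "exp (- k * real n * ln (real n)) * exp (c' * real n * ln (real n)) \<le> exp (- (d * real n * ln (real n)))"
      if "d \<le> k - c'" for k c'
    proof -
      have "d * (real n * ln (real n)) \<le> (k - c') * (real n * ln (real n))" using that nl by (rule mult_right_mono)
      thus ?thesis by (simp add: exp_add[symmetric] algebra_simps)
    qed
    have "(\<integral>\<^sup>+\<alpha>\<in>{0<..<alpha_lower n}. ennreal (\<rho> \<alpha>) \<partial>lborel)
        \<le> ennreal (alpha_lower n powr real n * exp (cl * real n * ln (real n)))"
    proof (rule prior_mass_weighted[OF rho, where u = "\<lambda>\<alpha>. \<alpha> powr (- real n)"])
      fix \<alpha> assume "\<alpha> \<in> {0<..<alpha_lower n}"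
      hence "\<alpha> powr real n \<le> alpha_lower n powr real n" "0 < \<alpha> powr real n" by (auto intro: powr_mono2)
      thus "1 \<le> alpha_lower n powr real n * \<alpha> powr (- real n)"
        by (simp add: powr_minus_divide pos_le_divide_eq)
    qed (use elim in auto)
    also have "\<dots> \<le> ennreal (exp (- (d * real n * ln (real n))))"
      using rate[OF d(2)] n by (intro ennreal_leI) (simp add: alpha_lower_def powr_powr powr_def mult_ac)
    finally have 1: "(\<integral>\<^sup>+\<alpha>\<in>{0<..<alpha_lower n}. ennreal (\<rho> \<alpha>) \<partial>lborel) \<le> ennreal (exp (- (d * real n * ln (real n))))" .
    have "(\<integral>\<^sup>+\<alpha>\<in>{alpha_upper n<..}. ennreal (\<rho> \<alpha>) \<partial>lborel)
        \<le> ennreal (alpha_upper n powr (- real n) * exp (cu * real n * ln (real n)))"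
    proof (rule prior_mass_weighted[OF rho, where u = "\<lambda>\<alpha>. \<alpha> powr real n"])
      fix \<alpha> assume "\<alpha> \<in> {alpha_upper n<..}"
      hence "alpha_upper n powr real n \<le> \<alpha> powr real n" "0 < alpha_upper n powr real n"
        using pos by (auto intro: powr_mono2)
      thus "1 \<le> alpha_upper n powr (- real n) * \<alpha> powr real n"
        by (simp add: powr_minus_divide pos_le_divide_eq)
    qed (use elim pos in auto)
    also have "\<dots> \<le> ennreal (exp (- (d * real n * ln (real n))))"
      using rate[OF d(3)] n by (intro ennreal_leI) (simp add: alpha_upper_def powr_powr powr_def mult_ac)
    finally have 2: "(\<integral>\<^sup>+\<alpha>\<in>{alpha_upper n<..}. ennreal (\<rho> \<alpha>) \<partial>lborel) \<le> ennreal (exp (- (d * real n * ln (real n))))" .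
    from add_mono[OF 1 2] show ?case by (simp add: ennreal_plus[symmetric] del: ennreal_plus)
  qed
  thus ?thesis using that d(1) by blast
qed

section \<open>Vanishing of the two error ratios\<close>

lemma tail_ratio_nonneg:
  assumes "0 < \<theta>\<^sub>0" "0 \<le> G"
  shows "0 \<le> tail_ratio \<theta>\<^sub>0 n G c"
  unfolding tail_ratio_def
  by (intro divide_nonneg_nonneg mult_nonneg_nonneg add_nonneg_nonneg) (use assms in auto)

lemma tail_ratio_tendsto_0:
  assumes "0 < \<theta>\<^sub>0" "C2 < 1 / 2" "C3 < 1"
  shows "(\<lambda>n. tail_ratio \<theta>\<^sub>0 n (real n powr C2) (real n powr C3)) \<longlonglongrightarrow> 0"
proof -
  \<comment> \<open>The unspecified powers n^C2 and n^C3 are traded for n and n / 80, so that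
    \<open>real_asymp\<close> faces explicit functions; n / 80 still loses against n / 40. In the
    first term n^(3/200) competes with n^(1/100).\<close>
  define b where "b n = (exp (- (real n * (real n powr (- 197 / 400))\<^sup>2 / 24)) * real n * (3 / 2 * \<theta>\<^sub>0) + exp (- (real n / 40)) * exp (real n / 80))
    / (exp (- (16 * real n * (real n powr (- 99 / 200))\<^sup>2)) * exp (- \<theta>\<^sub>0) * (2 * \<theta>\<^sub>0 * real n powr (- 1 / 2)))" for n
  have lim: "b \<longlonglongrightarrow> 0" unfolding b_def using assms(1) by real_asymp
  have "C3 - 1 < 0" using assms by simp
  hence "(\<lambda>n. real n powr (C3 - 1)) \<longlonglongrightarrow> 0" by real_asymp
  hence "\<forall>\<^sub>F n in sequentially. real n powr (C3 - 1) < 1 / 80" by (rule order_tendstoD) simp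
  moreover have "\<forall>\<^sub>F n::nat in sequentially. 1 \<le> n" by real_asymp
  ultimately have "\<forall>\<^sub>F n in sequentially. tail_ratio \<theta>\<^sub>0 n (real n powr C2) (real n powr C3) \<le> b n"
  proof eventually_elim
    case (elim n)
    have "real n powr (C3 - 1) * real n \<le> 1 / 80 * real n" using elim by (intro mult_right_mono) auto
    hence "real n powr C3 \<le> real n / 80" using elim by (simp add: powr_diff)
    moreover have "real n powr C2 \<le> real n" using elim assms powr_mono[of C2 1 "real n"] by simp
    ultimately show ?case
      unfolding tail_ratio_def b_def using assms elim
      by (intro divide_right_mono add_mono mult_mono) auto
  qed
  moreover have "0 \<le> tail_ratio \<theta>\<^sub>0 n (real n powr C2) (real n powr C3)" for n
    by (rule tail_ratio_nonneg) (use assms in auto)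
  ultimately show ?thesis
    by (intro tendsto_sandwich[OF _ _ tendsto_const lim]) auto
qed

text \<open>Twice the profile bound times the bound on the outer prior mass, over the lower bound
  \<open>L\<close>: the value of \<eta>' that makes \<open>CL\<close> in
  \<open>posterior_mass_bound\<close> an equality.\<close>

definition outside_ratio :: "real \<Rightarrow> real \<Rightarrow> real \<Rightarrow> nat \<Rightarrow> real" where
  "outside_ratio \<theta>\<^sub>0 C3 c n = exp (real n / 2 * (ln (real n) - ln (\<theta>\<^sub>0 / 16) - 1)) * (2 * exp (- (c * real n * ln (real n)))) * 2
    / (exp (real n / 2 * (ln (real n) - ln (3 * \<theta>\<^sub>0) - 1) - ln (real n)) * (exp (- (real n powr C3))
      * (exp (- (16 * real n * (real n powr (- 99 / 200))\<^sup>2)) * exp (- \<theta>\<^sub>0) * (2 * \<theta>\<^sub>0 * real n powr (- 1 / 2)))))"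

lemma outside_ratio_nonneg:
  assumes "0 < \<theta>\<^sub>0"
  shows "0 \<le> outside_ratio \<theta>\<^sub>0 C3 c n"
  unfolding outside_ratio_def by (intro divide_nonneg_nonneg mult_nonneg_nonneg) (use assms in auto)

lemma outside_ratio_tendsto_0:
  assumes \<theta>: "0 < \<theta>\<^sub>0" and "C3 < 1" "0 < c"
  shows "outside_ratio \<theta>\<^sub>0 C3 c \<longlonglongrightarrow> 0"
proof -
  define b where "b n = 4 * exp (24 * real n + ln (real n) + real n + 16 * real n * (real n powr (- 99 / 200))\<^sup>2
      + \<theta>\<^sub>0 - c * real n * ln (real n)) / (2 * \<theta>\<^sub>0 * real n powr (- 1 / 2))" for n
  have lim: "b \<longlonglongrightarrow> 0" unfolding b_def using assms by real_asymp
  \<comment> \<open>The quadratic form lies between \<open>\<theta>\<^sub>0\<close> / 16 and 3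
    \<open>\<theta>\<^sub>0\<close>; the crude ln 48 \<le> 47 suffices because the exponent also
    contains -c n ln n.\<close>
  have l48: "ln (3 * \<theta>\<^sub>0) - ln (\<theta>\<^sub>0 / 16) \<le> 47"
  proof -
    have "ln (3 * \<theta>\<^sub>0) - ln (\<theta>\<^sub>0 / 16) = ln (3 * \<theta>\<^sub>0 / (\<theta>\<^sub>0 / 16))" using \<theta> by (subst ln_div) auto
    also have "\<dots> \<le> 3 * \<theta>\<^sub>0 / (\<theta>\<^sub>0 / 16) - 1" using \<theta> by (intro ln_le_minus_one) auto
    also have "\<dots> = 47" using \<theta> by simp
    finally show ?thesis .
  qed
  have "\<forall>\<^sub>F n::nat in sequentially. 1 \<le> n" by real_asymp
  hence "\<forall>\<^sub>F n in sequentially. outside_ratio \<theta>\<^sub>0 C3 c n \<le> b n"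
  proof eventually_elim
    case (elim n)
    define p where "p = 16 * real n * (real n powr (- 99 / 200))\<^sup>2"
    define D where "D = 2 * \<theta>\<^sub>0 * real n powr (- 1 / 2)"
    define e1 where "e1 = real n / 2 * (ln (real n) - ln (\<theta>\<^sub>0 / 16) - 1)"
    define e2 where "e2 = real n / 2 * (ln (real n) - ln (3 * \<theta>\<^sub>0) - 1) - ln (real n)"
    define e3 where "e3 = c * real n * ln (real n)"
    have D: "0 < D" using \<theta> elim by (simp add: D_def)
    have "outside_ratio \<theta>\<^sub>0 C3 c n = exp e1 * (2 * exp (- e3)) * 2 / (exp e2 * (exp (- (real n powr C3)) * (exp (- p) * exp (- \<theta>\<^sub>0) * D)))"
      unfolding outside_ratio_def p_def D_def e1_def e2_def e3_def ..
    also have "\<dots> = 4 * exp (e1 - e3 - e2 + real n powr C3 + p + \<theta>\<^sub>0) / D"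
    proof -
      have d: "exp e2 * (exp (- (real n powr C3)) * (exp (- p) * exp (- \<theta>\<^sub>0) * D))
          = exp (e2 - real n powr C3 - p - \<theta>\<^sub>0) * D"
        by (simp add: mult_exp_exp)
      have "exp e1 * (2 * exp (- e3)) * 2 = 4 * exp (e1 - e3)" by (simp add: mult_exp_exp)
      moreover have "exp (e1 - e3) = exp (e1 - e3 - e2 + real n powr C3 + p + \<theta>\<^sub>0) * exp (e2 - real n powr C3 - p - \<theta>\<^sub>0)"
        by (simp add: mult_exp_exp)
      ultimately show ?thesis unfolding d by simp
    qed
    also have "\<dots> \<le> 4 * exp (24 * real n + ln (real n) + real n + p + \<theta>\<^sub>0 - e3) / D"
    proof -
      have "e1 - e2 = real n / 2 * (ln (3 * \<theta>\<^sub>0) - ln (\<theta>\<^sub>0 / 16)) + ln (real n)"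
        by (simp add: e1_def e2_def algebra_simps)
      also have "\<dots> \<le> real n / 2 * 47 + ln (real n)" using l48 by (intro add_right_mono mult_left_mono) auto
      finally have "e1 - e2 \<le> 24 * real n + ln (real n)" by simp
      moreover have "real n powr C3 \<le> real n" using elim assms powr_mono[of C3 1 "real n"] by simp
      ultimately show ?thesis using D by (intro divide_right_mono) auto
    qed
    also have "\<dots> = b n" by (simp add: b_def p_def D_def e3_def)
    finally show ?case .
  qed
  moreover have "0 \<le> outside_ratio \<theta>\<^sub>0 C3 c n" for n by (rule outside_ratio_nonneg[OF \<theta>])
  ultimately show ?thesis
    by (intro tendsto_sandwich[OF _ _ tendsto_const lim]) auto
qed

text \<open>The rate \<eta> is deterministic and the same for all data vectors: randomness is
  confined to \<open>typical_path\<close>, so almost sure convergence follows path by path.\<close>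

lemma posterior_concentration:
  fixes \<sigma>2 \<alpha>\<^sub>0 :: real
  defines "\<theta>\<^sub>0 \<equiv> \<sigma>2 * \<alpha>\<^sub>0"
  assumes pos: "0 < \<sigma>2" "0 < \<alpha>\<^sub>0" and reg: "cond_prior_regular \<theta>\<^sub>0 \<pi>"
    and growth: "cond_prior_growth \<theta>\<^sub>0 \<pi>" and rng: "range_prior_cond \<theta>\<^sub>0 \<alpha>\<^sub>0 \<pi> \<rho>"
  obtains \<eta> :: "nat \<Rightarrow> real" where "\<eta> \<longlonglongrightarrow> 0" "\<And>n. 0 \<le> \<eta> n"
    "\<forall>\<^sub>F n in sequentially. \<forall>y\<in>carrier_vec n. typical_path \<sigma>2 \<alpha>\<^sub>0 n (vec_index y) \<longrightarrow>
      emeasure (unnormalized_posterior \<pi> \<rho> n y)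
        (far_set \<theta>\<^sub>0 (alpha_lower n) (alpha_upper n) (2 * real n powr (- 197 / 400)))
      \<le> ennreal (\<eta> n) * emeasure (unnormalized_posterior \<pi> \<rho> n y) UNIV"
proof -
  have \<theta>: "0 < \<theta>\<^sub>0" using pos by (simp add: \<theta>\<^sub>0_def)
  obtain C1 C2 C3 where CC: "0 < C1" "0 < C2" "0 < C3" "C1 + C2 < 1 / 2" "C3 < 1"
    and ev: "\<forall>\<^sub>F n in sequentially.
          (SUP \<alpha>\<in>{alpha_lower n..alpha_upper n}. SUP \<theta>\<in>{\<theta>\<^sub>0 / 2<..<2 * \<theta>\<^sub>0}.
             ereal \<bar>deriv (\<lambda>t. ln (\<pi> t \<alpha>)) \<theta>\<bar>) \<le> ereal (real n powr C1) \<and>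
          (SUP \<alpha>\<in>{alpha_lower n..alpha_upper n}. SUP \<theta>\<in>{\<theta>\<^sub>0 / 2<..<2 * \<theta>\<^sub>0}.
             ereal (\<pi> \<theta> \<alpha> / \<pi> \<theta>\<^sub>0 \<alpha>)) \<le> ereal (real n powr C2) \<and>
          (INF \<alpha>\<in>{alpha_lower n..alpha_upper n}. ereal (ln (\<pi> \<theta>\<^sub>0 \<alpha>)))
             \<ge> ereal (- (real n powr C3))"
    using growth unfolding cond_prior_growth_def by blast
  obtain c where c: "0 < c" and out: "\<forall>\<^sub>F n in sequentially.
    (\<integral>\<^sup>+\<alpha>\<in>{0<..<alpha_lower n}. ennreal (\<rho> \<alpha>) \<partial>lborel) + (\<integral>\<^sup>+\<alpha>\<in>{alpha_upper n<..}. ennreal (\<rho> \<alpha>) \<partial>lborel)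
      \<le> ennreal (2 * exp (- (c * real n * ln (real n))))"
    by (rule prior_mass_outside[OF rng])
  define \<eta>1 where "\<eta>1 n = tail_ratio \<theta>\<^sub>0 n (real n powr C2) (real n powr C3)" for n
  define \<eta>2 where "\<eta>2 n = outside_ratio \<theta>\<^sub>0 C3 c n" for n
  have lim: "(\<lambda>n. \<eta>1 n + \<eta>2 n) \<longlonglongrightarrow> 0 + 0"
    unfolding \<eta>1_def \<eta>2_def
    by (intro tendsto_add tail_ratio_tendsto_0 outside_ratio_tendsto_0) (use \<theta> CC c in auto)
  have \<eta>1_nn: "0 \<le> \<eta>1 n" and \<eta>2_nn: "0 \<le> \<eta>2 n" for n
    unfolding \<eta>1_def \<eta>2_def by (intro tail_ratio_nonneg outside_ratio_nonneg \<theta>; simp)+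
  have "\<forall>\<^sub>F n in sequentially. 2 * exp (- (c * real n * ln (real n))) \<le> 1 / 2" using c by real_asymp
  moreover have "\<forall>\<^sub>F n::nat in sequentially. 2 \<le> n"
    "\<forall>\<^sub>F n in sequentially. real n powr (- 99 / 200) \<le> 1 / 100"
    "\<forall>\<^sub>F n in sequentially. real n powr (- 99 / 200) \<le> real n powr (- 197 / 400) / 2"
    "\<forall>\<^sub>F n in sequentially. real n powr (- 197 / 400) \<le> 1 / 4"
    "\<forall>\<^sub>F n in sequentially. real n powr (1 / 200) / real n \<le> 1 / 2"
    by real_asymp+
  ultimately have "\<forall>\<^sub>F n in sequentially. \<forall>y\<in>carrier_vec n. typical_path \<sigma>2 \<alpha>\<^sub>0 n (vec_index y) \<longrightarrow>
      emeasure (unnormalized_posterior \<pi> \<rho> n y)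
        (far_set \<theta>\<^sub>0 (alpha_lower n) (alpha_upper n) (2 * real n powr (- 197 / 400)))
      \<le> ennreal (\<eta>1 n + \<eta>2 n) * emeasure (unnormalized_posterior \<pi> \<rho> n y) UNIV"
    using ev out typical_path_bounds[OF pos]
  proof eventually_elim
    case (elim n)
    define p where "p = real n powr (- 99 / 200)"
    define \<delta> where "\<delta> = real n powr (- 1 / 2)"
    define K where "K = real n powr C1"
    define G where "G = real n powr C2"
    define C where "C = exp (real n / 2 * (ln (real n) - ln (\<theta>\<^sub>0 / 16) - 1))"
    define \<epsilon> where "\<epsilon> = 2 * exp (- (c * real n * ln (real n)))"
    define l where "l = exp (- (real n powr C3)) * (exp (- (16 * real n * p\<^sup>2)) * exp (- \<theta>\<^sub>0) * (2 * \<theta>\<^sub>0 * \<delta>))"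
    \<comment> \<open>Lower bound for the profile likelihood on the range: the form is at most 3
      \<open>\<theta>\<^sub>0\<close>, and 1 - r^2 \<ge> n^(-2) is the source of -ln n.\<close>
    define P where "P = exp (real n / 2 * (ln (real n) - ln (3 * \<theta>\<^sub>0) - 1) - ln (real n))"
    have n: "0 < n" "1 < real n" using elim(2) by auto
    have \<delta>: "0 < \<delta>" "\<delta> \<le> p" "K * \<delta> \<le> 1"
    proof -
      show "0 < \<delta>" using n by (simp add: \<delta>_def)
      show "\<delta> \<le> p" using n by (simp add: \<delta>_def p_def)
      have "K * \<delta> = real n powr (C1 + - 1 / 2)" by (simp only: K_def \<delta>_def powr_add)
      also have "\<dots> \<le> real n powr 0" using n CC by (intro powr_mono) auto
      finally show "K * \<delta> \<le> 1" using n by simp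
    qed
    have K: "0 \<le> K" by (simp add: K_def)
    have l0: "0 < l" using \<theta> \<delta> by (simp add: l_def)
    have a0: "0 < alpha_lower n" using n by (simp add: alpha_lower_def)
    have \<alpha>_pos: "0 < \<alpha>" if "\<alpha> \<in> {alpha_lower n..alpha_upper n}" for \<alpha> using that a0 by simp
    have g_nn: "0 \<le> \<pi> \<theta> \<alpha>" if "0 < \<theta>" "0 < \<alpha>" for \<theta> \<alpha>
      using reg that by (simp add: cond_prior_regular_def)
    have g0: "0 < \<pi> \<theta>\<^sub>0 \<alpha>" if "0 < \<alpha>" for \<alpha> using reg that by (simp add: cond_prior_regular_def)
    have one: "(\<integral>\<^sup>+\<theta>\<in>{0<..}. ennreal (\<pi> \<theta> \<alpha>) \<partial>lborel) = 1" if "0 < \<alpha>" for \<alpha>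
      using reg that by (simp add: cond_prior_regular_def)
    have g_meas: "(\<lambda>\<theta>. ennreal (\<pi> \<theta> \<alpha>) * indicator {0<..} \<theta>) \<in> borel_measurable borel" if \<alpha>: "0 < \<alpha>" for \<alpha>
    proof -
      have m: "(\<lambda>\<theta>. indicator {0<..} \<theta> *\<^sub>R \<pi> \<theta> \<alpha>) \<in> borel_measurable borel"
        by (rule borel_measurable_continuous_on_indicator[OF _ cond_prior_continuous[OF reg \<alpha>]]) simp
      have "(\<lambda>\<theta>. ennreal (\<pi> \<theta> \<alpha>) * indicator {0<..} \<theta>) = (\<lambda>\<theta>. ennreal (indicator {0<..} \<theta> *\<^sub>R \<pi> \<theta> \<alpha>))"
        by (auto simp: indicator_def fun_eq_iff)
      thus ?thesis using m by simp
    qed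
    have low: "\<pi> \<theta>\<^sub>0 \<alpha> * exp (- K * \<bar>\<theta> - \<theta>\<^sub>0\<bar>) \<le> \<pi> \<theta> \<alpha>"
      if \<alpha>: "\<alpha> \<in> {alpha_lower n..alpha_upper n}" and \<theta>i: "\<theta> \<in> {\<theta>\<^sub>0 / 2<..<2 * \<theta>\<^sub>0}" for \<theta> \<alpha>
    proof -
      obtain D where D: "\<And>\<theta>. 0 < \<theta> \<Longrightarrow> ((\<lambda>t. \<pi> t \<alpha>) has_real_derivative D \<theta>) (at \<theta>)"
        using reg \<alpha>_pos[OF \<alpha>] unfolding cond_prior_regular_def by blast
      show ?thesis
      proof (rule lower_bound_of_log_derivative[where D = D and a = "\<theta>\<^sub>0 / 2" and b = "2 * \<theta>\<^sub>0"])
        fix t assume "t \<in> {\<theta>\<^sub>0 / 2<..<2 * \<theta>\<^sub>0}"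
        thus "\<bar>deriv (\<lambda>t. ln (\<pi> t \<alpha>)) t\<bar> \<le> K"
          using elim(7) \<alpha> by (auto simp: SUP_le_iff K_def)
      qed (use g_nn \<alpha>_pos[OF \<alpha>] D \<theta> \<theta>i in auto)
    qed
    have up: "\<pi> \<theta> \<alpha> \<le> G * \<pi> \<theta>\<^sub>0 \<alpha>"
      if \<alpha>: "\<alpha> \<in> {alpha_lower n..alpha_upper n}" and \<theta>i: "\<theta> \<in> {\<theta>\<^sub>0 / 2<..<2 * \<theta>\<^sub>0}" for \<theta> \<alpha>
    proof -
      have "\<pi> \<theta> \<alpha> / \<pi> \<theta>\<^sub>0 \<alpha> \<le> G" using elim(7) \<alpha> \<theta>i by (auto simp: SUP_le_iff G_def)
      thus ?thesis using g0[OF \<alpha>_pos[OF \<alpha>]] by (simp add: pos_divide_le_eq)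
    qed
    have g0_low: "exp (- (real n powr C3)) \<le> \<pi> \<theta>\<^sub>0 \<alpha>" if \<alpha>: "\<alpha> \<in> {alpha_lower n..alpha_upper n}" for \<alpha>
    proof -
      have "- (real n powr C3) \<le> ln (\<pi> \<theta>\<^sub>0 \<alpha>)" using elim(7) \<alpha> by (auto simp: le_INF_iff)
      thus ?thesis using g0[OF \<alpha>_pos[OF \<alpha>]] by (simp add: ln_ge_iff)
    qed
    have g0_low': "1 \<le> \<pi> \<theta>\<^sub>0 \<alpha> * exp (real n powr C3)" if "\<alpha> \<in> {alpha_lower n..alpha_upper n}" for \<alpha>
      using g0_low[OF that] by (simp add: exp_minus field_simps)
    show ?case
    proof (intro ballI impI)
      fix y :: "real vec" assume y: "y \<in> carrier_vec n" and path: "typical_path \<sigma>2 \<alpha>\<^sub>0 n (vec_index y)"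
      define f where "f = vec_index y"
      have V: "\<theta>\<^sub>0 \<le> quad_var n f"
        and up3: "\<alpha> \<in> {alpha_lower n..alpha_upper n} \<Longrightarrow> quad_form n f (step_corr n \<alpha>) \<le> 3 * \<theta>\<^sub>0"
        and hat: "\<alpha> \<in> {alpha_lower n..alpha_upper n} \<Longrightarrow> \<bar>theta_hat n f \<alpha> / \<theta>\<^sub>0 - 1\<bar> \<le> 2 * p" for \<alpha>
        using elim(9) path unfolding f_def \<theta>\<^sub>0_def p_def by auto
      have quad: "\<theta>\<^sub>0 / 16 \<le> quad_form n f (step_corr n \<alpha>)" if "0 < \<alpha>" for \<alpha>
        using quad_form_lower[OF elim(2), of "step_corr n \<alpha>" f] step_corr_bounds(1,2)[OF n(1) that] V by auto
      have quad0: "0 < quad_form n f (step_corr n \<alpha>)" if "0 < \<alpha>" for \<alpha>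
        using quad[OF that] \<theta> by linarith
      have hat0: "0 < theta_hat n f \<alpha>" if "0 < \<alpha>" for \<alpha>
        using quad0[OF that] that n step_corr_bounds(3)[OF n(1) that] by (simp add: theta_hat_def)
      show "emeasure (unnormalized_posterior \<pi> \<rho> n y)
          (far_set \<theta>\<^sub>0 (alpha_lower n) (alpha_upper n) (2 * real n powr (- 197 / 400)))
        \<le> ennreal (\<eta>1 n + \<eta>2 n) * emeasure (unnormalized_posterior \<pi> \<rho> n y) UNIV"
      proof (rule posterior_mass_bound[OF reg rng n(1) y \<theta> a0, where C = C and L = "P * l" and \<epsilon> = \<epsilon>])
        fix \<alpha> :: real assume \<alpha>: "0 < \<alpha>"
        show "0 < quad_form n (vec_index y) (step_corr n \<alpha>)" using quad0[OF \<alpha>] by (simp add: f_def)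
        have "ln (\<theta>\<^sub>0 / 16) \<le> ln (quad_form n f (step_corr n \<alpha>))" using quad[OF \<alpha>] \<theta> by simp
        hence "real n / 2 * (ln (real n) - ln (quad_form n f (step_corr n \<alpha>)) - 1)
            \<le> real n / 2 * (ln (real n) - ln (\<theta>\<^sub>0 / 16) - 1)"
          by (intro mult_left_mono) auto
        moreover have "ln (1 - (step_corr n \<alpha>)\<^sup>2) \<le> 0"
          using step_corr_bounds(3)[OF n(1) \<alpha>] by simp
        ultimately show "profile_lik n (vec_index y) \<alpha> \<le> C"
          by (simp add: profile_lik_def C_def f_def)
      next
        fix \<alpha> assume \<alpha>: "\<alpha> \<in> {alpha_lower n..alpha_upper n}"
        note \<alpha>0 = \<alpha>_pos[OF \<alpha>]
        show "likelihood_mass n (theta_hat n (vec_index y) \<alpha>) (\<lambda>\<theta>. \<pi> \<theta> \<alpha>) {\<theta>. \<bar>\<theta> / \<theta>\<^sub>0 - 1\<bar> > 2 * real n powr (- 197 / 400)}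
          \<le> ennreal (\<eta>1 n) * likelihood_mass n (theta_hat n (vec_index y) \<alpha>) (\<lambda>\<theta>. \<pi> \<theta> \<alpha>) UNIV"
          unfolding \<eta>1_def f_def[symmetric]
        proof (rule likelihood_mass_tail_ratio[where K = K])
          show "\<bar>theta_hat n f \<alpha> / \<theta>\<^sub>0 - 1\<bar> \<le> 2 * real n powr (- 99 / 200)" using hat[OF \<alpha>] by (simp add: p_def)
          show "real n powr (- 1 / 2) \<le> real n powr (- 99 / 200)" "K * real n powr (- 1 / 2) \<le> 1"
            using \<delta> by (simp_all add: \<delta>_def p_def)
        qed (use n \<theta> hat0[OF \<alpha>0] elim(3,4,5) K g_nn \<alpha>0 g_meas[OF \<alpha>0] one[OF \<alpha>0] up[OF \<alpha>] low[OF \<alpha>] g0_low'[OF \<alpha>]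
            in \<open>simp_all add: G_def\<close>)
        have "P \<le> profile_lik n f \<alpha>"
        proof -
          have "ln (quad_form n f (step_corr n \<alpha>)) \<le> ln (3 * \<theta>\<^sub>0)" using up3[OF \<alpha>] quad0[OF \<alpha>0] by simp
          hence 1: "real n / 2 * (ln (real n) - ln (3 * \<theta>\<^sub>0) - 1)
              \<le> real n / 2 * (ln (real n) - ln (quad_form n f (step_corr n \<alpha>)) - 1)"
            by (intro mult_left_mono) auto
          have "\<alpha> / real n \<le> real n powr (1 / 200) / real n"
            using \<alpha> by (intro divide_right_mono) (auto simp: alpha_upper_def kappa_values)
          hence z: "\<alpha> / real n \<le> 1 / 2" using elim(6) by linarith
          have "real n powr (- 2) \<le> real n powr (- 1 / 200) / real n"
          proof -
            have "real n powr (- 2) \<le> real n powr (- 1 / 200 - 1)" using n by (intro powr_mono) auto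
            also have "\<dots> = real n powr (- 1 / 200) / real n" using n by (simp only: powr_diff) simp
            finally show ?thesis .
          qed
          also have "\<dots> \<le> \<alpha> / real n"
            using \<alpha> by (intro divide_right_mono) (auto simp: alpha_lower_def kappa_values)
          also have "\<dots> = 2 * (\<alpha> / real n) * (1 / 2)" by simp
          also have "\<dots> \<le> 2 * (\<alpha> / real n) * (1 - \<alpha> / real n)" using z \<alpha>0 by (intro mult_left_mono) auto
          also have "\<dots> \<le> 1 - (step_corr n \<alpha>)\<^sup>2" by (rule one_minus_step_corr_square(1)[OF n(1) \<alpha>0])
          finally have "ln (real n powr (- 2)) \<le> ln (1 - (step_corr n \<alpha>)\<^sup>2)"
            using n step_corr_bounds(3)[OF n(1) \<alpha>0] by (subst ln_le_cancel_iff) auto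
          hence "- 2 * ln (real n) \<le> ln (1 - (step_corr n \<alpha>)\<^sup>2)" using n by (simp add: ln_powr)
          thus ?thesis using 1 by (simp add: P_def profile_lik_def)
        qed
        moreover have "ennreal l \<le> likelihood_mass n (theta_hat n f \<alpha>) (\<lambda>\<theta>. \<pi> \<theta> \<alpha>) UNIV"
        proof (rule order_trans[OF ennreal_leI likelihood_mass_lower[OF \<theta> hat[OF \<alpha>] _ \<delta> low[OF \<alpha>] _ K]])
          show "l \<le> \<pi> \<theta>\<^sub>0 \<alpha> * (exp (- (16 * real n * p\<^sup>2)) * exp (- \<theta>\<^sub>0) * (2 * \<theta>\<^sub>0 * \<delta>))"
            unfolding l_def using g0_low[OF \<alpha>] \<theta> \<delta> by (intro mult_right_mono) auto
        qed (use elim(3) g0[OF \<alpha>0] in \<open>simp_all add: p_def less_imp_le\<close>)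
        ultimately have "ennreal P * ennreal l
          \<le> ennreal (profile_lik n f \<alpha>) * likelihood_mass n (theta_hat n f \<alpha>) (\<lambda>\<theta>. \<pi> \<theta> \<alpha>) UNIV"
          by (intro mult_mono ennreal_leI) auto
        thus "ennreal (P * l)
          \<le> ennreal (profile_lik n (vec_index y) \<alpha>) * likelihood_mass n (theta_hat n (vec_index y) \<alpha>) (\<lambda>\<theta>. \<pi> \<theta> \<alpha>) UNIV"
          using l0 by (simp add: ennreal_mult' P_def f_def)
      next
        have Pl: "0 < P * l" using l0 by (simp add: P_def)
        have "\<eta>2 n = C * \<epsilon> * 2 / (P * l)"
          unfolding \<eta>2_def outside_ratio_def C_def \<epsilon>_def P_def l_def p_def \<delta>_def ..
        hence e: "\<eta>2 n * (P * l) = C * \<epsilon> * 2"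
          unfolding nonzero_eq_divide_eq[OF less_imp_neq[OF Pl, symmetric]] .
        have "\<eta>2 n * (P * l / 2) = \<eta>2 n * (P * l) / 2" by simp
        also have "\<dots> = C * \<epsilon>" unfolding e by simp
        finally have "\<eta>2 n * (P * l / 2) = C * \<epsilon>" .
        thus "C * \<epsilon> \<le> \<eta>2 n * (P * l / 2)" by simp
      qed (use elim(1,8) \<eta>1_nn \<eta>2_nn l0 in \<open>auto simp: \<epsilon>_def P_def\<close>)
    qed
  qed
  with that[of "\<lambda>n. \<eta>1 n + \<eta>2 n"] lim \<eta>1_nn \<eta>2_nn show ?thesis by simp
qed

text \<open>The two posterior claims differ only in the parameter of the predictor in the
  denominator: \<open>\<beta>\<close> is the identity or a constant. The threshold is 2
  \<open>varsigma n\<close>, so \<open>ratio_dev_large_imp\<close> places the event inside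
  \<open>far_set\<close> for large n.\<close>

lemma AE_posterior_ratio_dev:
  fixes P :: "real \<Rightarrow> real \<Rightarrow> 'a measure" and X :: "real \<Rightarrow> 'a \<Rightarrow> real" and \<sigma>\<^sub>0 \<alpha>\<^sub>0 \<theta>\<^sub>0 :: real
    and \<beta> :: "real \<Rightarrow> real"
  assumes pos: "0 < \<sigma>\<^sub>0" "0 < \<alpha>\<^sub>0" and \<theta>: "\<theta>\<^sub>0 = \<sigma>\<^sub>0\<^sup>2 * \<alpha>\<^sub>0" and fam: "matern_gp_family P X"
    and reg: "cond_prior_regular \<theta>\<^sub>0 \<pi>" and growth: "cond_prior_growth \<theta>\<^sub>0 \<pi>"
    and rng: "range_prior_cond \<theta>\<^sub>0 \<alpha>\<^sub>0 \<pi> \<rho>"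
    and \<beta>: "\<And>\<alpha>. \<beta> \<alpha> \<in> {\<alpha>, \<alpha>\<^sub>0}"
  shows "AE \<omega> in P (\<sigma>\<^sub>0\<^sup>2) \<alpha>\<^sub>0.
          (\<lambda>n. measure (posterior \<pi> \<rho> n (obs n X \<omega>))
             {(\<theta>, \<alpha>). 0 < \<theta> \<and> 0 < \<alpha> \<and>
                ratio_dev n (\<lambda>s. mspe (P (\<theta> / \<alpha>) \<alpha>) n X s \<alpha>)
                            (\<lambda>s. mspe (P (\<sigma>\<^sub>0\<^sup>2) \<alpha>\<^sub>0) n X s (\<beta> \<alpha>))
                  > ereal (6 * real n powr (- 1 / 2 + (\<kappa>\<^sub>u + \<kappa>\<^sub>l / 2)))}) \<longlonglongrightarrow> 0"
proof -
  have \<sigma>: "0 < \<sigma>\<^sub>0\<^sup>2" using pos by simp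
  obtain \<eta> where \<eta>: "\<eta> \<longlonglongrightarrow> 0" "\<And>n. 0 \<le> \<eta> n" and ev: "\<forall>\<^sub>F n in sequentially.
      \<forall>y\<in>carrier_vec n. typical_path (\<sigma>\<^sub>0\<^sup>2) \<alpha>\<^sub>0 n (vec_index y) \<longrightarrow>
      emeasure (unnormalized_posterior \<pi> \<rho> n y)
        (far_set \<theta>\<^sub>0 (alpha_lower n) (alpha_upper n) (2 * real n powr (- 197 / 400)))
      \<le> ennreal (\<eta> n) * emeasure (unnormalized_posterior \<pi> \<rho> n y) UNIV"
    using posterior_concentration[OF \<sigma> pos(2) reg[unfolded \<theta>] growth[unfolded \<theta>] rng[unfolded \<theta>]]
    unfolding \<theta> by blast
  have "AE \<omega> in P (\<sigma>\<^sub>0\<^sup>2) \<alpha>\<^sub>0. \<forall>\<^sub>F n in sequentially. typical_path (\<sigma>\<^sub>0\<^sup>2) \<alpha>\<^sub>0 n (\<lambda>i. X (site n (Suc i)) \<omega>)"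
    by (rule AE_typical_path[OF gp_of_family[OF fam \<sigma> pos(2)] \<sigma> pos(2)])
  thus ?thesis
  proof eventually_elim
    case (elim \<omega>)
    define A where "A n = {(\<theta>, \<alpha>). 0 < \<theta> \<and> 0 < \<alpha> \<and>
                ratio_dev n (\<lambda>s. mspe (P (\<theta> / \<alpha>) \<alpha>) n X s \<alpha>)
                            (\<lambda>s. mspe (P (\<sigma>\<^sub>0\<^sup>2) \<alpha>\<^sub>0) n X s (\<beta> \<alpha>))
                  > ereal (6 * real n powr (- 1 / 2 + (\<kappa>\<^sub>u + \<kappa>\<^sub>l / 2)))}" for n
    have "\<forall>\<^sub>F n::nat in sequentially. 0 < n" by real_asymp
    with elim ev ratio_dev_large_imp[OF fam pos]
    have "\<forall>\<^sub>F n in sequentially. measure (posterior \<pi> \<rho> n (obs n X \<omega>)) (A n) \<le> \<eta> n"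
    proof eventually_elim
      case (elim n)
      define B where "B = (far_set \<theta>\<^sub>0 (alpha_lower n) (alpha_upper n) (2 * real n powr (- 197 / 400)))"
      have y: "obs n X \<omega> \<in> carrier_vec n" by (simp add: obs_def)
      have "typical_path (\<sigma>\<^sub>0\<^sup>2) \<alpha>\<^sub>0 n (vec_index (obs n X \<omega>))"
        using elim(1) by (simp add: typical_path_def obs_def)
      hence le: "emeasure (unnormalized_posterior \<pi> \<rho> n (obs n X \<omega>)) B
          \<le> ennreal (\<eta> n) * emeasure (unnormalized_posterior \<pi> \<rho> n (obs n X \<omega>)) UNIV"
        using elim(2) y unfolding B_def by blast
      have v: "varsigma n = 3 * real n powr (- 197 / 400)" by (simp add: varsigma_def kappa_values)
      have e: "(- 1 / 2 + (\<kappa>\<^sub>u + \<kappa>\<^sub>l / 2)) = - 197 / 400" by (simp add: kappa_values)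
      have "A n \<subseteq> B"
      proof
        fix z assume z: "z \<in> A n"
        obtain \<theta> \<alpha> where z_eq: "z = (\<theta>, \<alpha>)" by (cases z)
        have za: "0 < \<theta>" "0 < \<alpha>" "ratio_dev n (\<lambda>s. mspe (P (\<theta> / \<alpha>) \<alpha>) n X s \<alpha>)
            (\<lambda>s. mspe (P (\<sigma>\<^sub>0\<^sup>2) \<alpha>\<^sub>0) n X s (\<beta> \<alpha>)) > ereal (2 * varsigma n)"
          using z unfolding A_def z_eq e v by auto
        have "\<bar>\<theta> / \<theta>\<^sub>0 - 1\<bar> > 2 * real n powr (- 197 / 400)" if "\<alpha> \<in> {alpha_lower n..alpha_upper n}"
          using elim(3) that za \<beta>[of \<alpha>] unfolding v \<open>\<theta>\<^sub>0 = \<sigma>\<^sub>0\<^sup>2 * \<alpha>\<^sub>0\<close> by fastforce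
        thus "z \<in> B" using za by (simp add: B_def far_set_def z_eq)
      qed
      moreover have "B \<in> sets borel"
        using far_set_measurable unfolding B_def borel_prod .
      ultimately show ?case by (intro measure_posterior_le[OF _ _ \<eta>(2) le])
    qed
    hence "(\<lambda>n. measure (posterior \<pi> \<rho> n (obs n X \<omega>)) (A n)) \<longlonglongrightarrow> 0"
      by (intro tendsto_sandwich[OF _ _ tendsto_const \<eta>(1)]) auto
    thus ?case by (simp add: A_def)
  qed
qed

theorem theorem6:
  fixes P :: "real \<Rightarrow> real \<Rightarrow> 'a measure"
    and X :: "real \<Rightarrow> 'a \<Rightarrow> real"
    and \<sigma>\<^sub>0 \<alpha>\<^sub>0 \<theta>\<^sub>0 :: real
  assumes "0 < \<sigma>\<^sub>0" and "0 < \<alpha>\<^sub>0" and "\<theta>\<^sub>0 = \<sigma>\<^sub>0\<^sup>2 * \<alpha>\<^sub>0"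
    and "matern_gp_family P X"
  shows "varsigma \<longlonglongrightarrow> 0 \<and>
    (\<forall>\<^sub>F n in sequentially.
       (SUP \<alpha>\<in>{alpha_lower n..alpha_upper n}.
          max (ratio_dev n (\<lambda>s. mspe (P (\<theta>\<^sub>0 / \<alpha>) \<alpha>) n X s \<alpha>)
                           (\<lambda>s. mspe (P (\<sigma>\<^sub>0\<^sup>2) \<alpha>\<^sub>0) n X s \<alpha>))
              (ratio_dev n (\<lambda>s. mspe (P (\<theta>\<^sub>0 / \<alpha>) \<alpha>) n X s \<alpha>)
                           (\<lambda>s. mspe (P (\<sigma>\<^sub>0\<^sup>2) \<alpha>\<^sub>0) n X s \<alpha>\<^sub>0)))
         \<le> ereal (varsigma n)) \<and>
    (\<forall>\<pi> \<rho>.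
       cond_prior_regular \<theta>\<^sub>0 \<pi> \<longrightarrow>
       cond_prior_growth \<theta>\<^sub>0 \<pi> \<longrightarrow>
       range_prior_cond \<theta>\<^sub>0 \<alpha>\<^sub>0 \<pi> \<rho> \<longrightarrow>
       sites_fill \<longrightarrow>
       (AE \<omega> in P (\<sigma>\<^sub>0\<^sup>2) \<alpha>\<^sub>0.
          (\<lambda>n. measure (posterior \<pi> \<rho> n (obs n X \<omega>))
             {(\<theta>, \<alpha>). 0 < \<theta> \<and> 0 < \<alpha> \<and>
                ratio_dev n (\<lambda>s. mspe (P (\<theta> / \<alpha>) \<alpha>) n X s \<alpha>)
                            (\<lambda>s. mspe (P (\<sigma>\<^sub>0\<^sup>2) \<alpha>\<^sub>0) n X s \<alpha>)
                  > ereal (6 * real n powr (- 1 / 2 + (\<kappa>\<^sub>u + \<kappa>\<^sub>l / 2)))}) \<longlonglongrightarrow> 0) \<and>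
       (AE \<omega> in P (\<sigma>\<^sub>0\<^sup>2) \<alpha>\<^sub>0.
          (\<lambda>n. measure (posterior \<pi> \<rho> n (obs n X \<omega>))
             {(\<theta>, \<alpha>). 0 < \<theta> \<and> 0 < \<alpha> \<and>
                ratio_dev n (\<lambda>s. mspe (P (\<theta> / \<alpha>) \<alpha>) n X s \<alpha>)
                            (\<lambda>s. mspe (P (\<sigma>\<^sub>0\<^sup>2) \<alpha>\<^sub>0) n X s \<alpha>\<^sub>0)
                  > ereal (6 * real n powr (- 1 / 2 + (\<kappa>\<^sub>u + \<kappa>\<^sub>l / 2)))}) \<longlonglongrightarrow> 0))"
proof (intro conjI allI impI)
  show "varsigma \<longlonglongrightarrow> 0" by (rule varsigma_tendsto_0)
  show "\<forall>\<^sub>F n in sequentially.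
       (SUP \<alpha>\<in>{alpha_lower n..alpha_upper n}.
          max (ratio_dev n (\<lambda>s. mspe (P (\<theta>\<^sub>0 / \<alpha>) \<alpha>) n X s \<alpha>)
                           (\<lambda>s. mspe (P (\<sigma>\<^sub>0\<^sup>2) \<alpha>\<^sub>0) n X s \<alpha>))
              (ratio_dev n (\<lambda>s. mspe (P (\<theta>\<^sub>0 / \<alpha>) \<alpha>) n X s \<alpha>)
                           (\<lambda>s. mspe (P (\<sigma>\<^sub>0\<^sup>2) \<alpha>\<^sub>0) n X s \<alpha>\<^sub>0)))
         \<le> ereal (varsigma n)"
    using mspe_ratio_eventually[OF assms(4,1,2)]
    by eventually_elim (auto simp: ratio_dev_def assms(3) intro!: SUP_least)
next
  fix \<pi> \<rho>
  assume "cond_prior_regular \<theta>\<^sub>0 \<pi>" "cond_prior_growth \<theta>\<^sub>0 \<pi>" "range_prior_cond \<theta>\<^sub>0 \<alpha>\<^sub>0 \<pi> \<rho>"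
  note post = AE_posterior_ratio_dev[OF assms(1,2,3,4) this]
  show "AE \<omega> in P (\<sigma>\<^sub>0\<^sup>2) \<alpha>\<^sub>0.
          (\<lambda>n. measure (posterior \<pi> \<rho> n (obs n X \<omega>))
             {(\<theta>, \<alpha>). 0 < \<theta> \<and> 0 < \<alpha> \<and>
                ratio_dev n (\<lambda>s. mspe (P (\<theta> / \<alpha>) \<alpha>) n X s \<alpha>)
                            (\<lambda>s. mspe (P (\<sigma>\<^sub>0\<^sup>2) \<alpha>\<^sub>0) n X s \<alpha>)
                  > ereal (6 * real n powr (- 1 / 2 + (\<kappa>\<^sub>u + \<kappa>\<^sub>l / 2)))}) \<longlonglongrightarrow> 0"
    by (rule post) simp
  show "AE \<omega> in P (\<sigma>\<^sub>0\<^sup>2) \<alpha>\<^sub>0.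
          (\<lambda>n. measure (posterior \<pi> \<rho> n (obs n X \<omega>))
             {(\<theta>, \<alpha>). 0 < \<theta> \<and> 0 < \<alpha> \<and>
                ratio_dev n (\<lambda>s. mspe (P (\<theta> / \<alpha>) \<alpha>) n X s \<alpha>)
                            (\<lambda>s. mspe (P (\<sigma>\<^sub>0\<^sup>2) \<alpha>\<^sub>0) n X s \<alpha>\<^sub>0)
                  > ereal (6 * real n powr (- 1 / 2 + (\<kappa>\<^sub>u + \<kappa>\<^sub>l / 2)))}) \<longlonglongrightarrow> 0"
    by (rule post) simp
qed

end
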